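(* Let $\mathcal{O}$ be an $\mathcal{ALCH}$ ontology, $C_0,D_0$ be $\mathcal{ALC}$ concepts, and $\Sigma$ be a signature. If there is an $\mathcal{ALC}(\Sigma)$ interpolant for $\mathcal{O}\models C_0\sqsubseteq D_0$, then the DAG representation of such an interpolant can be constructed in time double exponential in $|\mathcal{O}|+|C_0|+|D_0|$.
   Context: $\mathcal{ALC}$ concepts are built by $C,D ::= \top \mid A \mid \neg C \mid C\sqcap D \mid \exists r.C$ with $A$ a concept name and $r$ a role name, with standard semantics. An $\mathcal{ALCH}$ ontology is a finite set of $\mathcal{ALC}$ concept inclusions $C\sqsubseteq D$ and role inclusions $r\sqsubseteq s$ ($r,s$ role names); $\mathcal{O}\models C\sqsubseteq D$ means $C^{\mathcal{I}}\subseteq D^{\mathcal{I}}$ in every model $\mathcal{I}$ of $\mathcal{O}$. A signature is a set $\Sigma$ of concept and role names; an $\mathcal{ALC}(\Sigma)$ concept uses only names from $\Sigma$. An $\mathcal{ALC}(\Sigma)$ interpolant for $\mathcal{O}\models C\sqsubseteq D$ is an $\mathcal{ALC}(\Sigma)$ concept $E$ with $\mathcal{O}\models C\sqsubseteq E$ and $\mathcal{O}\models E\sqsubseteq D$. $|X|$ denotes the number of symbols needed to write $X$. The DAG representation of a concept shares identical subconcepts, so its size is the number of distinct subconcepts. *)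

theory Defs
  imports "HOL-Computational_Algebra.Polynomial"
begin

section \<open>Syntax\<close>

type_synonym cname = nat
type_synonym rname = nat

datatype concept =
    Top
  | Name cname
  | Neg concept
  | And concept concept
  | Exists rname concept

datatype axiom =
    CI concept concept
  | RI rname rname

type_synonym ontology = "axiom set"

text \<open>Concept names and role names are kept disjoint by tagging.\<close>

datatype symb = CSym cname | RSym rname

fun sig_concept :: "concept \<Rightarrow> symb set" where
  "sig_concept Top = {}"
| "sig_concept (Name A) = {CSym A}"
| "sig_concept (Neg C) = sig_concept C"
| "sig_concept (And C D) = sig_concept C \<union> sig_concept D"
| "sig_concept (Exists r C) = insert (RSym r) (sig_concept C)"

fun sig_axiom :: "axiom \<Rightarrow> symb set" where
  "sig_axiom (CI C D) = sig_concept C \<union> sig_concept D"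
| "sig_axiom (RI r s) = {RSym r, RSym s}"

definition sig_ontology :: "ontology \<Rightarrow> symb set" where
  "sig_ontology \<O> = (\<Union>ax\<in>\<O>. sig_axiom ax)"

fun subconcepts :: "concept \<Rightarrow> concept set" where
  "subconcepts Top = {Top}"
| "subconcepts (Name A) = {Name A}"
| "subconcepts (Neg C) = insert (Neg C) (subconcepts C)"
| "subconcepts (And C D) = insert (And C D) (subconcepts C \<union> subconcepts D)"
| "subconcepts (Exists r C) = insert (Exists r C) (subconcepts C)"

text \<open>Number of symbols; every concept name and role name counts as one symbol.\<close>

fun concept_size :: "concept \<Rightarrow> nat" where
  "concept_size Top = 1"
| "concept_size (Name A) = 1"
| "concept_size (Neg C) = 1 + concept_size C"
| "concept_size (And C D) = 1 + concept_size C + concept_size D"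
| "concept_size (Exists r C) = 2 + concept_size C"

fun axiom_size :: "axiom \<Rightarrow> nat" where
  "axiom_size (CI C D) = 1 + concept_size C + concept_size D"
| "axiom_size (RI r s) = 3"

definition ontology_size :: "ontology \<Rightarrow> nat" where
  "ontology_size \<O> = (\<Sum>ax\<in>\<O>. axiom_size ax)"

section \<open>Semantics\<close>

record 'd interp =
  domain :: "'d set"
  conc :: "cname \<Rightarrow> 'd set"
  role :: "rname \<Rightarrow> ('d \<times> 'd) set"

definition is_interp :: "'d interp \<Rightarrow> bool" where
  "is_interp I \<longleftrightarrow> domain I \<noteq> {} \<and> (\<forall>A. conc I A \<subseteq> domain I) \<and> (\<forall>r. role I r \<subseteq> domain I \<times> domain I)"

fun ext :: "'d interp \<Rightarrow> concept \<Rightarrow> 'd set" where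
  "ext I Top = domain I"
| "ext I (Name A) = conc I A"
| "ext I (Neg C) = domain I - ext I C"
| "ext I (And C D) = ext I C \<inter> ext I D"
| "ext I (Exists r C) = {d \<in> domain I. \<exists>e. (d, e) \<in> role I r \<and> e \<in> ext I C}"

fun satisfies :: "'d interp \<Rightarrow> axiom \<Rightarrow> bool" where
  "satisfies I (CI C D) \<longleftrightarrow> ext I C \<subseteq> ext I D"
| "satisfies I (RI r s) \<longleftrightarrow> role I r \<subseteq> role I s"

definition is_model :: "'d interp \<Rightarrow> ontology \<Rightarrow> bool" where
  "is_model I \<O> \<longleftrightarrow> is_interp I \<and> (\<forall>ax\<in>\<O>. satisfies I ax)"

text \<open>
  HOL cannot quantify over all types inside a formula, so the models range over all
  interpretations whose domain is a nonempty set of natural numbers. For finite ontologies this is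
  no restriction: by \<open>entails_all_models\<close> below (proved by filtration), such an entailment
  holds in the models over an arbitrary domain type.
\<close>

definition entails :: "ontology \<Rightarrow> concept \<Rightarrow> concept \<Rightarrow> bool" where
  "entails \<O> C D \<longleftrightarrow> (\<forall>I :: nat interp. is_model I \<O> \<longrightarrow> ext I C \<subseteq> ext I D)"

lemma finite_subconcepts: "finite (subconcepts C)"
  by (induction C) auto

lemma subconcepts_self: "C \<in> subconcepts C"
  by (cases C) auto

fun axiom_subconcepts :: "axiom \<Rightarrow> concept set" where
  "axiom_subconcepts (CI C D) = subconcepts C \<union> subconcepts D"
| "axiom_subconcepts (RI r s) = {}"

lemma ext_subset_dom: "is_interp I \<Longrightarrow> ext I C \<subseteq> domain I"
  by (induction C) (auto simp: is_interp_def)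

lemma ext_filtration:
  fixes I :: "'d interp" and h :: "'d \<Rightarrow> nat"
  assumes I: "is_interp I"
    and h: "\<And>d e F. d \<in> domain I \<Longrightarrow> e \<in> domain I \<Longrightarrow> h d = h e \<Longrightarrow> F \<in> S
      \<Longrightarrow> d \<in> ext I F \<longleftrightarrow> e \<in> ext I F"
    and J: "J = \<lparr>domain = h ` domain I, conc = \<lambda>A. h ` conc I A, role = \<lambda>r. map_prod h h ` role I r\<rparr>"
  shows "subconcepts C \<subseteq> S \<Longrightarrow> d \<in> domain I \<Longrightarrow> h d \<in> ext J C \<longleftrightarrow> d \<in> ext I C"
proof (induction C arbitrary: d)
  case Top
  then show ?case by (simp add: J)
next
  case (Name A)
  have A: "conc I A \<subseteq> domain I" using I by (auto simp: is_interp_def)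
  have "d \<in> conc I A" if "h d = h e" "e \<in> conc I A" for e
    using h[of d e "Name A"] that Name A by auto
  then show ?case by (auto simp: J)
next
  case (Neg C)
  then show ?case by (auto simp: J)
next
  case (And C D)
  then show ?case by auto
next
  case (Exists r C)
  have R: "role I r \<subseteq> domain I \<times> domain I" using I by (auto simp: is_interp_def)
  have roleJ: "role J r = map_prod h h ` role I r" by (simp add: J)
  have domJ: "domain J = h ` domain I" by (simp add: J)
  have C: "subconcepts C \<subseteq> S" and EC: "Exists r C \<in> S" using Exists.prems by auto
  show ?case
  proof
    assume "h d \<in> ext J (Exists r C)"
    then obtain d' e' where de: "(d', e') \<in> role I r" "h d' = h d" "h e' \<in> ext J C"
      by (auto simp: roleJ)
    then have "d' \<in> domain I" "e' \<in> domain I" using R by auto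
    moreover from this have "e' \<in> ext I C" using Exists.IH[OF C] de by auto
    ultimately have "d' \<in> ext I (Exists r C)" using de by auto
    then show "d \<in> ext I (Exists r C)"
      using h[of d' d, OF \<open>d' \<in> domain I\<close> Exists.prems(2) de(2) EC] by auto
  next
    assume "d \<in> ext I (Exists r C)"
    then obtain e where e: "(d, e) \<in> role I r" "e \<in> ext I C" by auto
    then have "h e \<in> ext J C" using R Exists.IH[OF C] by auto
    moreover have "(h d, h e) \<in> role J r" using e by (force simp: roleJ)
    ultimately show "h d \<in> ext J (Exists r C)" using Exists.prems by (auto simp: domJ)
  qed
qed

lemma entails_all_models:
  fixes I :: "'d interp"
  assumes fin: "finite \<O>" and ent: "entails \<O> C D" and mod: "is_model I \<O>"
  shows "ext I C \<subseteq> ext I D"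
proof
  fix x assume x: "x \<in> ext I C"
  have I: "is_interp I" using mod by (simp add: is_model_def)
  define S where "S = subconcepts C \<union> subconcepts D \<union> (\<Union>ax\<in>\<O>. axiom_subconcepts ax)"
  have "finite (axiom_subconcepts ax)" for ax by (cases ax) (auto simp: finite_subconcepts)
  then have "finite S" using fin by (auto simp: S_def finite_subconcepts)
  then obtain g :: "concept set \<Rightarrow> nat" where g: "inj_on g (Pow S)"
    using finite_imp_inj_to_nat_seg[of "Pow S"] by auto
  define h where "h d = g {F \<in> S. d \<in> ext I F}" for d
  define J :: "nat interp" where
    "J = \<lparr>domain = h ` domain I, conc = \<lambda>A. h ` conc I A, role = \<lambda>r. map_prod h h ` role I r\<rparr>"
  have h: "d \<in> ext I F \<longleftrightarrow> e \<in> ext I F" if "h d = h e" "F \<in> S" for d e F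
  proof -
    have "{F \<in> S. d \<in> ext I F} = {F \<in> S. e \<in> ext I F}"
      using that(1) unfolding h_def by (intro inj_onD[OF g]) auto
    then show ?thesis using that(2) by blast
  qed
  have truth: "h d \<in> ext J F \<longleftrightarrow> d \<in> ext I F" if "subconcepts F \<subseteq> S" "d \<in> domain I" for F d
    by (rule ext_filtration[OF I _ J_def that]) (use h in blast)
  have J: "is_interp J" using I unfolding is_interp_def J_def by fastforce
  have "satisfies J ax" if ax: "ax \<in> \<O>" for ax
  proof (cases ax)
    case (CI F G)
    have "subconcepts F \<subseteq> S" "subconcepts G \<subseteq> S" using ax CI by (force simp: S_def)+
    moreover have "ext I F \<subseteq> ext I G" using mod ax CI by (force simp: is_model_def)
    moreover have "ext J F \<subseteq> h ` domain I" using ext_subset_dom[OF J, of F] by (simp add: J_def)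
    ultimately have "ext J F \<subseteq> ext J G" using truth by blast
    then show ?thesis using CI by simp
  next
    case (RI r s)
    then have "role I r \<subseteq> role I s" using mod ax by (force simp: is_model_def)
    then show ?thesis using RI by (auto simp: J_def)
  qed
  then have "is_model J \<O>" using J by (simp add: is_model_def)
  then have "ext J C \<subseteq> ext J D" using ent by (auto simp: entails_def)
  moreover have "x \<in> domain I" using x ext_subset_dom[OF I] by auto
  moreover have "subconcepts C \<subseteq> S" "subconcepts D \<subseteq> S" by (auto simp: S_def)
  ultimately show "x \<in> ext I D" using truth x by blast
qed

definition is_interpolant :: "ontology \<Rightarrow> concept \<Rightarrow> concept \<Rightarrow> symb set \<Rightarrow> concept \<Rightarrow> bool" where
  "is_interpolant \<O> C D \<Sigma> E \<longleftrightarrow> sig_concept E \<subseteq> \<Sigma> \<and> entails \<O> C E \<and> entails \<O> E D"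

section \<open>DAG representation of concepts\<close>

text \<open>
  A DAG is a list of nodes in which a node refers to its children by their positions. Children
  precede their parents and the root is the last node. The nodes of the DAG representation of
  \<open>E\<close> are in bijection with the distinct subconcepts of \<open>E\<close>: the witness \<open>Cs\<close> lists the concept
  denoted by each node.
\<close>

datatype node = NTop | NName cname | NNeg nat | NAnd nat nat | NExists rname nat

fun children :: "node \<Rightarrow> nat set" where
  "children NTop = {}"
| "children (NName A) = {}"
| "children (NNeg i) = {i}"
| "children (NAnd i j) = {i, j}"
| "children (NExists r i) = {i}"

fun node_concept :: "concept list \<Rightarrow> node \<Rightarrow> concept" where
  "node_concept Cs NTop = Top"
| "node_concept Cs (NName A) = Name A"
| "node_concept Cs (NNeg i) = Neg (Cs ! i)"
| "node_concept Cs (NAnd i j) = And (Cs ! i) (Cs ! j)"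
| "node_concept Cs (NExists r i) = Exists r (Cs ! i)"

definition is_dag_of :: "node list \<Rightarrow> concept \<Rightarrow> bool" where
  "is_dag_of ns E \<longleftrightarrow>
    (\<exists>Cs. length Cs = length ns
      \<and> (\<forall>k < length ns. (\<forall>i\<in>children (ns ! k). i < k) \<and> Cs ! k = node_concept Cs (ns ! k))
      \<and> distinct Cs \<and> set Cs = subconcepts E \<and> last Cs = E)"

section \<open>Model of computation\<close>

text \<open>
  Algorithms are programs of a first-order, call-by-value functional language over S-expressions
  (pure first-order LISP). Atoms can only be copied and compared for equality, and programs contain
  no atom constants. A program is a list of function bodies; a call \<open>Call f es\<close> evaluates
  \<open>es\<close> and then the body of function \<open>f\<close> in the environment consisting of the argument values.
  Evaluating an expression costs at least the full size of the value it produces (sharing is not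
  exploited), so both the space used and the size of the output are bounded by the time. Hence, with
  the \<open>n\<close> atoms of an input written as \<open>log n\<close>-bit strings, running times agree with those of
  Turing machines up to a polynomial.
\<close>

datatype sexp = Nl | Atom nat | Pr sexp sexp

fun sexp_size :: "sexp \<Rightarrow> nat" where
  "sexp_size Nl = 1"
| "sexp_size (Atom a) = 1"
| "sexp_size (Pr u v) = 1 + sexp_size u + sexp_size v"

fun car :: "sexp \<Rightarrow> sexp" where
  "car (Pr u v) = u"
| "car Nl = Nl"
| "car (Atom a) = Nl"

fun cdr :: "sexp \<Rightarrow> sexp" where
  "cdr (Pr u v) = v"
| "cdr Nl = Nl"
| "cdr (Atom a) = Nl"

definition sexp_of_bool :: "bool \<Rightarrow> sexp" where
  "sexp_of_bool b = (if b then Pr Nl Nl else Nl)"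

datatype expr =
    Arg nat
  | Null
  | MkPair expr expr
  | Car expr
  | Cdr expr
  | Equal expr expr
  | Cond expr expr expr
  | Call nat "expr list"

type_synonym program = "expr list"

text \<open>\<open>evaluates P env e v t\<close>: evaluating \<open>e\<close> terminates with result \<open>v\<close> after time \<open>t\<close>.\<close>

inductive
  evaluates :: "program \<Rightarrow> sexp list \<Rightarrow> expr \<Rightarrow> sexp \<Rightarrow> nat \<Rightarrow> bool" and
  evaluates_list :: "program \<Rightarrow> sexp list \<Rightarrow> expr list \<Rightarrow> sexp list \<Rightarrow> nat \<Rightarrow> bool"
  for P :: program
where
  ev_Arg: "i < length env \<Longrightarrow> evaluates P env (Arg i) (env ! i) (sexp_size (env ! i))"
| ev_Null: "evaluates P env Null Nl 1"
| ev_MkPair: "evaluates P env a u s \<Longrightarrow> evaluates P env b v t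
    \<Longrightarrow> evaluates P env (MkPair a b) (Pr u v) (s + t + sexp_size (Pr u v))"
| ev_Car: "evaluates P env a u t \<Longrightarrow> evaluates P env (Car a) (car u) (t + sexp_size (car u))"
| ev_Cdr: "evaluates P env a u t \<Longrightarrow> evaluates P env (Cdr a) (cdr u) (t + sexp_size (cdr u))"
| ev_Equal: "evaluates P env a u s \<Longrightarrow> evaluates P env b v t
    \<Longrightarrow> evaluates P env (Equal a b) (sexp_of_bool (u = v))
          (s + t + sexp_size (sexp_of_bool (u = v)))"
| ev_Cond_true: "evaluates P env c w s \<Longrightarrow> w \<noteq> Nl \<Longrightarrow> evaluates P env a u t
    \<Longrightarrow> evaluates P env (Cond c a b) u (s + t + 1)"
| ev_Cond_false: "evaluates P env c Nl s \<Longrightarrow> evaluates P env b u t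
    \<Longrightarrow> evaluates P env (Cond c a b) u (s + t + 1)"
| ev_Call: "f < length P \<Longrightarrow> evaluates_list P env es vs s \<Longrightarrow> evaluates P vs (P ! f) u t
    \<Longrightarrow> evaluates P env (Call f es) u (s + t + 1)"
| ev_list_Nil: "evaluates_list P env [] [] 0"
| ev_list_Cons: "evaluates P env e v s \<Longrightarrow> evaluates_list P env es vs t
    \<Longrightarrow> evaluates_list P env (e # es) (v # vs) (s + t)"

lemma evaluates_deterministic:
  "evaluates P env e v t \<Longrightarrow> (\<And>v' t'. evaluates P env e v' t' \<Longrightarrow> v' = v \<and> t' = t)"
  "evaluates_list P env es vs t
    \<Longrightarrow> (\<And>vs' t'. evaluates_list P env es vs' t' \<Longrightarrow> vs' = vs \<and> t' = t)"
proof (induction rule: evaluates_evaluates_list.inducts)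
  case ev_Arg
  from ev_Arg.prems show ?case by cases auto
next
  case ev_Null
  from ev_Null.prems show ?case by cases auto
next
  case ev_MkPair
  from ev_MkPair.prems show ?case by cases (use ev_MkPair in \<open>metis\<close>)+
next
  case ev_Car
  from ev_Car.prems show ?case by cases (use ev_Car in \<open>metis\<close>)+
next
  case ev_Cdr
  from ev_Cdr.prems show ?case by cases (use ev_Cdr in \<open>metis\<close>)+
next
  case ev_Equal
  from ev_Equal.prems show ?case by cases (use ev_Equal in \<open>metis\<close>)+
next
  case ev_Cond_true
  from ev_Cond_true.prems show ?case by cases (use ev_Cond_true in \<open>metis\<close>)+
next
  case ev_Cond_false
  from ev_Cond_false.prems show ?case by cases (use ev_Cond_false in \<open>metis\<close>)+
next
  case ev_Call
  from ev_Call.prems show ?case by cases (use ev_Call in \<open>metis\<close>)+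
next
  case ev_list_Nil
  from ev_list_Nil.prems show ?case by cases auto
next
  case ev_list_Cons
  from ev_list_Cons.prems show ?case by cases (use ev_list_Cons in \<open>metis\<close>)+
qed

lemma sexp_size_le_time:
  "evaluates P env e v t \<Longrightarrow> sexp_size v \<le> t"
  "evaluates_list P env es vs t \<Longrightarrow> True"
  by (induction rule: evaluates_evaluates_list.inducts) auto

text \<open>Function 0 is the entry point, applied to the whole input as its single argument.\<close>

definition computes :: "program \<Rightarrow> sexp \<Rightarrow> sexp \<Rightarrow> nat \<Rightarrow> bool" where
  "computes P inp out t \<longleftrightarrow> P \<noteq> [] \<and> evaluates P [inp] (P ! 0) out t"

definition at_most_double_exponential :: "nat poly \<Rightarrow> nat \<Rightarrow> nat \<Rightarrow> bool" where
  "at_most_double_exponential p n t \<longleftrightarrow> t \<le> 2 ^ (2 ^ poly p n)"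

section \<open>Encoding of inputs and outputs\<close>

text \<open>Tags and node positions are written in unary.\<close>

fun enc_nat :: "nat \<Rightarrow> sexp" where
  "enc_nat 0 = Nl"
| "enc_nat (Suc n) = Pr Nl (enc_nat n)"

fun enc_list :: "('a \<Rightarrow> sexp) \<Rightarrow> 'a list \<Rightarrow> sexp" where
  "enc_list f [] = Nl"
| "enc_list f (x # xs) = Pr (f x) (enc_list f xs)"

fun enc_concept :: "concept \<Rightarrow> sexp" where
  "enc_concept Top = Pr (enc_nat 0) Nl"
| "enc_concept (Name A) = Pr (enc_nat 1) (Atom A)"
| "enc_concept (Neg C) = Pr (enc_nat 2) (enc_concept C)"
| "enc_concept (And C D) = Pr (enc_nat 3) (Pr (enc_concept C) (enc_concept D))"
| "enc_concept (Exists r C) = Pr (enc_nat 4) (Pr (Atom r) (enc_concept C))"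

fun enc_axiom :: "axiom \<Rightarrow> sexp" where
  "enc_axiom (CI C D) = Pr (enc_nat 0) (Pr (enc_concept C) (enc_concept D))"
| "enc_axiom (RI r s) = Pr (enc_nat 1) (Pr (Atom r) (Atom s))"

fun enc_symb :: "symb \<Rightarrow> sexp" where
  "enc_symb (CSym A) = Pr (enc_nat 0) (Atom A)"
| "enc_symb (RSym r) = Pr (enc_nat 1) (Atom r)"

fun enc_node :: "node \<Rightarrow> sexp" where
  "enc_node NTop = Pr (enc_nat 0) Nl"
| "enc_node (NName A) = Pr (enc_nat 1) (Atom A)"
| "enc_node (NNeg i) = Pr (enc_nat 2) (enc_nat i)"
| "enc_node (NAnd i j) = Pr (enc_nat 3) (Pr (enc_nat i) (enc_nat j))"
| "enc_node (NExists r i) = Pr (enc_nat 4) (Pr (Atom r) (enc_nat i))"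

definition enc_dag :: "node list \<Rightarrow> sexp" where
  "enc_dag ns = enc_list enc_node ns"

text \<open>
  The finite sets \<open>\<O>\<close> and \<open>\<Sigma>\<close> are presented to a program as repetition-free lists, in any
  order. A signature may be infinite, or finite but arbitrarily large compared to
  \<open>\<O>\<close>, \<open>C\<close>, \<open>D\<close>; the program is given only the symbols of \<open>\<Sigma>\<close> that occur in \<open>\<O>\<close>, \<open>C\<close>, \<open>D\<close>,
  that is, it knows for each symbol of the input whether it belongs to \<open>\<Sigma>\<close>.
\<close>

definition is_input :: "ontology \<Rightarrow> concept \<Rightarrow> concept \<Rightarrow> symb set \<Rightarrow> sexp \<Rightarrow> bool" where
  "is_input \<O> C D \<Sigma> inp \<longleftrightarrow>
    (\<exists>axs syms. distinct axs \<and> set axs = \<O>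
      \<and> distinct syms \<and> set syms = \<Sigma> \<inter> (sig_ontology \<O> \<union> sig_concept C \<union> sig_concept D)
      \<and> inp = Pr (enc_list enc_axiom axs)
                (Pr (enc_concept C) (Pr (enc_concept D) (enc_list enc_symb syms))))"

end

theory Submission
  imports Defs
begin

text \<open>
  A type is a set of subconcepts of the input. Each point \<open>d\<close> of an interpretation has a sequence of
  views, which are sets of types: view 0 consists of all types, and a type belongs to view \<open>n + 1\<close> if it
  agrees with \<open>d\<close> on the concept names in \<open>\<Sigma>\<close> and can be matched with the views \<open>n\<close> of the
  \<open>\<Sigma>\<close>-successors of \<open>d\<close> in accordance with the role hierarchy. Membership of \<open>t\<close> in view \<open>n\<close> is
  expressed by a concept \<open>F\<^sub>n t\<close> over \<open>\<Sigma>\<close>, which is obtained from the concepts of level \<open>n - 1\<close> by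
  double exponentially many Boolean operations and existential restrictions.

  The views of level \<open>n\<close> that occur in models of the ontology belong to the \<open>n\<close>-th member of a decreasing
  sequence of sets of views, which is stationary from some double exponential \<open>N\<close> on. From the stationary
  views one builds a model in which all types of a view are realized by \<open>\<Sigma>\<close>-bisimilar points. So if an
  interpolant exists, no stationary view contains both a type with \<open>C\<^sub>0\<close> and a type without \<open>D\<^sub>0\<close>, and
  the disjunction of \<open>F\<^sub>N t\<close> over the types \<open>t\<close> containing \<open>C\<^sub>0\<close> is an interpolant.

  The concepts are computed by a straight-line program over registers, whose values are then
  hash-consed into a DAG. Apart from forming two powersets (of the set of subconcepts and of the set of
  types), every step of the algorithm takes polynomial time.
\<close>

section \<open>Polynomial bounds\<close>

text \<open>The type of a point lies in every view of that point. This yields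
  \<open>C\<^sub>0\<close> below the disjunction. Conversely, if the view of a point at level
  \<open>N\<close> contains a type with \<open>C\<^sub>0\<close>, it also contains the point's own
  type, which therefore contains \<open>D\<^sub>0\<close>. The existence of some interpolant enters
  only in the model of stationary views: its bisimilar points agree on every concept over \<Sigma>,
  so they cannot realize both \<open>C\<^sub>0\<close> and the complement of
  \<open>D\<^sub>0\<close>. Views are sets of types because a concept over \<Sigma> cannot tell
  which of several types a point has, only which types its bisimulation class admits. Two obstacles
  shape the computational half. Recursion along trees is the only loop whose time is easily bounded,
  so least and greatest fixpoints are expressed by quantification over listed powersets, and level
  iteration by a loop over a list of sufficient length. And the nodes of the output must be pairwise
  distinct subconcepts of the root, although the straight-line program also produces auxiliary
  values that need not occur in its result.\<close>

lemma poly_mono_nat: "m \<le> n \<Longrightarrow> poly p m \<le> poly p (n::nat)"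
  by (induction p) (auto intro: add_mono mult_mono)

text \<open>Running times arise as nested expressions; closure properties of \<open>pbounded\<close>
  make it unnecessary to exhibit the polynomials.\<close>

definition pbounded :: "(nat \<Rightarrow> nat) \<Rightarrow> bool" where
  "pbounded T \<longleftrightarrow> (\<exists>p. \<forall>n. T n \<le> poly p n)"

lemma pbounded_poly: "pbounded (poly p)"
  by (auto simp: pbounded_def)

lemma pbounded_const: "pbounded (\<lambda>n. c)"
  unfolding pbounded_def by (rule exI[of _ "[:c:]"]) simp

lemma pbounded_id: "pbounded (\<lambda>n. n)"
  unfolding pbounded_def by (rule exI[of _ "[:0, 1:]"]) simp

lemma pbounded_add: "pbounded S \<Longrightarrow> pbounded T \<Longrightarrow> pbounded (\<lambda>n. S n + T n)"
  unfolding pbounded_def by (metis add_mono poly_add)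

lemma pbounded_mult: "pbounded S \<Longrightarrow> pbounded T \<Longrightarrow> pbounded (\<lambda>n. S n * T n)"
  unfolding pbounded_def by (metis mult_le_mono poly_mult)

lemma pbounded_comp: "pbounded T \<Longrightarrow> pbounded (\<lambda>n. poly p (T n))"
  unfolding pbounded_def by (metis poly_mono_nat poly_pcompose)

lemma pbounded_Suc: "pbounded T \<Longrightarrow> pbounded (\<lambda>n. Suc (T n))"
  using pbounded_add[OF _ pbounded_const[of 1]] by simp

lemmas pbounded_intros = pbounded_poly pbounded_const pbounded_id pbounded_add pbounded_mult
  pbounded_comp pbounded_Suc

section \<open>Programs and running times\<close>

text \<open>Calls refer to absolute positions in the program, so placing a program behind another
  one requires renumbering its calls.\<close>

fun shift :: "nat \<Rightarrow> expr \<Rightarrow> expr" where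
  "shift m (Arg i) = Arg i"
| "shift m Null = Null"
| "shift m (MkPair a b) = MkPair (shift m a) (shift m b)"
| "shift m (Car a) = Car (shift m a)"
| "shift m (Cdr a) = Cdr (shift m a)"
| "shift m (Equal a b) = Equal (shift m a) (shift m b)"
| "shift m (Cond c a b) = Cond (shift m c) (shift m a) (shift m b)"
| "shift m (Call f es) = Call (f + m) (map (shift m) es)"

lemma evaluates_shift:
  "evaluates P env e v t \<Longrightarrow>
    evaluates (Q @ map (shift (length Q)) P @ R) env (shift (length Q) e) v t"
  "evaluates_list P env es vs t \<Longrightarrow>
    evaluates_list (Q @ map (shift (length Q)) P @ R) env (map (shift (length Q)) es) vs t"
proof (induction rule: evaluates_evaluates_list.inducts)
  case (ev_Call f env es vs s u t)
  have "evaluates (Q @ map (shift (length Q)) P @ R) env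
      (Call (f + length Q) (map (shift (length Q)) es)) u (s + t + 1)"
    by (rule evaluates_evaluates_list.ev_Call[where vs = vs])
      (use ev_Call in \<open>auto simp: nth_append\<close>)
  then show ?case by simp
next
  case ev_Cond_true
  then show ?case unfolding shift.simps by (intro evaluates_evaluates_list.ev_Cond_true)
next
  case ev_Cond_false
  then show ?case unfolding shift.simps by (intro evaluates_evaluates_list.ev_Cond_false)
qed (simp only: shift.simps list.map, intro evaluates_evaluates_list.intros; assumption)+

lemma shift_0: "shift 0 e = e"
  by (induction e) (auto simp: map_idI)

lemma evaluates_append: "evaluates P env e v t \<Longrightarrow> evaluates (P @ R) env e v t"
  using evaluates_shift(1)[of P env e v t "[]" R] by (simp add: shift_0 map_idI)

definition runs :: "program \<Rightarrow> nat \<Rightarrow> (sexp \<Rightarrow> sexp) \<Rightarrow> (nat \<Rightarrow> nat) \<Rightarrow> bool" where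
  "runs P f F T \<longleftrightarrow> f < length P
    \<and> (\<forall>z. \<exists>t \<le> T (sexp_size z). evaluates P [z] (P ! f) (F z) t)"

text \<open>The bound holds on all S-expressions, not only on codes of inputs, so functions compose
  freely. Several arguments are packed into one pair.\<close>

definition timed :: "(sexp \<Rightarrow> sexp) \<Rightarrow> (nat \<Rightarrow> nat) \<Rightarrow> bool" where
  "timed F T \<longleftrightarrow> (\<exists>P f. runs P f F T)"

lemma runs_append: "runs P f F T \<Longrightarrow> runs (P @ R) f F T"
  unfolding runs_def by (auto simp: nth_append) (meson evaluates_append)

lemma runs_shift: "runs P f F T \<Longrightarrow> runs (Q @ map (shift (length Q)) P) (f + length Q) F T"
  unfolding runs_def using evaluates_shift(1)[of P _ _ _ _ Q "[]"]
  by (auto simp: nth_append) meson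

text \<open>Two functions may be assumed to live in one program: the second is shifted behind the
  first.\<close>

lemma timedE2:
  assumes "timed F S" "timed G T"
  obtains P f g where "runs P f F S" "runs P g G T"
  using assms unfolding timed_def by (metis runs_append runs_shift)

lemma timedE3:
  assumes "timed F S" "timed G T" "timed H R"
  obtains P f g h where "runs P f F S" "runs P g G T" "runs P h H R"
proof -
  obtain P f g where "runs P f F S" "runs P g G T" using assms timedE2 by metis
  moreover obtain Q h where "runs Q h H R" using assms by (auto simp: timed_def)
  ultimately show ?thesis using that runs_append runs_shift by metis
qed

lemma timedI:
  assumes "\<And>z. \<exists>t \<le> T (sexp_size z). evaluates (P @ [e]) [z] e (F z) t"
  shows "timed F T"
  unfolding timed_def runs_def
  by (rule exI[of _ "P @ [e]"], rule exI[of _ "length P"]) (use assms in auto)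

lemma runs_call:
  assumes "runs P f F T" "evaluates P env e z s"
  shows "\<exists>t \<le> T (sexp_size z). evaluates P env (Call f [e]) (F z) (s + t + 1)"
proof -
  obtain t where t: "t \<le> T (sexp_size z)" "evaluates P [z] (P ! f) (F z) t" "f < length P"
    using assms by (auto simp: runs_def)
  have "evaluates_list P env [e] [z] (s + 0)"
    by (intro evaluates_evaluates_list.intros assms)
  then have "evaluates P env (Call f [e]) (F z) (s + t + 1)"
    using ev_Call[OF t(3) _ t(2)] by simp
  then show ?thesis using t by blast
qed

lemma sexp_size_car: "sexp_size (car x) \<le> sexp_size x"
  and sexp_size_cdr: "sexp_size (cdr x) \<le> sexp_size x"
  by (cases x; auto)+

lemma sexp_size_of_bool: "sexp_size (sexp_of_bool b) \<le> 3"
  by (auto simp: sexp_of_bool_def)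

lemma evaluates_Arg0: "evaluates P [z] (Arg 0) z (sexp_size z)"
  using ev_Arg[of 0 "[z]"] by simp

lemma timed_mono: "timed F S \<Longrightarrow> (\<And>n. S n \<le> T n) \<Longrightarrow> timed F T"
  unfolding timed_def runs_def by (meson le_trans)

lemma timed_size: "timed F T \<Longrightarrow> sexp_size (F z) \<le> T (sexp_size z)"
  unfolding timed_def runs_def by (meson le_trans sexp_size_le_time(1))

lemma timed_id: "timed (\<lambda>z. z) (\<lambda>n. n)"
  by (rule timedI[of _ "[]" "Arg 0"]) (use evaluates_Arg0 in auto)

lemma timed_Nl: "timed (\<lambda>z. Nl) (\<lambda>n. 1)"
  by (rule timedI[of _ "[]" "Null"]) (use ev_Null in auto)

lemma timed_car: "timed car (\<lambda>n. n + n)"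
  by (rule timedI[of _ "[]" "Car (Arg 0)"])
    (use ev_Car[OF evaluates_Arg0] sexp_size_car in \<open>meson add_le_mono le_refl\<close>)

lemma timed_cdr: "timed cdr (\<lambda>n. n + n)"
  by (rule timedI[of _ "[]" "Cdr (Arg 0)"])
    (use ev_Cdr[OF evaluates_Arg0] sexp_size_cdr in \<open>meson add_le_mono le_refl\<close>)

lemma timed_comp:
  assumes F: "timed F S" and G: "timed G T" and "mono S"
  shows "timed (\<lambda>z. F (G z)) (\<lambda>n. S (T n) + T n + n + 2)"
proof -
  obtain P f g where fg: "runs P f F S" "runs P g G T" using F G timedE2 by metis
  let ?e = "Call f [Call g [Arg 0]]"
  show ?thesis
  proof (rule timedI[of _ P ?e])
    fix z
    obtain t where t: "t \<le> T (sexp_size z)"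
      "evaluates P [z] (Call g [Arg 0]) (G z) (sexp_size z + t + 1)"
      using runs_call[OF fg(2) evaluates_Arg0] by blast
    obtain s where s: "s \<le> S (sexp_size (G z))"
      "evaluates P [z] ?e (F (G z)) (sexp_size z + t + 1 + s + 1)"
      using runs_call[OF fg(1) t(2)] by blast
    \<comment> \<open>A result is never larger than the time spent on it, so \<open>T\<close> also
      bounds the argument of \<open>F\<close>.\<close>
    have "S (sexp_size (G z)) \<le> S (T (sexp_size z))"
      using \<open>mono S\<close> timed_size[OF G] by (auto dest: monoD)
    with s(1) t(1) have "sexp_size z + t + 1 + s + 1 \<le> S (T (sexp_size z)) + T (sexp_size z) +
      sexp_size z + 2"
      by simp
    then show "\<exists>t\<le>S (T (sexp_size z)) + T (sexp_size z) + sexp_size z + 2.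
        evaluates (P @ [?e]) [z] ?e (F (G z)) t"
      using evaluates_append[OF s(2)] by blast
  qed
qed

lemma timed_Pr:
  assumes F: "timed F S" and G: "timed G T"
  shows "timed (\<lambda>z. Pr (F z) (G z)) (\<lambda>n. 2 * S n + 2 * T n + 2 * n + 3)"
proof -
  obtain P f g where fg: "runs P f F S" "runs P g G T" using F G timedE2 by metis
  let ?e = "MkPair (Call f [Arg 0]) (Call g [Arg 0])"
  show ?thesis
  proof (rule timedI[of _ P ?e])
    fix z
    obtain s where s: "s \<le> S (sexp_size z)"
      "evaluates P [z] (Call f [Arg 0]) (F z) (sexp_size z + s + 1)"
      using runs_call[OF fg(1) evaluates_Arg0] by blast
    obtain t where t: "t \<le> T (sexp_size z)"
      "evaluates P [z] (Call g [Arg 0]) (G z) (sexp_size z + t + 1)"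
      using runs_call[OF fg(2) evaluates_Arg0] by blast
    show "\<exists>t\<le>2 * S (sexp_size z) + 2 * T (sexp_size z) + 2 * sexp_size z + 3.
        evaluates (P @ [?e]) [z] ?e (Pr (F z) (G z)) t"
      by (rule exI, rule conjI[rotated], rule evaluates_append[OF ev_MkPair[OF s(2) t(2)]])
        (use s(1) t(1) timed_size[OF F, of z] timed_size[OF G, of z] in simp)
  qed
qed

lemma timed_Equal:
  assumes F: "timed F S" and G: "timed G T"
  shows "timed (\<lambda>z. sexp_of_bool (F z = G z)) (\<lambda>n. S n + T n + 2 * n + 5)"
proof -
  obtain P f g where fg: "runs P f F S" "runs P g G T" using F G timedE2 by metis
  let ?e = "Equal (Call f [Arg 0]) (Call g [Arg 0])"
  show ?thesis
  proof (rule timedI[of _ P ?e])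
    fix z
    obtain s where s: "s \<le> S (sexp_size z)"
      "evaluates P [z] (Call f [Arg 0]) (F z) (sexp_size z + s + 1)"
      using runs_call[OF fg(1) evaluates_Arg0] by blast
    obtain t where t: "t \<le> T (sexp_size z)"
      "evaluates P [z] (Call g [Arg 0]) (G z) (sexp_size z + t + 1)"
      using runs_call[OF fg(2) evaluates_Arg0] by blast
    show "\<exists>t\<le>S (sexp_size z) + T (sexp_size z) + 2 * sexp_size z + 5.
        evaluates (P @ [?e]) [z] ?e (sexp_of_bool (F z = G z)) t"
      by (rule exI, rule conjI[rotated], rule evaluates_append[OF ev_Equal[OF s(2) t(2)]])
        (use s(1) t(1) sexp_size_of_bool[of "F z = G z"] in simp)
  qed
qed

lemma timed_Cond:
  assumes F: "timed F S" and G: "timed G T" and H: "timed H R"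
  shows "timed (\<lambda>z. if F z \<noteq> Nl then G z else H z) (\<lambda>n. S n + T n + R n + 2 * n + 3)"
proof -
  obtain P f g h where fg: "runs P f F S" "runs P g G T" "runs P h H R"
    using F G H timedE3 by metis
  let ?e = "Cond (Call f [Arg 0]) (Call g [Arg 0]) (Call h [Arg 0])"
  show ?thesis
  proof (rule timedI[of _ P ?e])
    fix z
    obtain s where s: "s \<le> S (sexp_size z)"
      "evaluates P [z] (Call f [Arg 0]) (F z) (sexp_size z + s + 1)"
      using runs_call[OF fg(1) evaluates_Arg0] by blast
    obtain t where t: "t \<le> T (sexp_size z)"
      "evaluates P [z] (Call g [Arg 0]) (G z) (sexp_size z + t + 1)"
      using runs_call[OF fg(2) evaluates_Arg0] by blast
    obtain r where r: "r \<le> R (sexp_size z)"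
      "evaluates P [z] (Call h [Arg 0]) (H z) (sexp_size z + r + 1)"
      using runs_call[OF fg(3) evaluates_Arg0] by blast
    show "\<exists>t\<le>S (sexp_size z) + T (sexp_size z) + R (sexp_size z) + 2 * sexp_size z + 3.
        evaluates (P @ [?e]) [z] ?e (if F z \<noteq> Nl then G z else H z) t"
    proof (cases "F z = Nl")
      case True
      have "evaluates P [z] ?e (H z) (sexp_size z + s + 1 + (sexp_size z + r + 1) + 1)"
        using ev_Cond_false s(2) r(2) True by metis
      then have *: "evaluates P [z] ?e (if F z \<noteq> Nl then G z else H z)
          (sexp_size z + s + 1 + (sexp_size z + r + 1) + 1)" using True by simp
      show ?thesis
        by (rule exI, rule conjI[rotated], rule evaluates_append[OF *])
          (use s(1) t(1) r(1) in simp)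
    next
      case False
      show ?thesis unfolding if_P[OF False]
        by (rule exI, rule conjI[rotated], rule evaluates_append[OF ev_Cond_true[OF s(2) False t(2)]])
          (use s(1) t(1) r(1) in simp)
    qed
  qed
qed

section \<open>Tree recursion\<close>

text \<open>The one recursion scheme from which all loops are derived. The step function
  \<open>F\<close> sees the tree itself, the results for both children and the constant parameter
  \<open>z\<close>.\<close>

fun trec :: "(sexp \<Rightarrow> sexp) \<Rightarrow> (sexp \<Rightarrow> sexp) \<Rightarrow> sexp \<Rightarrow> sexp \<Rightarrow> sexp" where
  "trec G F (Pr u v) z = F (Pr (Pr u v) (Pr (Pr (trec G F u z) (trec G F v z)) z))"
| "trec G F Nl z = G (Pr Nl z)"
| "trec G F (Atom a) z = G (Pr (Atom a) z)"

lemma evaluates_cong: "evaluates P env e v t \<Longrightarrow> v = v' \<Longrightarrow> t = t' \<Longrightarrow> evaluates P env e v' t'"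
  by simp

text \<open>The time is the number of tree nodes times the cost per node. That cost depends on the
  sizes of the intermediate results handed to \<open>F\<close>, so an a priori bound
  \<open>B\<close> on results is required.\<close>

lemma timed_trec:
  assumes F: "timed F S" and G: "timed G T" and "mono S" "mono T" "mono B"
    and B: "\<And>x z. sexp_size (trec G F x z) \<le> B (sexp_size x + sexp_size z)"
  shows "timed (\<lambda>z. trec G F (car z) (cdr z))
    (\<lambda>n. (n + 1) * (S (3 * n + 2 * B (n + 1) + 13) + T (Suc (Suc (Suc n))) + 40 * n + 6 * B (n + 1) + 140))"
proof -
  obtain P f g where fg0: "runs P f F S" "runs P g G T" using F G timedE2 by metis
  define m where "m = length P"
  define x where "x = Car (Arg 0)"
  define z where "z = Cdr (Arg 0)"
  \<comment> \<open>The language has no test for pairs: a value is a pair iff it equals the pair of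
    its \<open>Car\<close> and \<open>Cdr\<close>. Index \<open>m\<close> is the position of
    \<open>e\<close> itself in \<open>P'\<close>, which makes the calls recursive.\<close>
  define e where "e = Cond (Equal x (MkPair (Car x) (Cdr x)))
    (Call f [MkPair x (MkPair (MkPair (Call m [MkPair (Car x) z]) (Call m [MkPair (Cdr x) z])) z)])
    (Call g [MkPair x z])"
  define P' where "P' = P @ [e]"
  have fg: "runs P' f F S" "runs P' g G T"
    using fg0 by (auto simp: P'_def intro: runs_append)
  have P'm: "P' ! m = e" "m < length P'" by (auto simp: P'_def m_def)
  let ?K = "\<lambda>n. S (3 * n + 2 * B n + 10) + T (n + 2) + 40 * n + 6 * B n + 100"
  have ex: "evaluates P' [w] x (car w) (sexp_size w + sexp_size (car w))"
    and ez: "evaluates P' [w] z (cdr w) (sexp_size w + sexp_size (cdr w))" for w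
    unfolding x_def z_def by (intro ev_Car ev_Cdr evaluates_Arg0)+
  \<comment> \<open>\<open>n\<close> bounds the whole argument and stays fixed during the induction
    on \<open>car w\<close>. A child paired with \<open>cdr w\<close> still fits under it, so the
    cost \<open>?K n\<close> is the same at every node.\<close>
  have *: "\<exists>t \<le> sexp_size (car w) * ?K n. evaluates P' [w] e (trec G F (car w) (cdr w)) t"
    if "sexp_size (car w) + sexp_size (cdr w) \<le> n" "sexp_size w \<le> n + 1" for w n
    using that
  proof (induction "car w" arbitrary: w)
    case (Pr u v)
    note uv = Pr(3)[symmetric]
    have sz: "sexp_size u + sexp_size v + 1 + sexp_size (cdr w) \<le> n" "sexp_size w \<le> n + 1"
      using Pr.prems uv by auto
    define w1 where "w1 = Pr u (cdr w)"
    define w2 where "w2 = Pr v (cdr w)"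
    have mp1: "evaluates P' [w] (MkPair (Car x) z) w1
        ((sexp_size w + sexp_size (car w)) + sexp_size u + (sexp_size w + sexp_size (cdr w)) +
          sexp_size w1)"
      using ev_MkPair[OF ev_Car[OF ex[of w]] ez[of w]] uv unfolding w1_def by simp
    have mp2: "evaluates P' [w] (MkPair (Cdr x) z) w2
        ((sexp_size w + sexp_size (car w)) + sexp_size v + (sexp_size w + sexp_size (cdr w)) +
          sexp_size w2)"
      using ev_MkPair[OF ev_Cdr[OF ex[of w]] ez[of w]] uv unfolding w2_def by simp
    have "\<exists>t1 \<le> sexp_size u * ?K n. evaluates P' [w1] e (trec G F u (cdr w)) t1"
      using Pr(1)[of w1] sz by (auto simp: w1_def)
    then obtain t1 where t1: "t1 \<le> sexp_size u * ?K n" "evaluates P' [w1] e (trec G F u (cdr w)) t1"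
      by blast
    have "\<exists>t2 \<le> sexp_size v * ?K n. evaluates P' [w2] e (trec G F v (cdr w)) t2"
      using Pr(2)[of w2] sz by (auto simp: w2_def)
    then obtain t2 where t2: "t2 \<le> sexp_size v * ?K n" "evaluates P' [w2] e (trec G F v (cdr w)) t2"
      by blast
    have b: "sexp_size (trec G F y (cdr w)) \<le> B n" if "sexp_size y + sexp_size (cdr w) \<le> n" for y
      using B[of y "cdr w"] monoD[OF \<open>mono B\<close> that] by linarith
    have b1: "sexp_size (trec G F u (cdr w)) \<le> B n" and b2: "sexp_size (trec G F v (cdr w)) \<le> B n"
      using b sz by auto
    have l: "evaluates_list P' [w] [d] [y] s" if "evaluates P' [w] d y s" for d y s
      using ev_list_Cons[OF that ev_list_Nil] by simp
    note c1 = ev_Call[OF P'm(2) l[OF mp1] t1(2)[folded P'm(1)]]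
    note c2 = ev_Call[OF P'm(2) l[OF mp2] t2(2)[folded P'm(1)]]
    note arg = ev_MkPair[OF ex[of w] ev_MkPair[OF ev_MkPair[OF c1 c2] ez[of w]]]
    define a where "a = Pr (car w) (Pr (Pr (trec G F u (cdr w)) (trec G F v (cdr w))) (cdr w))"
    obtain s where s: "s \<le> S (sexp_size a)" and
      es: "evaluates P' [w] (Call f [MkPair x (MkPair (MkPair (Call m [MkPair (Car x) z]) (Call m
        [MkPair (Cdr x) z])) z)])
         (F a) (sexp_size w + sexp_size (car w) +
     (sexp_size w + sexp_size (car w) + sexp_size u +
      (sexp_size w + sexp_size (cdr w)) +
      sexp_size w1 +
      t1 +
      1 +
      (sexp_size w + sexp_size (car w) + sexp_size v +
       (sexp_size w + sexp_size (cdr w)) +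
       sexp_size w2 +
       t2 +
       1) +
      sexp_size (Pr (trec G F u (cdr w)) (trec G F v (cdr w))) +
      (sexp_size w + sexp_size (cdr w)) +
      sexp_size (Pr (Pr (trec G F u (cdr w)) (trec G F v (cdr w))) (cdr w))) +
     sexp_size a + s + 1)"
      using runs_call[OF fg(1) arg, folded a_def] by blast
    have "sexp_size a \<le> 3 * n + 2 * B n + 10"
      using b1 b2 sz uv by (simp add: a_def)
    then have s': "s \<le> S (3 * n + 2 * B n + 10)"
      using s monoD[OF \<open>mono S\<close>] le_trans by blast
    have test: "evaluates P' [w] (Equal x (MkPair (Car x) (Cdr x))) (Pr Nl Nl)
       ((sexp_size w + sexp_size (car w)) + ((sexp_size w + sexp_size (car w)) + sexp_size u +
         ((sexp_size w + sexp_size (car w)) + sexp_size v)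
         + sexp_size (car w)) + 3)"
      by (rule evaluates_cong[OF ev_Equal[OF ex[of w] ev_MkPair[OF ev_Car[OF ex[of w]] ev_Cdr[OF
        ex[of w]]]]])
        (simp_all add: sexp_of_bool_def uv)
    have res: "trec G F (car w) (cdr w) = F a" by (simp add: uv a_def)
    have k: "sexp_size (car w) * ?K n = ?K n + sexp_size u * ?K n + sexp_size v * ?K n"
      using uv by (simp add: distrib_right)
    show ?case
      unfolding res k
      by (rule exI, rule conjI[rotated], unfold e_def, rule ev_Cond_true[OF test _ es], simp)
        (use s' t1(1) t2(1) sz b1 b2 uv in \<open>simp add: w1_def w2_def a_def\<close>)
  next
    case Nl
    have x1: "evaluates P' [w] (Equal x (MkPair (Car x) (Cdr x))) Nl
       ((sexp_size w + sexp_size (car w)) + ((sexp_size w + sexp_size (car w)) + 1 + ((sexp_size w +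
         sexp_size (car w)) + 1)
         + 3) + 1)"
      by (rule evaluates_cong[OF ev_Equal[OF ex[of w] ev_MkPair[OF ev_Car[OF ex[of w]] ev_Cdr[OF
        ex[of w]]]]])
        (simp_all add: sexp_of_bool_def Nl(1)[symmetric])
    obtain t where t: "t \<le> T (sexp_size (Pr (car w) (cdr w)))" and
      e2: "evaluates P' [w] (Call g [MkPair x z]) (G (Pr (car w) (cdr w)))
         (sexp_size w + sexp_size (car w) + (sexp_size w + sexp_size (cdr w)) + sexp_size (Pr (car
           w) (cdr w)) + t + 1)"
      using runs_call[OF fg(2) ev_MkPair[OF ex[of w] ez[of w]]] by blast
    have t': "t \<le> T (n + 2)" using t monoD[OF \<open>mono T\<close>, of "sexp_size (Pr (car w) (cdr w))" "n + 2"]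
      Nl by simp
    have res: "trec G F (car w) (cdr w) = G (Pr (car w) (cdr w))" by (simp add: Nl(1)[symmetric])
    show ?case
      unfolding res
      by (rule exI, rule conjI[rotated], unfold e_def, rule ev_Cond_false[OF x1 e2])
        (use t' Nl(2,3) Nl(1)[symmetric] in simp)
  next
    case (Atom b)
    have x1: "evaluates P' [w] (Equal x (MkPair (Car x) (Cdr x))) Nl
       ((sexp_size w + sexp_size (car w)) + ((sexp_size w + sexp_size (car w)) + 1 + ((sexp_size w +
         sexp_size (car w)) + 1)
         + 3) + 1)"
      by (rule evaluates_cong[OF ev_Equal[OF ex[of w] ev_MkPair[OF ev_Car[OF ex[of w]] ev_Cdr[OF
        ex[of w]]]]])
        (simp_all add: sexp_of_bool_def Atom(1)[symmetric])
    obtain t where t: "t \<le> T (sexp_size (Pr (car w) (cdr w)))" and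
      e2: "evaluates P' [w] (Call g [MkPair x z]) (G (Pr (car w) (cdr w)))
         (sexp_size w + sexp_size (car w) + (sexp_size w + sexp_size (cdr w)) + sexp_size (Pr (car
           w) (cdr w)) + t + 1)"
      using runs_call[OF fg(2) ev_MkPair[OF ex[of w] ez[of w]]] by blast
    have t': "t \<le> T (n + 2)" using t monoD[OF \<open>mono T\<close>, of "sexp_size (Pr (car w) (cdr w))" "n + 2"]
      Atom by simp
    have res: "trec G F (car w) (cdr w) = G (Pr (car w) (cdr w))" by (simp add: Atom(1)[symmetric])
    show ?case
      unfolding res
      by (rule exI, rule conjI[rotated], unfold e_def, rule ev_Cond_false[OF x1 e2])
        (use t' Atom(2,3) Atom(1)[symmetric] in simp)
  qed
  show ?thesis
  proof (rule timedI[of _ P e])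
    fix w
    let ?n = "sexp_size w"
    \<comment> \<open>The \<open>+ 1\<close> covers an argument that is not a pair:
      \<open>car\<close> and \<open>cdr\<close> then both yield \<open>Nl\<close>, of total size
      2.\<close>
    have "sexp_size (car w) + sexp_size (cdr w) \<le> ?n + 1" "sexp_size w \<le> ?n + 1 + 1"
      by (cases w; simp)+
    from *[OF this] obtain t where t: "t \<le> sexp_size (car w) * ?K (?n + 1)"
      "evaluates P' [w] e (trec G F (car w) (cdr w)) t" by blast
    have "evaluates (P @ [e]) [w] e (trec G F (car w) (cdr w)) t"
      using t(2) by (simp add: P'_def)
    moreover have "t \<le> (?n + 1) * (S (3 * ?n + 2 * B (?n + 1) + 13) + T (Suc (Suc (Suc ?n))) + 40 *
      ?n + 6 * B (?n + 1) + 140)"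
    proof (rule le_trans[OF t(1)], rule mult_le_mono)
      show "sexp_size (car w) \<le> ?n + 1" using sexp_size_car[of w] by simp
    qed (simp add: algebra_simps)
    ultimately show "\<exists>t\<le>(?n + 1) * (S (3 * ?n + 2 * B (?n + 1) + 13) + T (Suc (Suc (Suc ?n))) + 40 *
      ?n + 6 * B (?n + 1) + 140).
        evaluates (P @ [e]) [w] e (trec G F (car w) (cdr w)) t" by blast
  qed
qed

section \<open>Polynomial-time functions\<close>

definition poly_time :: "(sexp \<Rightarrow> sexp) \<Rightarrow> bool" where
  "poly_time F \<longleftrightarrow> (\<exists>p. timed F (poly p))"

definition poly_time_pred :: "(sexp \<Rightarrow> bool) \<Rightarrow> bool" where
  "poly_time_pred Q \<longleftrightarrow> poly_time (\<lambda>z. sexp_of_bool (Q z))"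

definition slist :: "sexp list \<Rightarrow> sexp" where
  "slist = enc_list (\<lambda>x. x)"

definition poly_time_list :: "(sexp \<Rightarrow> sexp list) \<Rightarrow> bool" where
  "poly_time_list L \<longleftrightarrow> poly_time (\<lambda>z. slist (L z))"

text \<open>Every S-expression can be read as a list, an improper end being dropped, so
  list-processing functions need no well-formedness condition.\<close>

fun lst :: "sexp \<Rightarrow> sexp list" where
  "lst (Pr u v) = u # lst v"
| "lst Nl = []"
| "lst (Atom a) = []"

lemma slist_simps [simp]: "slist [] = Nl" "slist (x # xs) = Pr x (slist xs)"
  by (simp_all add: slist_def)

lemma lst_slist [simp]: "lst (slist xs) = xs"
  by (induction xs) auto

lemma sexp_of_bool_Nl [simp]: "sexp_of_bool b = Nl \<longleftrightarrow> \<not> b"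
  by (simp add: sexp_of_bool_def)

lemma ptI: "timed F T \<Longrightarrow> pbounded T \<Longrightarrow> poly_time F"
  unfolding poly_time_def pbounded_def using timed_mono by blast

lemma mono_poly: "mono (poly (p :: nat poly))"
  by (auto intro: monoI poly_mono_nat)

lemma poly_time_id: "poly_time (\<lambda>z. z)"
  by (rule ptI[OF timed_id]) (intro pbounded_intros)

lemma poly_time_Nl: "poly_time (\<lambda>z. Nl)"
  by (rule ptI[OF timed_Nl]) (intro pbounded_intros)

lemma poly_time_comp:
  assumes "poly_time F" "poly_time G"
  shows "poly_time (\<lambda>z. F (G z))"
proof -
  obtain p q where "timed F (poly p)" "timed G (poly q)" using assms by (auto simp: poly_time_def)
  from timed_comp[OF this mono_poly] show ?thesis
    by (rule ptI) (intro pbounded_intros)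
qed

lemma poly_time_car: "poly_time F \<Longrightarrow> poly_time (\<lambda>z. car (F z))"
  by (rule poly_time_comp[OF ptI[OF timed_car]]) (intro pbounded_intros)

lemma poly_time_cdr: "poly_time F \<Longrightarrow> poly_time (\<lambda>z. cdr (F z))"
  by (rule poly_time_comp[OF ptI[OF timed_cdr]]) (intro pbounded_intros)

lemma poly_time_Pr:
  assumes "poly_time F" "poly_time G"
  shows "poly_time (\<lambda>z. Pr (F z) (G z))"
proof -
  obtain p q where "timed F (poly p)" "timed G (poly q)" using assms by (auto simp: poly_time_def)
  from timed_Pr[OF this] show ?thesis
    by (rule ptI) (intro pbounded_intros)
qed

lemma poly_time_pred_eq:
  assumes "poly_time F" "poly_time G"
  shows "poly_time_pred (\<lambda>z. F z = G z)"
proof -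
  obtain p q where "timed F (poly p)" "timed G (poly q)" using assms by (auto simp: poly_time_def)
  from timed_Equal[OF this] show ?thesis
    unfolding poly_time_pred_def by (rule ptI) (intro pbounded_intros)
qed

lemma poly_time_if:
  assumes "poly_time_pred Q" "poly_time F" "poly_time G"
  shows "poly_time (\<lambda>z. if Q z then F z else G z)"
proof -
  obtain p q r where "timed (\<lambda>z. sexp_of_bool (Q z)) (poly p)" "timed F (poly q)" "timed G (poly r)"
    using assms by (auto simp: poly_time_def poly_time_pred_def)
  from timed_Cond[OF this] have "poly_time (\<lambda>z. if sexp_of_bool (Q z) \<noteq> Nl then F z else G z)"
    by (rule ptI) (intro pbounded_intros)
  then show ?thesis by simp
qed

lemma poly_time_list_Nil: "poly_time_list (\<lambda>z. [])"
  by (simp add: poly_time_list_def poly_time_Nl)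

lemma poly_time_list_Cons: "poly_time F \<Longrightarrow> poly_time_list L \<Longrightarrow> poly_time_list (\<lambda>z. F z # L z)"
  by (simp add: poly_time_list_def poly_time_Pr)

lemma poly_time_list_if: "poly_time_pred Q \<Longrightarrow> poly_time_list K \<Longrightarrow> poly_time_list L \<Longrightarrow> poly_time_list
  (\<lambda>z. if Q z then K z else L z)"
  unfolding poly_time_list_def by (subst if_distrib) (rule poly_time_if)

lemma poly_time_slist: "poly_time_list L \<Longrightarrow> poly_time (\<lambda>z. slist (L z))"
  by (simp add: poly_time_list_def)

lemma poly_time_pred_const: "poly_time_pred (\<lambda>z. b)"
  by (cases b) (auto simp: poly_time_pred_def sexp_of_bool_def intro!: poly_time_Pr poly_time_Nl)

lemma poly_time_pred_if: 
  assumes "poly_time_pred Q" "poly_time_pred R" "poly_time_pred S"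
  shows "poly_time_pred (\<lambda>z. if Q z then R z else S z)"
  using poly_time_if[OF assms(1) assms(2,3)[unfolded poly_time_pred_def]] unfolding poly_time_pred_def
  by (subst if_distrib)

lemma poly_time_pred_not: "poly_time_pred Q \<Longrightarrow> poly_time_pred (\<lambda>z. \<not> Q z)"
  by (rule back_subst[of poly_time_pred, OF poly_time_pred_if[OF _ poly_time_pred_const[of False]
    poly_time_pred_const[of True]]]) auto

lemma poly_time_pred_conj: "poly_time_pred Q \<Longrightarrow> poly_time_pred R \<Longrightarrow> poly_time_pred (\<lambda>z. Q z \<and> R z)"
  by (rule back_subst[of poly_time_pred, OF poly_time_pred_if[of Q R, OF _ _ poly_time_pred_const[of
    False]]]) auto

lemma poly_time_pred_imp: "poly_time_pred Q \<Longrightarrow> poly_time_pred R \<Longrightarrow> poly_time_pred (\<lambda>z. Q z \<longrightarrow> R z)"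
  by (rule back_subst[of poly_time_pred, OF poly_time_pred_if[of Q R, OF _ _ poly_time_pred_const[of
    True]]]) auto

lemma poly_time_pred_iff:
  assumes "poly_time_pred Q" "poly_time_pred R"
  shows "poly_time_pred (\<lambda>z. Q z = R z)"
proof -
  have "(\<lambda>z. Q z = R z) = (\<lambda>z. if Q z then R z else \<not> R z)" by auto
  then show ?thesis using assms by (simp add: poly_time_pred_if poly_time_pred_not)
qed

text \<open>
  The polynomial does not depend on the bound \<open>B\<close> on the sizes of the results, so this also applies to
  recursions with results of exponential size.
\<close>

lemma timed_trec_poly:
  assumes F: "poly_time F" and G: "poly_time G" and B: "mono B"
    "\<And>x z. sexp_size (trec G F x z) \<le> B (sexp_size x + sexp_size z)"
  shows "\<exists>p. timed (\<lambda>z. trec G F (car z) (cdr z)) (\<lambda>n. poly p (n + B (n + 1)))"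
proof -
  obtain p q where pq: "timed F (poly p)" "timed G (poly q)" using F G by (auto simp: poly_time_def)
  have "pbounded (\<lambda>m. (m + 1) * (poly p (3 * m + 13) + poly q (Suc (Suc (Suc m))) + 46 * m + 140))"
    by (intro pbounded_intros)
  then obtain r where r: "\<And>m. (m + 1) * (poly p (3 * m + 13) + poly q (Suc (Suc (Suc m))) + 46 * m +
    140) \<le> poly r m"
    by (auto simp: pbounded_def)
  have "timed (\<lambda>z. trec G F (car z) (cdr z)) (\<lambda>n. poly r (n + B (n + 1)))"
  proof (rule timed_mono[OF timed_trec[OF pq mono_poly mono_poly B]])
    fix n
    show "(n + 1) * (poly p (3 * n + 2 * B (n + 1) + 13) + poly q (Suc (Suc (Suc n))) + 40 * n + 6 *
      B (n + 1) + 140)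
      \<le> poly r (n + B (n + 1))"
    proof -
      define m where "m = n + B (n + 1)"
      have "poly p (3 * n + 2 * B (n + 1) + 13) \<le> poly p (3 * m + 13)"
        "poly q (Suc (Suc (Suc n))) \<le> poly q (Suc (Suc (Suc m)))"
        by (intro poly_mono_nat; simp add: m_def)+
      moreover have "40 * n + 6 * B (n + 1) \<le> 46 * m" by (simp add: m_def)
      ultimately have "(n + 1) * (poly p (3 * n + 2 * B (n + 1) + 13) + poly q (Suc (Suc (Suc n))) +
        40 * n + 6 * B (n + 1) + 140)
        \<le> (m + 1) * (poly p (3 * m + 13) + poly q (Suc (Suc (Suc m))) + 46 * m + 140)"
        by (intro mult_le_mono) (simp_all add: m_def)
      then show ?thesis using r[of m] m_def by simp
    qed
  qed
  then show ?thesis by blast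
qed

lemma poly_time_trec:
  assumes F: "poly_time F" and G: "poly_time G" and B: "pbounded B"
    "\<And>x z. sexp_size (trec G F x z) \<le> B (sexp_size x + sexp_size z)"
    and K: "poly_time K" and L: "poly_time L"
  shows "poly_time (\<lambda>z. trec G F (K z) (L z))"
proof -
  obtain b where b: "\<And>n. B n \<le> poly b n" using B by (auto simp: pbounded_def)
  obtain p where p: "timed (\<lambda>z. trec G F (car z) (cdr z)) (\<lambda>n. poly p (n + poly b (n + 1)))"
    using timed_trec_poly[OF F G mono_poly le_trans[OF B(2) b]] by blast
  have "poly_time (\<lambda>z. trec G F (car z) (cdr z))"
    by (rule ptI[OF p]) (intro pbounded_intros)
  from poly_time_comp[OF this poly_time_Pr[OF K L]] show ?thesis by simp
qed

text \<open>A fold is tree recursion along the \<open>cdr\<close> spine, with a step that consults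
  only the result for the tail.\<close>

lemma foldr_trec:
  "trec (\<lambda>w. b (cdr w)) (\<lambda>w. H (car (car w)) (cdr (car (cdr w))) (cdr (cdr w))) x z
    = foldr (\<lambda>x a. H x a z) (lst x) (b z)"
  by (induction x) auto

lemma poly_time_foldr_args:
  assumes "poly_time (\<lambda>w. H (car w) (car (cdr w)) (cdr (cdr w)))"
  shows "poly_time (\<lambda>w. H (car (car w)) (cdr (car (cdr w))) (cdr (cdr w)))"
  using poly_time_comp[OF assms, of "\<lambda>w. Pr (car (car w)) (Pr (cdr (car (cdr w))) (cdr (cdr w)))"]
  by (simp add: poly_time_car poly_time_cdr poly_time_Pr poly_time_id)

lemma size_slist_lst: "sexp_size (slist (lst x)) \<le> sexp_size x"
  by (induction x) auto

text \<open>Tree recursion also descends into the elements of the list and treats them as lists;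
  hence the size bound is asked for folds over every list, not only over \<open>L z\<close>.\<close>

lemma poly_time_foldr:
  assumes L: "poly_time_list L" and b: "poly_time b" and H: "poly_time (\<lambda>w. H (car w) (car (cdr w))
    (cdr (cdr w)))"
    and B: "pbounded B"
      "\<And>xs z. sexp_size (foldr (\<lambda>x a. H x a z) xs (b z)) \<le> B (sexp_size (slist xs) + sexp_size z)"
  shows "poly_time (\<lambda>z. foldr (\<lambda>x a. H x a z) (L z) (b z))"
proof -
  obtain p where p: "\<And>n. B n \<le> poly p n" using B by (auto simp: pbounded_def)
  have "sexp_size (foldr (\<lambda>x a. H x a z) (lst x) (b z)) \<le> poly p (sexp_size x + sexp_size z)" for x z
    by (rule order.trans[OF B(2)], rule order.trans[OF p], rule poly_mono_nat)
      (simp add: size_slist_lst)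
  then have "poly_time (\<lambda>z. foldr (\<lambda>x a. H x a z) (lst (slist (L z))) (b z))"
    unfolding foldr_trec[of b H, symmetric]
    using L by (intro poly_time_trec[OF poly_time_foldr_args[OF H] _ pbounded_poly]
      poly_time_comp[OF b] poly_time_cdr poly_time_id)
      (auto simp: foldr_trec poly_time_list_def)
  then show ?thesis by simp
qed

lemma sexp_size_slist: "sexp_size (slist xs) = 1 + (\<Sum>x\<leftarrow>xs. 1 + sexp_size x)"
  by (induction xs) auto

lemma size_slist_append: "sexp_size (slist (xs @ ys)) \<le> sexp_size (slist xs) + sexp_size (slist ys)"
  by (induction xs) auto

lemma length_le_slist: "length xs \<le> sexp_size (slist xs)"
  by (induction xs) auto

lemma poly_time_size:
  assumes "poly_time F"
  obtains p where "\<And>z. sexp_size (F z) \<le> poly p (sexp_size z)"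
  using assms unfolding poly_time_def by (meson timed_size)

lemma poly_time_list_append:
  assumes "poly_time_list K" "poly_time_list L"
  shows "poly_time_list (\<lambda>z. K z @ L z)"
proof -
  obtain p where p: "\<And>z. sexp_size (slist (L z)) \<le> poly p (sexp_size z)"
    using poly_time_size[OF assms(2)[unfolded poly_time_list_def]] by blast
  have "sexp_size (foldr Pr xs (slist (L z))) \<le> sexp_size (slist xs) + sexp_size (slist (L z))" for xs z
    by (induction xs) auto
  also have "sexp_size (slist xs) + sexp_size (slist (L z)) \<le>
      (sexp_size (slist xs) + sexp_size z) + poly p (sexp_size (slist xs) + sexp_size z)" for xs z
    using p[of z] poly_mono_nat[of "sexp_size z" "sexp_size (slist xs) + sexp_size z" p] by linarith
  finally have "poly_time (\<lambda>z. foldr (\<lambda>x a. Pr x a) (K z) (slist (L z)))"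
    using assms by (intro poly_time_foldr[where B = "\<lambda>n. n + poly p n"])
      (auto intro!: pbounded_intros poly_time_Pr poly_time_car poly_time_cdr poly_time_id simp:
        poly_time_list_def)
  moreover have "foldr Pr xs (slist ys) = slist (xs @ ys)" for xs ys
    by (induction xs) auto
  ultimately show ?thesis by (simp add: poly_time_list_def)
qed

lemma poly_time_list_lst: 
  assumes "poly_time F"
  shows "poly_time_list (\<lambda>z. lst (F z))"
proof -
  have *: "trec (\<lambda>w. Nl) (\<lambda>w. Pr (car (car w)) (cdr (car (cdr w)))) x z = slist (lst x)" for x z
    by (induction x) auto
  have "poly_time (\<lambda>z. trec (\<lambda>w. Nl) (\<lambda>w. Pr (car (car w)) (cdr (car (cdr w)))) (F z) z)"
    using size_slist_lst assms by (intro poly_time_trec[where B = "\<lambda>n. n"] poly_time_Pr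
      poly_time_car poly_time_cdr poly_time_id poly_time_Nl
      pbounded_id) (auto simp: * intro: trans_le_add1)
  then show ?thesis by (simp add: poly_time_list_def *)
qed

text \<open>The pieces appended in each round depend on the element and the context \<open>z\<close>
  but not on the accumulator, so their sizes add up instead of compounding. Nesting this loop yields
  the loops of the algorithm.\<close>

lemma poly_time_list_concat_map:
  assumes L: "poly_time_list L" and M: "poly_time_list (\<lambda>w. M (car w) (cdr w))"
  shows "poly_time_list (\<lambda>z. concat (map (\<lambda>x. M x z) (L z)))"
proof -
  obtain p where p: "\<And>w. sexp_size (slist (M (car w) (cdr w))) \<le> poly p (sexp_size w)"
    using poly_time_size[OF M[unfolded poly_time_list_def]] by blast
  have eq: "foldr (\<lambda>x a. slist (M x z @ lst a)) xs Nl = slist (concat (map (\<lambda>x. M x z) xs))" for xs z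
    by (induction xs) auto
  have sz: "sexp_size (slist (concat (map (\<lambda>x. M x z) xs))) \<le> length xs * poly p n + 1"
    if "sexp_size (slist xs) + sexp_size z \<le> n" for xs z n
    using that
  proof (induction xs)
    case (Cons x xs)
    have "sexp_size (slist (M x z)) \<le> poly p n"
      using p[of "Pr x z"] poly_mono_nat[of "sexp_size (Pr x z)" n p] Cons.prems
      by (auto intro: le_trans)
    moreover have "sexp_size (slist (concat (map (\<lambda>x. M x z) xs))) \<le> length xs * poly p n + 1"
      using Cons by simp
    ultimately show ?case
      using size_slist_append[of "M x z" "concat (map (\<lambda>x. M x z) xs)"] by simp
  qed simp
  have "sexp_size (foldr (\<lambda>x a. slist (M x z @ lst a)) xs Nl)
      \<le> (sexp_size (slist xs) + sexp_size z) * poly p (sexp_size (slist xs) + sexp_size z) + 1" for xs z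
    unfolding eq using sz[of xs z, OF le_refl]
    by (rule le_trans) (simp add: length_le_slist trans_le_add1)
  moreover have "poly_time_list (\<lambda>w. M (car w) (cdr (cdr w)))"
    using poly_time_comp[OF M[unfolded poly_time_list_def] poly_time_Pr[OF poly_time_car[OF
      poly_time_id] poly_time_cdr[OF poly_time_cdr[OF poly_time_id]]]]
    by (simp add: poly_time_list_def)
  ultimately have "poly_time (\<lambda>z. foldr (\<lambda>x a. slist (M x z @ lst a)) (L z) Nl)"
    by (intro poly_time_foldr[where B = "\<lambda>n. n * poly p n + 1" and b = "\<lambda>z. Nl"] poly_time_slist
      poly_time_list_append poly_time_list_lst)
      (auto intro!: L poly_time_Nl poly_time_car poly_time_cdr poly_time_id pbounded_intros)
  then show ?thesis by (simp add: eq poly_time_list_def)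
qed

lemma poly_time_list_map:
  assumes "poly_time_list L" "poly_time (\<lambda>w. F (car w) (cdr w))"
  shows "poly_time_list (\<lambda>z. map (\<lambda>x. F x z) (L z))"
  using poly_time_list_concat_map[OF assms(1) poly_time_list_Cons[OF assms(2) poly_time_list_Nil]] by simp

lemma poly_time_list_filter:
  assumes "poly_time_list L" "poly_time_pred (\<lambda>w. Q (car w) (cdr w))"
  shows "poly_time_list (\<lambda>z. filter (\<lambda>x. Q x z) (L z))"
proof -
  have "concat (map (\<lambda>x. if Q x z then [x] else []) xs) = filter (\<lambda>x. Q x z) xs" for xs z
    by (induction xs) auto
  then show ?thesis
    using poly_time_list_concat_map[OF assms(1), of "\<lambda>x z. if Q x z then [x] else []"]
    by (simp add: assms poly_time_list_if poly_time_list_Cons poly_time_list_Nil poly_time_car poly_time_id)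
qed

lemma poly_time_pred_Bex:
  assumes "poly_time_list L" "poly_time_pred (\<lambda>w. Q (car w) (cdr w))"
  shows "poly_time_pred (\<lambda>z. \<exists>x\<in>set (L z). Q x z)"
proof -
  have "poly_time_pred (\<lambda>z. slist (filter (\<lambda>x. Q x z) (L z)) \<noteq> Nl)"
    by (intro poly_time_pred_not poly_time_pred_eq poly_time_slist poly_time_list_filter assms poly_time_Nl)
  moreover have "slist (filter (\<lambda>x. Q x z) (L z)) \<noteq> Nl \<longleftrightarrow> (\<exists>x\<in>set (L z). Q x z)" for z
    by (cases "filter (\<lambda>x. Q x z) (L z)") (auto simp: filter_empty_conv filter_eq_Cons_iff)
  ultimately show ?thesis by simp
qed

lemma poly_time_pred_Ball:
  assumes "poly_time_list L" "poly_time_pred (\<lambda>w. Q (car w) (cdr w))"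
  shows "poly_time_pred (\<lambda>z. \<forall>x\<in>set (L z). Q x z)"
  using poly_time_pred_not[OF poly_time_pred_Bex[OF assms(1) poly_time_pred_not[OF assms(2)]]] by simp

lemma poly_time_pred_in_set:
  assumes "poly_time F" "poly_time_list L"
  shows "poly_time_pred (\<lambda>z. F z \<in> set (L z))"
proof -
  have "poly_time_pred (\<lambda>z. \<exists>x\<in>set (L z). x = F z)"
    using poly_time_comp[OF assms(1) poly_time_cdr[OF poly_time_id]]
    by (intro poly_time_pred_Bex poly_time_pred_eq assms poly_time_car poly_time_id)
  then show ?thesis by simp
qed

lemma poly_time_list_rev:
  assumes "poly_time_list L"
  shows "poly_time_list (\<lambda>z. rev (L z))"
proof -
  have eq: "foldr (\<lambda>x a. slist (lst a @ [x])) xs Nl = slist (rev xs)" for xs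
    by (induction xs) auto
  have sz: "sexp_size (slist (rev xs)) = sexp_size (slist xs)" for xs
    by (simp add: sexp_size_slist rev_map[symmetric] sum_list_rev)
  have "poly_time (\<lambda>z. foldr (\<lambda>x a. slist (lst a @ [x])) (L z) Nl)"
    using assms
    by (intro poly_time_foldr[where B = "\<lambda>n. n"] poly_time_slist poly_time_list_append
      poly_time_list_lst poly_time_list_Cons poly_time_list_Nil poly_time_car poly_time_cdr
        poly_time_id poly_time_Nl
       pbounded_id) (auto simp: eq sz)
  then show ?thesis by (simp add: eq poly_time_list_def)
qed

lemmas poly_time_intros = poly_time_id poly_time_car poly_time_cdr poly_time_Pr poly_time_Nl
  poly_time_if poly_time_slist
  poly_time_pred_eq poly_time_pred_not poly_time_pred_conj poly_time_pred_imp poly_time_pred_iff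
    poly_time_pred_const poly_time_pred_Bex poly_time_pred_Ball poly_time_pred_in_set
  poly_time_list_Nil poly_time_list_Cons poly_time_list_if poly_time_list_append poly_time_list_lst
    poly_time_list_concat_map poly_time_list_map poly_time_list_filter poly_time_list_rev

lemma enc_nat_numeral [simp]:
  "enc_nat 2 = Pr Nl (Pr Nl Nl)"
  "enc_nat 3 = Pr Nl (Pr Nl (Pr Nl Nl))"
  "enc_nat 4 = Pr Nl (Pr Nl (Pr Nl (Pr Nl Nl)))"
  by (simp_all add: numeral_eq_Suc)

lemma poly_time_enc_nat: "poly_time (\<lambda>z. enc_nat i)"
  by (induction i) (auto intro: poly_time_intros)

section \<open>Exponential time\<close>

text \<open>The base \<open>n + 2\<close> is at least 2 even for \<open>n = 0\<close>, so a
  coefficient \<open>a\<close> can be absorbed as \<open>2 ^ a\<close>.\<close>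

lemma poly_le_power: "\<exists>k. \<forall>n. poly p n \<le> (n + 2) ^ k" for p :: "nat poly"
proof (induction p)
  case (pCons a p)
  then obtain k where k: "\<And>n. poly p n \<le> (n + 2) ^ k" by auto
  have "poly (pCons a p) n \<le> (n + 2) ^ (a + k + 1)" for n
  proof -
    have "a \<le> 2 ^ a" by (simp add: less_imp_le)
    also have "\<dots> \<le> (n + 2) ^ a" by (intro power_mono) auto
    also have "(n + 2) ^ a \<le> (n + 2) ^ (a + k)" by (intro power_increasing) auto
    finally have a: "a \<le> (n + 2) ^ (a + k)" .
    have "n * poly p n \<le> n * (n + 2) ^ k" using k by simp
    also have "(n + 2) ^ k \<le> (n + 2) ^ (a + k)" by (intro power_increasing) auto
    finally have "n * poly p n \<le> n * (n + 2) ^ (a + k)" by simp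
    with a have "poly (pCons a p) n \<le> (n + 2) ^ (a + k) + n * (n + 2) ^ (a + k)"
      unfolding poly_pCons by (rule add_mono)
    also have "\<dots> \<le> (n + 2) ^ (a + k + 1)" by simp
    finally show ?thesis .
  qed
  then show ?case by blast
qed auto

text \<open>Single exponentials, closed under addition and under applying a polynomial from outside.
  The second exponential enters only in \<open>timed_double_exp\<close>.\<close>

definition ebounded :: "(nat \<Rightarrow> nat) \<Rightarrow> bool" where
  "ebounded T \<longleftrightarrow> (\<exists>p. \<forall>n. T n \<le> 2 ^ poly p n)"

lemma ebounded_power:
  assumes "pbounded T"
  shows "ebounded (\<lambda>n. 2 ^ T n)"
  using assms unfolding pbounded_def ebounded_def by (meson one_le_numeral power_increasing)

lemma ebounded_le: "ebounded T \<Longrightarrow> (\<And>n. S n \<le> T n) \<Longrightarrow> ebounded S"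
  unfolding ebounded_def using le_trans by blast

lemma ebounded_pbounded:
  assumes "pbounded T"
  shows "ebounded T"
  by (rule ebounded_le[OF ebounded_power[OF assms]]) (simp add: less_imp_le)

lemma ebounded_poly:
  assumes "ebounded T"
  shows "ebounded (\<lambda>n. poly p (T n))"
proof -
  obtain q where q: "\<And>n. T n \<le> 2 ^ poly q n" using assms by (auto simp: ebounded_def)
  obtain k where k: "\<And>n. poly p n \<le> (n + 2) ^ k" using poly_le_power by blast
  have "poly p (T n) \<le> 2 ^ ((poly q n + 2) * k)" for n
  proof -
    have "2 ^ (poly q n + 2) = 4 * (2::nat) ^ poly q n" "1 \<le> (2::nat) ^ poly q n" by simp_all
    then have "T n + 2 \<le> 2 ^ (poly q n + 2)" using q[of n] by linarith
    from power_mono[OF this, of k] have "(T n + 2) ^ k \<le> 2 ^ ((poly q n + 2) * k)"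
      unfolding power_mult by simp
    with k[of "T n"] show ?thesis by (rule le_trans)
  qed
  moreover have "pbounded (\<lambda>n. (poly q n + 2) * k)" by (intro pbounded_intros)
  ultimately show ?thesis by (intro ebounded_le[OF ebounded_power])
qed

lemma ebounded_add:
  assumes "ebounded S" "ebounded T"
  shows "ebounded (\<lambda>n. S n + T n)"
proof -
  obtain p q where pq: "\<And>n. S n \<le> 2 ^ poly p n" "\<And>n. T n \<le> 2 ^ poly q n"
    using assms by (auto simp: ebounded_def)
  have "S n + T n \<le> 2 ^ (poly p n + poly q n + 1)" for n
  proof -
    have "(2::nat) ^ poly p n \<le> 2 ^ (poly p n + poly q n)" "(2::nat) ^ poly q n \<le> 2 ^ (poly p n + poly q n)"
      by (intro power_increasing; simp)+
    then have "S n + T n \<le> 2 * 2 ^ (poly p n + poly q n)" using pq[of n] by linarith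
    then show ?thesis by simp
  qed
  moreover have "pbounded (\<lambda>n. poly p n + poly q n + 1)" by (intro pbounded_intros)
  ultimately show ?thesis by (intro ebounded_le[OF ebounded_power])
qed

text \<open>Each element doubles the list, which starts as \<open>Pr Nl Nl\<close>, the code of the
  list whose only member is the empty list. One step is polynomial in the accumulator, as
  \<open>timed_trec_poly\<close> demands, although the final result is exponential.\<close>

lemma slist_subseqs:
  "foldr (\<lambda>x a. slist (map (Pr x) (lst a) @ lst a)) xs (Pr Nl Nl) = slist (map slist (subseqs xs))"
  by (induction xs) (auto simp: Let_def comp_def)

lemma size_slist_subseqs:
  "sexp_size (slist (map slist (subseqs xs))) \<le> 2 ^ (2 * sexp_size (slist xs) + 1)"
proof -
  let ?n = "sexp_size (slist xs)"
  have len: "length (subseqs xs) \<le> 2 ^ ?n"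
    by (simp add: length_subseqs length_le_slist)
  have sub: "sexp_size (slist ys) \<le> ?n" if "ys \<in> set (subseqs xs)" for ys
    using that by (induction xs arbitrary: ys) (fastforce simp: Let_def)+
  have "(\<Sum>x\<leftarrow>map slist (subseqs xs). 1 + sexp_size x) \<le> (\<Sum>x\<leftarrow>subseqs xs. 1 + ?n)"
    unfolding map_map comp_def by (rule sum_list_mono) (use sub in auto)
  also have "\<dots> = length (subseqs xs) * (1 + ?n)" by (simp add: sum_list_triv)
  also have "\<dots> \<le> 2 ^ ?n * 2 ^ ?n"
    by (intro mult_le_mono len) (simp add: Suc_leI)
  also have "\<dots> = 2 ^ (2 * ?n)" by (simp only: mult_2 power_add)
  finally have "sexp_size (slist (map slist (subseqs xs))) \<le> 1 + 2 ^ (2 * ?n)"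
    unfolding sexp_size_slist[of "map slist _"] by (rule add_left_mono)
  moreover have "2 ^ (2 * ?n + 1) = 2 * (2::nat) ^ (2 * ?n)" "1 \<le> (2::nat) ^ (2 * ?n)"
    by simp_all
  ultimately show ?thesis by linarith
qed

text \<open>The argument is returned next to the powerset because later stages consult it
  again.\<close>

lemma timed_subseqs:
  assumes "poly_time_list L"
  shows "\<exists>p. timed (\<lambda>z. Pr (slist (map slist (subseqs (L z)))) z) (\<lambda>n. 2 ^ poly p n)"
proof -
  let ?H = "\<lambda>(x::sexp) (a::sexp) (z::sexp). slist (map (Pr x) (lst a) @ lst a)"
  let ?G = "\<lambda>w. Pr Nl Nl"
  let ?F = "\<lambda>w. ?H (car (car w)) (cdr (car (cdr w))) (cdr (cdr w))"
  have eq: "trec ?G ?F x z = slist (map slist (subseqs (lst x)))" for x z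
    using foldr_trec[of "\<lambda>z. Pr Nl Nl" ?H x z] by (simp only: slist_subseqs)
  have "sexp_size (trec ?G ?F x z) \<le> 2 ^ (2 * (sexp_size x + sexp_size z) + 1)" for x z
    unfolding eq by (rule le_trans[OF size_slist_subseqs], rule power_increasing)
      (use size_slist_lst[of x] in auto)
  moreover have "mono (\<lambda>n::nat. 2 ^ (2 * n + 1) :: nat)"
    by (intro monoI power_increasing) auto
  moreover have "poly_time ?F" "poly_time ?G" by (intro poly_time_intros)+
  ultimately obtain p where p: "timed (\<lambda>z. slist (map slist (subseqs (lst (car z))))) (\<lambda>n. poly p (n
    + 2 ^ (2 * (n + 1) + 1)))"
    using timed_trec_poly[of ?F ?G "\<lambda>n. 2 ^ (2 * n + 1)"] unfolding eq by blast
  have "poly_time (\<lambda>z. Pr (slist (L z)) z)" by (intro poly_time_intros assms)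
  then obtain q where q: "timed (\<lambda>z. Pr (slist (L z)) z) (poly q)" by (auto simp: poly_time_def)
  have "mono (\<lambda>n. poly p (n + 2 ^ (2 * (n + 1) + 1)))"
    by (intro monoI poly_mono_nat add_mono power_increasing) auto
  note t = timed_Pr[OF timed_comp[OF p q this] timed_id]
  have "ebounded (\<lambda>n. poly [:0, 2:] (poly p (poly q n + 2 ^ (2 * (poly q n + 1) + 1)) + poly q n + n
    + 2) + 4 * n + 3)"
    by (intro ebounded_add ebounded_poly ebounded_power)
      (rule ebounded_pbounded | intro pbounded_intros)+
  then obtain r where r: "\<And>n. poly [:0, 2:] (poly p (poly q n + 2 ^ (2 * (poly q n + 1) + 1)) + poly
    q n + n + 2) + 4 * n + 3 \<le> 2 ^ poly r n"
    by (auto simp: ebounded_def)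
  have "2 * (poly p (poly q n + 2 ^ (2 * (poly q n + 1) + 1)) + poly q n + n + 2) + 2 * n + 2 * n +
    3 \<le> 2 ^ poly r n" for n
    using r[of n] by simp
  from timed_mono[OF t this] have "timed (\<lambda>z. Pr (slist (map slist (subseqs (L z)))) z) (\<lambda>n. 2 ^ poly r n)"
    by (simp only: car.simps lst_slist)
  then show ?thesis by blast
qed

text \<open>Time bounds output size, so \<open>G\<close> receives an argument of exponential size
  and \<open>H\<close> one of double exponential size; being polynomial, \<open>H\<close> adds no
  further exponential.\<close>

lemma timed_double_exp:
  assumes F: "timed F (\<lambda>n. 2 ^ poly p n)" and G: "timed G (\<lambda>n. 2 ^ poly q n)" and H: "poly_time H"
  shows "\<exists>r. timed (\<lambda>z. H (G (F z))) (\<lambda>n. 2 ^ 2 ^ poly r n)"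
proof -
  obtain h where h: "timed H (poly h)" using H by (auto simp: poly_time_def)
  have "ebounded (\<lambda>n. poly h (2 ^ poly q n) + 2 ^ poly q n + n + 2)"
    by (intro ebounded_add ebounded_poly ebounded_power)
      (rule ebounded_pbounded | intro pbounded_intros)+
  then obtain a where a: "\<And>n. poly h (2 ^ poly q n) + 2 ^ poly q n + n + 2 \<le> 2 ^ poly a n"
    by (auto simp: ebounded_def)
  have HG: "timed (\<lambda>z. H (G z)) (\<lambda>n. 2 ^ poly a n)"
    by (rule timed_mono[OF timed_comp[OF h G mono_poly] a])
  have m: "mono (\<lambda>n. 2 ^ poly a n :: nat)"
    by (intro monoI power_increasing poly_mono_nat) auto
  have "ebounded (\<lambda>n. poly a (2 ^ poly p n) + poly p n + n + 2)"
    by (intro ebounded_add ebounded_poly ebounded_power)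
      (rule ebounded_pbounded | intro pbounded_intros)+
  then obtain r where r: "\<And>n. poly a (2 ^ poly p n) + poly p n + n + 2 \<le> 2 ^ poly r n"
    by (auto simp: ebounded_def)
  have "timed (\<lambda>z. H (G (F z))) (\<lambda>n. 2 ^ 2 ^ poly r n)"
  proof (rule timed_mono[OF timed_comp[OF HG F m]])
    fix n
    let ?e = "poly a (2 ^ poly p n) + poly p n + n"
    have e: "(2::nat) ^ poly a (2 ^ poly p n) \<le> 2 ^ ?e" "(2::nat) ^ poly p n \<le> 2 ^ ?e" "(2::nat) ^ n
      \<le> 2 ^ ?e"
      by (intro power_increasing; simp)+
    \<comment> \<open>The sum splits into four parts, namely the two powers, \<open>n + 1\<close>
      and 1, each at most \<open>2 ^ ?e\<close>; this is where \<open>?e + 2\<close> comes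
      from.\<close>
    have "n + 1 \<le> 2 ^ n" "(1::nat) \<le> 2 ^ ?e" "(2::nat) ^ (?e + 2) = 4 * 2 ^ ?e"
      by (simp_all add: Suc_leI power_add)
    with e have "2 ^ poly a (2 ^ poly p n) + 2 ^ poly p n + n + 2 \<le> (2::nat) ^ (?e + 2)"
      by linarith
    also have "\<dots> \<le> 2 ^ 2 ^ poly r n" using r[of n] by (intro power_increasing) auto
    finally show "2 ^ poly a (2 ^ poly p n) + 2 ^ poly p n + n + 2 \<le> (2::nat) ^ 2 ^ poly r n" .
  qed
  then show ?thesis by blast
qed

section \<open>Subtrees of an S-expression\<close>

fun subtrees :: "sexp \<Rightarrow> sexp list" where
  "subtrees (Pr u v) = Pr u v # subtrees u @ subtrees v"
| "subtrees x = [x]"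

lemma poly_time_list_subtrees:
  assumes "poly_time F"
  shows "poly_time_list (\<lambda>z. subtrees (F z))"
proof -
  let ?G = "\<lambda>w. slist [car w]"
  let ?F = "\<lambda>w. slist (car w # lst (car (car (cdr w))) @ lst (cdr (car (cdr w))))"
  have eq: "trec ?G ?F x z = slist (subtrees x)" for x z
    by (induction x) auto
  have "sexp_size (slist (subtrees x)) \<le> sexp_size x * (n + 2)" if "sexp_size x \<le> n" for x n
    using that
  proof (induction x)
    case (Pr u v)
    then show ?case using size_slist_append[of "subtrees u" "subtrees v"] by (simp add: algebra_simps)
  qed simp_all
  then have sz: "sexp_size (slist (subtrees x)) \<le> (sexp_size x + sexp_size z) * ((sexp_size x +
    sexp_size z) + 2)" for x z
    by (rule le_trans[OF _ mult_le_mono1]) auto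
  have "poly_time (\<lambda>z. trec ?G ?F (F z) Nl)"
    by (intro poly_time_trec[where B = "\<lambda>n. n * (n + 2)"] pbounded_intros poly_time_intros assms)
      (unfold eq, rule sz)
  then show ?thesis unfolding eq poly_time_list_def .
qed

lemma subtrees_self: "x \<in> set (subtrees x)"
  by (cases x) auto

lemma subtrees_trans: "y \<in> set (subtrees x) \<Longrightarrow> z \<in> set (subtrees y) \<Longrightarrow> z \<in> set (subtrees x)"
  by (induction x) auto

section \<open>Hash-consing of straight-line programs\<close>

text \<open>
  An absent key yields \<open>Nl\<close>, which is the position 0, and that node is always \<open>Top\<close>.
\<close>

definition look :: "sexp list \<Rightarrow> sexp \<Rightarrow> sexp" where
  "look L k = cdr (car (slist (filter (\<lambda>e. car e = k) L)))"

text \<open>Replaces operand registers by the positions of the nodes they hold. \<open>A\<close> is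
  the table from registers to positions; a newer binding stands in front and shadows older
  ones.\<close>

definition node_of :: "sexp list \<Rightarrow> sexp \<Rightarrow> sexp" where
  "node_of A d =
    (if car d = enc_nat 2 then Pr (enc_nat 2) (look A (cdr d))
     else if car d = enc_nat 3 then Pr (enc_nat 3) (Pr (look A (car (cdr d))) (look A (cdr (cdr d))))
     else if car d = enc_nat 4 then Pr (enc_nat 4) (Pr (car (cdr d)) (look A (cdr (cdr d))))
     else d)"

text \<open>\<open>N\<close> lists the nodes with their positions, the last created first. A list of
  as many \<open>Nl\<close> as \<open>N\<close> has entries is therefore the next free position in
  unary.\<close>

definition hc_update :: "sexp list \<Rightarrow> sexp list \<Rightarrow> sexp \<Rightarrow> sexp \<Rightarrow> sexp" where
  "hc_update A N k nd =
    (if \<exists>x\<in>set N. car x = nd then Pr (slist (Pr k (look N nd) # A)) (slist N)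
     else Pr (slist (Pr k (slist (map (\<lambda>x. Nl) N)) # A)) (slist (Pr nd (slist (map (\<lambda>x. Nl) N)) # N)))"

definition hc_step :: "sexp \<Rightarrow> sexp \<Rightarrow> sexp" where
  "hc_step e st = hc_update (lst (car st)) (lst (cdr st)) (car e) (node_of (lst (car st)) (cdr e))"

definition hc_init :: sexp where
  "hc_init = Pr Nl (slist [Pr (Pr Nl Nl) Nl])"

definition hashcons :: "sexp list \<Rightarrow> sexp list" where
  "hashcons L = rev (map car (lst (cdr (foldr hc_step (rev L) hc_init))))"

lemma look_cases: "look L k = Nl \<or> (\<exists>e\<in>set L. car e = k \<and> look L k = cdr e)"
  by (cases "filter (\<lambda>e. car e = k) L")
    (auto simp: look_def filter_eq_Cons_iff)

text \<open>Positions are bounded by the number of executed instructions, and an entry consists of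
  parts of one instruction and at most three positions. The separate bound on \<open>cdr e\<close>,
  the position in an entry, keeps sizes from compounding through the fold.\<close>

lemma size_hc:
  "sexp_size (slist xs) \<le> n \<Longrightarrow> \<exists>A N. foldr hc_step xs hc_init = Pr (slist A) (slist N)
    \<and> length A \<le> length xs \<and> length N \<le> length xs + 1
    \<and> (\<forall>e\<in>set A \<union> set N. sexp_size e \<le> 7 * n + 30 \<and> sexp_size (cdr e) \<le> 2 * length xs + 1)"
proof (induction xs)
  case Nil
  then show ?case
    by (intro exI[of _ "[]"] exI[of _ "[Pr (Pr Nl Nl) Nl]"]) (auto simp: hc_init_def)
next
  case (Cons x xs)
  then obtain A N where st: "foldr hc_step xs hc_init = Pr (slist A) (slist N)"
    and len: "length A \<le> length xs" "length N \<le> length xs + 1"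
    and sz: "\<And>e. e \<in> set A \<or> e \<in> set N \<Longrightarrow> sexp_size e \<le> 7 * n + 30"
      "\<And>e. e \<in> set A \<or> e \<in> set N \<Longrightarrow> sexp_size (cdr e) \<le> 2 * length xs + 1"
    by auto
  have n: "length xs + sexp_size x + 1 \<le> n"
    using Cons.prems length_le_slist[of xs] by simp
  have look: "sexp_size (look A k) \<le> 2 * length xs + 1" "sexp_size (look N k) \<le> 2 * length xs + 1" for k
    using look_cases[of A k] look_cases[of N k] sz(2) by auto
  have len': "sexp_size (slist (map (\<lambda>x. Nl) N)) \<le> 2 * length xs + 3"
    using len(2) by (simp add: sexp_size_slist comp_def sum_list_triv)
  have x: "sexp_size (car x) \<le> sexp_size x" "sexp_size (cdr x) \<le> sexp_size x"
    "sexp_size (car (cdr (cdr x))) \<le> sexp_size x"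
    using sexp_size_car sexp_size_cdr le_trans by blast+
  have nd: "sexp_size (node_of A (cdr x)) \<le> sexp_size x + 4 * length xs + 12"
    unfolding node_of_def
    using look[of "cdr (cdr x)"] look[of "car (cdr (cdr x))"] look[of "cdr (cdr (cdr x))"] x by auto
  have eq: "foldr hc_step (x # xs) hc_init = hc_update A N (car x) (node_of A (cdr x))"
    by (simp add: st hc_step_def[of x])
  define nd where "nd = node_of A (cdr x)"
  have sz2: "sexp_size (cdr e) \<le> 2 * length xs + 3" if "e \<in> set A \<or> e \<in> set N" for e
    using sz(2)[OF that] by simp
  have look2: "sexp_size (look N nd) \<le> 2 * length xs + 3" using look(2)[of nd] by simp
  show ?case
  proof (cases "\<exists>y\<in>set N. car y = nd")
    case True
    have "foldr hc_step (x # xs) hc_init = Pr (slist (Pr (car x) (look N nd) # A)) (slist N)"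
      using True unfolding eq hc_update_def nd_def by (rule if_P)
    moreover have "sexp_size (Pr (car x) (look N nd)) \<le> 7 * n + 30"
      using n x(1) look2 by simp
    ultimately show ?thesis
      using len sz(1) sz2 look2
      by - (rule exI[of _ "Pr (car x) (look N nd) # A"], rule exI[of _ N], auto simp: numeral_3_eq_3)
  next
    case False
    have "foldr hc_step (x # xs) hc_init = Pr (slist (Pr (car x) (slist (map (\<lambda>x. Nl) N)) # A))
        (slist (Pr nd (slist (map (\<lambda>x. Nl) N)) # N))"
      using False unfolding eq hc_update_def nd_def by (rule if_not_P)
    moreover have "sexp_size (Pr (car x) (slist (map (\<lambda>x. Nl) N))) \<le> 7 * n + 30"
      "sexp_size (Pr nd (slist (map (\<lambda>x. Nl) N))) \<le> 7 * n + 30"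
      using n x(1) len' nd by (simp_all add: nd_def)
    ultimately show ?thesis
      using len sz(1) sz2 len'
      by - (rule exI[of _ "Pr (car x) (slist (map (\<lambda>x. Nl) N)) # A"],
          rule exI[of _ "Pr nd (slist (map (\<lambda>x. Nl) N)) # N"], auto simp: numeral_3_eq_3)
  qed
qed

lemma poly_time_list_hashcons:
  assumes "poly_time_list L"
  shows "poly_time_list (\<lambda>z. hashcons (L z))"
proof -
  have sz: "sexp_size (foldr hc_step xs hc_init) \<le> 3 + 2 * ((n + 1) * (7 * n + 31))"
    if n: "sexp_size (slist xs) \<le> n" for xs n
  proof -
    obtain A N where st: "foldr hc_step xs hc_init = Pr (slist A) (slist N)"
      and len: "length A \<le> length xs" "length N \<le> length xs + 1"
      and sz: "\<And>e. e \<in> set A \<Longrightarrow> sexp_size e \<le> 7 * n + 30" "\<And>e. e \<in> set N \<Longrightarrow> sexp_size e \<le> 7 * n + 30"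
      using size_hc[OF n] by auto
    have *: "sexp_size (slist B) \<le> 1 + (n + 1) * (7 * n + 31)"
      if "length B \<le> length xs + 1" "\<And>e. e \<in> set B \<Longrightarrow> sexp_size e \<le> 7 * n + 30" for B
    proof -
      have "(\<Sum>x\<leftarrow>B. 1 + sexp_size x) \<le> (\<Sum>x\<leftarrow>B. 7 * n + 31)"
        by (rule sum_list_mono) (use that(2) in force)
      also have "\<dots> = length B * (7 * n + 31)" by (simp only: sum_list_triv of_nat_id)
      also have "\<dots> \<le> (n + 1) * (7 * n + 31)"
        using that(1) n length_le_slist[of xs] by (intro mult_le_mono1) simp
      finally show ?thesis unfolding sexp_size_slist by simp
    qed
    from *[of A] *[of N] len sz show ?thesis unfolding st by simp
  qed
  have "poly_time (\<lambda>w. hc_step (car w) (car (cdr w)))"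
    unfolding hc_step_def hc_update_def node_of_def look_def
    by (intro poly_time_intros poly_time_enc_nat)
  then have "poly_time (\<lambda>z. foldr (\<lambda>x a. hc_step x a) (rev (L z)) hc_init)"
    unfolding hc_init_def
    by (intro poly_time_foldr[where B = "\<lambda>n. 3 + 2 * ((n + 1) * (7 * n + 31))"] pbounded_intros
        poly_time_intros assms sz[unfolded hc_init_def]) simp_all
  then show ?thesis unfolding hashcons_def by (intro poly_time_intros)
qed

subsection \<open>Correctness of hash-consing\<close>

fun aval :: "sexp \<Rightarrow> nat" where
  "aval (Atom a) = a"
| "aval x = 0"

text \<open>Phrased with equality tests only, since these are what a program can evaluate.\<close>

definition is_atom :: "sexp \<Rightarrow> bool" where
  "is_atom x \<longleftrightarrow> x \<noteq> Nl \<and> x \<noteq> Pr (car x) (cdr x)"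

lemma is_atom_iff: "is_atom x \<longleftrightarrow> (\<exists>a. x = Atom a)"
  by (cases x) (auto simp: is_atom_def)

fun kval :: "(sexp \<Rightarrow> concept) \<Rightarrow> sexp \<Rightarrow> concept" where
  "kval \<rho> d =
    (if car d = enc_nat 1 then Name (aval (cdr d))
     else if car d = enc_nat 2 then Neg (\<rho> (cdr d))
     else if car d = enc_nat 3 then And (\<rho> (car (cdr d))) (\<rho> (cdr (cdr d)))
     else if car d = enc_nat 4 then Exists (aval (car (cdr d))) (\<rho> (cdr (cdr d)))
     else Top)"

text \<open>On a malformed body \<open>kval\<close> falls back to defaults such as
  \<open>Top\<close>, whereas \<open>node_of\<close> may copy the body verbatim; for the five shapes
  listed here the two agree.\<close>

definition instr_ok :: "sexp \<Rightarrow> bool" where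
  "instr_ok e \<longleftrightarrow> (\<exists>k. e = Pr k (Pr Nl Nl) \<or> (\<exists>A. e = Pr k (Pr (enc_nat 1) (Atom A)))
    \<or> (\<exists>a. e = Pr k (Pr (enc_nat 2) a)) \<or> (\<exists>a b. e = Pr k (Pr (enc_nat 3) (Pr a b)))
    \<or> (\<exists>r a. e = Pr k (Pr (enc_nat 4) (Pr (Atom r) a))))"

fun exec :: "sexp list \<Rightarrow> (sexp \<Rightarrow> concept) \<Rightarrow> sexp \<Rightarrow> concept" where
  "exec [] \<rho> = \<rho>"
| "exec (e # L) \<rho> = exec L (\<rho>(car e := kval \<rho> (cdr e)))"

text \<open>All values ever assigned, including those overwritten later: besides the initial
  \<open>Top\<close>, exactly these become nodes.\<close>

fun vals :: "sexp list \<Rightarrow> (sexp \<Rightarrow> concept) \<Rightarrow> concept set" where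
  "vals [] \<rho> = {}"
| "vals (e # L) \<rho> = insert (kval \<rho> (cdr e)) (vals L (\<rho>(car e := kval \<rho> (cdr e))))"

definition dag_ok :: "node list \<Rightarrow> concept list \<Rightarrow> bool" where
  "dag_ok ns Cs \<longleftrightarrow> length Cs = length ns
    \<and> (\<forall>k < length ns. (\<forall>i\<in>children (ns ! k). i < k) \<and> Cs ! k = node_concept Cs (ns ! k))
    \<and> distinct Cs"

definition enc_nodes :: "node list \<Rightarrow> sexp list" where
  "enc_nodes ns = rev (map (\<lambda>i. Pr (enc_node (ns ! i)) (enc_nat i)) [0..<length ns])"

text \<open>\<open>\<rho>\<close> gives the current contents of the registers, \<open>V\<close> the
  concepts that already have a node.\<close>

definition hc_inv :: "(sexp \<Rightarrow> concept) \<Rightarrow> concept set \<Rightarrow> sexp \<Rightarrow> bool" where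
  "hc_inv \<rho> V st \<longleftrightarrow> (\<exists>A ns Cs. st = Pr (slist A) (slist (enc_nodes ns)) \<and> dag_ok ns Cs \<and> set Cs = V
    \<and> (\<forall>k. \<exists>i<length ns. look A k = enc_nat i \<and> Cs ! i = \<rho> k))"

lemma enc_nat_inject [simp]: "enc_nat i = enc_nat j \<longleftrightarrow> i = j"
proof (induction i arbitrary: j)
  case 0
  then show ?case by (cases j) auto
next
  case (Suc i)
  then show ?case by (cases j) auto
qed

lemma enc_node_inject: "enc_node m = enc_node n \<longleftrightarrow> m = n"
  by (cases m; cases n) auto

lemma enc_nat_length: "slist (map (\<lambda>x. Nl) xs) = enc_nat (length xs)"
  by (induction xs) auto

lemma node_concept_cong:
  "(\<And>i. i \<in> children n \<Longrightarrow> Cs ! i = Ds ! i) \<Longrightarrow> node_concept Cs n = node_concept Ds n"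
  by (cases n) auto

text \<open>The reason why hash-consing works: comparing nodes, which are small, decides equality of
  concepts, which may be huge.\<close>

lemma node_concept_inj:
  assumes "distinct Cs" "\<forall>i\<in>children m. i < length Cs" "\<forall>i\<in>children n. i < length Cs"
    and "node_concept Cs m = node_concept Cs n"
  shows "m = n"
  using assms by (cases m; cases n) (auto simp: nth_eq_iff_index_eq)

lemma node_of_correct:
  assumes "instr_ok e" "\<forall>k. \<exists>i<n. look A k = enc_nat i \<and> Cs ! i = \<rho> k"
  shows "\<exists>nd. node_of A (cdr e) = enc_node nd \<and> (\<forall>i\<in>children nd. i < n)
    \<and> node_concept Cs nd = kval \<rho> (cdr e)"
proof -
  obtain pos where pos: "\<And>k. pos k < n" "\<And>k. look A k = enc_nat (pos k)" "\<And>k. Cs ! pos k = \<rho> k"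
    using assms(2) by metis
  consider k where "e = Pr k (Pr Nl Nl)" | k A' where "e = Pr k (Pr (enc_nat 1) (Atom A'))"
    | k a where "e = Pr k (Pr (enc_nat 2) a)" | k a b where "e = Pr k (Pr (enc_nat 3) (Pr a b))"
    | k r a where "e = Pr k (Pr (enc_nat 4) (Pr (Atom r) a))"
    using assms(1) by (auto simp: instr_ok_def)
  then show ?thesis
  proof cases
    case 1
    then show ?thesis by (intro exI[of _ NTop]) (auto simp: node_of_def)
  next
    case 2
    then show ?thesis by (intro exI[of _ "NName A'"]) (auto simp: node_of_def)
  next
    case 3
    then show ?thesis by (intro exI[of _ "NNeg (pos a)"]) (auto simp: node_of_def pos)
  next
    case 4
    then show ?thesis by (intro exI[of _ "NAnd (pos a) (pos b)"]) (auto simp: node_of_def pos)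
  next
    case 5
    then show ?thesis by (intro exI[of _ "NExists r (pos a)"]) (auto simp: node_of_def pos)
  qed
qed

lemma look_Cons: "look (Pr k v # A) k' = (if k' = k then v else look A k')"
  by (auto simp: look_def)

text \<open>A known node leaves the DAG as it is. For a new node the concept is new as well, by
  \<open>node_concept_inj\<close>, so the list of concepts stays distinct.\<close>

lemma hc_step_inv:
  assumes inv: "hc_inv \<rho> V st" and e: "instr_ok e"
  shows "hc_inv (\<rho>(car e := kval \<rho> (cdr e))) (insert (kval \<rho> (cdr e)) V) (hc_step e st)"
proof -
  obtain A ns Cs where st: "st = Pr (slist A) (slist (enc_nodes ns))" and dag: "dag_ok ns Cs"
    and V: "set Cs = V" and pos: "\<forall>k. \<exists>i<length ns. look A k = enc_nat i \<and> Cs ! i = \<rho> k"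
    using inv by (auto simp: hc_inv_def)
  obtain nd where nd: "node_of A (cdr e) = enc_node nd" "\<forall>i\<in>children nd. i < length ns"
      "node_concept Cs nd = kval \<rho> (cdr e)"
    using node_of_correct[OF e pos] by blast
  have len: "length Cs = length ns" and dist: "distinct Cs"
    and ch: "\<And>k i. k < length ns \<Longrightarrow> i \<in> children (ns ! k) \<Longrightarrow> i < k"
    and Cs: "\<And>k. k < length ns \<Longrightarrow> Cs ! k = node_concept Cs (ns ! k)"
    using dag by (auto simp: dag_ok_def)
  have step: "hc_step e st = hc_update A (enc_nodes ns) (car e) (enc_node nd)"
    by (simp add: hc_step_def st nd(1))
  show ?thesis
  proof (cases "\<exists>x\<in>set (enc_nodes ns). car x = enc_node nd")
    case True
    obtain x where x: "x \<in> set (enc_nodes ns)" "car x = enc_node nd"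
      "look (enc_nodes ns) (enc_node nd) = cdr x"
    proof -
      obtain x xs where "filter (\<lambda>x. car x = enc_node nd) (enc_nodes ns) = x # xs"
        using True by (cases "filter (\<lambda>x. car x = enc_node nd) (enc_nodes ns)")
          (auto simp: filter_empty_conv)
      then show ?thesis using that[of x] by (auto simp: look_def filter_eq_Cons_iff)
    qed
    then obtain i where i: "i < length ns" "ns ! i = nd"
      "look (enc_nodes ns) (enc_node nd) = enc_nat i"
      by (auto simp: enc_nodes_def enc_node_inject)
    have Ci: "Cs ! i = kval \<rho> (cdr e)" using Cs[OF i(1)] i(2) nd(3) by simp
    have "hc_step e st = Pr (slist (Pr (car e) (enc_nat i) # A)) (slist (enc_nodes ns))"
      using True by (simp add: step hc_update_def i(3))
    moreover have "insert (kval \<rho> (cdr e)) V = set Cs"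
      using V Ci[symmetric] i(1) len by auto
    moreover have "\<exists>j<length ns. look (Pr (car e) (enc_nat i) # A) k = enc_nat j
        \<and> Cs ! j = (\<rho>(car e := kval \<rho> (cdr e))) k" for k
      using pos Ci i(1) by (cases "k = car e") (auto simp: look_Cons simp del: kval.simps)
    ultimately show ?thesis unfolding hc_inv_def using dag by metis
  next
    case False
    let ?C = "kval \<rho> (cdr e)"
    have new: "nd \<notin> set ns"
    proof
      assume "nd \<in> set ns"
      then obtain i where i: "i < length ns" "ns ! i = nd" by (auto simp: in_set_conv_nth)
      then have "Pr (enc_node nd) (enc_nat i) \<in> set (enc_nodes ns)" by (auto simp: enc_nodes_def)
      then show False using False by force
    qed
    have C: "?C \<notin> set Cs"
    proof
      assume "?C \<in> set Cs"
      then obtain i where i: "i < length ns" "Cs ! i = ?C" by (auto simp: in_set_conv_nth len)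
      then have "node_concept Cs (ns ! i) = node_concept Cs nd" using Cs nd(3) by simp
      then have "ns ! i = nd"
        using node_concept_inj[OF dist, of "ns ! i" nd] nd(2) ch i(1) len by force
      then show False using new i(1) by auto
    qed
    have enc: "enc_nodes (ns @ [nd]) = Pr (enc_node nd) (enc_nat (length ns)) # enc_nodes ns"
      by (auto simp: enc_nodes_def nth_append)
    have l: "length (enc_nodes ns) = length ns" by (simp add: enc_nodes_def)
    have "hc_step e st = Pr (slist (Pr (car e) (enc_nat (length ns)) # A)) (slist (enc_nodes (ns @ [nd])))"
      using False by (simp add: step hc_update_def enc enc_nat_length l)
    moreover have "insert ?C V = set (Cs @ [?C])" using V by auto
    moreover have "dag_ok (ns @ [nd]) (Cs @ [?C])"
      unfolding dag_ok_def
    proof (intro conjI allI impI)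
      fix k assume k: "k < length (ns @ [nd])"
      show "\<forall>i\<in>children ((ns @ [nd]) ! k). i < k"
        using k ch nd(2) by (auto simp: nth_append less_Suc_eq)
      have "node_concept Cs ((ns @ [nd]) ! k) = node_concept (Cs @ [?C]) ((ns @ [nd]) ! k)"
        by (rule node_concept_cong) (use k ch nd(2) len in \<open>fastforce simp: nth_append less_Suc_eq\<close>)
      then show "(Cs @ [?C]) ! k = node_concept (Cs @ [?C]) ((ns @ [nd]) ! k)"
        using k Cs nd(3) len by (auto simp: nth_append less_Suc_eq simp del: kval.simps)
    qed (use dist C len in auto)
    moreover have "\<exists>j<length (ns @ [nd]). look (Pr (car e) (enc_nat (length ns)) # A) k = enc_nat j
        \<and> (Cs @ [?C]) ! j = (\<rho>(car e := ?C)) k" for k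
    proof (cases "k = car e")
      case True
      then show ?thesis using len by (intro exI[of _ "length ns"]) (auto simp: look_Cons nth_append
        simp del: kval.simps)
    next
      case False
      obtain i where "i < length ns" "look A k = enc_nat i" "Cs ! i = \<rho> k" using pos by blast
      then show ?thesis using False len
        by (intro exI[of _ i]) (auto simp: look_Cons nth_append simp del: kval.simps)
    qed
    ultimately show ?thesis unfolding hc_inv_def by metis
  qed
qed

lemma hc_fold_inv:
  "hc_inv \<rho> V st \<Longrightarrow> \<forall>e\<in>set L. instr_ok e \<Longrightarrow> hc_inv (exec L \<rho>) (V \<union> vals L \<rho>) (fold hc_step L st)"
proof (induction L arbitrary: \<rho> V st)
  case (Cons e L)
  then show ?case
    using Cons.IH[OF hc_step_inv[OF Cons.prems(1), of e]] by (simp add: fun_upd_def del: kval.simps)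
qed simp

lemma hc_inv_init: "hc_inv (\<lambda>k. Top) {Top} hc_init"
  unfolding hc_inv_def
  by (rule exI[of _ "[]"], rule exI[of _ "[NTop]"], rule exI[of _ "[Top]"])
    (auto simp: hc_init_def enc_nodes_def dag_ok_def look_def)

text \<open>Children precede their parents, hence all subconcepts of a node sit at or before its
  position.\<close>

lemma dag_ok_subconcepts:
  assumes "dag_ok ns Cs"
  shows "i < length ns \<Longrightarrow> D \<in> subconcepts (Cs ! i) \<Longrightarrow> \<exists>j\<le>i. Cs ! j = D"
proof (induction i rule: less_induct)
  case (less i)
  have ch: "\<And>j. j \<in> children (ns ! i) \<Longrightarrow> j < i" and C: "Cs ! i = node_concept Cs (ns ! i)"
    using assms less.prems(1) by (auto simp: dag_ok_def)
  have "D = Cs ! i \<or> (\<exists>j\<in>children (ns ! i). D \<in> subconcepts (Cs ! j))"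
    using less.prems(2) C by (cases "ns ! i") auto
  then show ?case
  proof
    assume "\<exists>j\<in>children (ns ! i). D \<in> subconcepts (Cs ! j)"
    then obtain j where j: "j < i" "D \<in> subconcepts (Cs ! j)" using ch by blast
    with less.IH[of j] less.prems(1) obtain j' where "j' \<le> j" "Cs ! j' = D" by auto
    with j show ?thesis by (intro exI[of _ j']) auto
  qed auto
qed

lemma hashcons_correct:
  assumes ok: "\<forall>e\<in>set L. instr_ok e" and E: "E \<in> vals L (\<lambda>k. Top)"
    and sub: "insert Top (vals L (\<lambda>k. Top)) \<subseteq> subconcepts E"
  shows "\<exists>ns. slist (hashcons L) = enc_dag ns \<and> is_dag_of ns E"
proof -
  have "foldr hc_step (rev L) hc_init = fold hc_step L hc_init" by (simp add: foldr_conv_fold)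
  then obtain A ns Cs where st: "foldr hc_step (rev L) hc_init = Pr (slist A) (slist (enc_nodes ns))"
    and dag: "dag_ok ns Cs" and V: "set Cs = insert Top (vals L (\<lambda>k. Top))"
    using hc_fold_inv[OF hc_inv_init ok] by (auto simp: hc_inv_def)
  have "hashcons L = map (\<lambda>i. enc_node (ns ! i)) [0..<length ns]"
    by (simp add: hashcons_def st enc_nodes_def rev_map[symmetric] comp_def)
  also have "\<dots> = map enc_node ns" by (rule nth_equalityI) auto
  finally have "hashcons L = map enc_node ns" .
  moreover have "slist (map enc_node ns) = enc_dag ns" by (induction ns) (simp_all add: enc_dag_def)
  ultimately have "slist (hashcons L) = enc_dag ns" by simp
  moreover have "is_dag_of ns E"
  proof -
    have len: "length Cs = length ns" and dist: "distinct Cs" using dag by (auto simp: dag_ok_def)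
    obtain i where i: "i < length ns" "Cs ! i = E"
      using E V len by (metis in_set_conv_nth insertI2)
    have pre: "\<exists>j\<le>i. Cs ! j = D" if "D \<in> subconcepts E" for D
      using dag_ok_subconcepts[OF dag i(1)] that i(2) by simp
    have set: "set Cs = subconcepts E"
    proof
      show "subconcepts E \<subseteq> set Cs"
      proof
        fix D assume "D \<in> subconcepts E"
        from pre[OF this] i(1) len show "D \<in> set Cs" by (auto intro: nth_mem)
      qed
    qed (use sub V in auto)
    \<comment> \<open>All nodes are subconcepts of \<open>E\<close> and so lie at or before position
      \<open>i\<close>. Applied to the last node, this shows that the root \<open>E\<close> is
      last.\<close>
    have "last Cs \<in> set Cs" using i(1) len by (intro last_in_set) auto
    then obtain j where j: "j \<le> i" "Cs ! j = last Cs" using pre set by auto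
    have "last Cs = Cs ! (length ns - 1)" using i(1) len by (metis last_conv_nth length_0_conv
      not_less_zero)
    then have "j = length ns - 1"
      using j i(1) dist len nth_eq_iff_index_eq[OF dist, of j "length ns - 1"] by force
    then have "i = length ns - 1" using j(1) i(1) by simp
    then have "last Cs = E" using \<open>last Cs = Cs ! (length ns - 1)\<close> i(2) by simp
    then show ?thesis unfolding is_dag_of_def using dag set by (auto simp: dag_ok_def)
  qed
  ultimately show ?thesis by blast
qed

section \<open>Instructions and their effect on the registers\<close>

definition i_top where "i_top k = Pr k (Pr Nl Nl)"
definition i_name where "i_name k s = Pr k (Pr (enc_nat 1) s)"
definition i_neg where "i_neg k a = Pr k (Pr (enc_nat 2) a)"
definition i_and where "i_and k a b = Pr k (Pr (enc_nat 3) (Pr a b))"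
definition i_ex where "i_ex k r a = Pr k (Pr (enc_nat 4) (Pr r a))"

lemmas instr_defs = i_top_def i_name_def i_neg_def i_and_def i_ex_def

lemma instr_ok_intros:
  "instr_ok (i_top k)" "is_atom s \<Longrightarrow> instr_ok (i_name k s)" "instr_ok (i_neg k a)"
  "instr_ok (i_and k a b)" "is_atom r \<Longrightarrow> instr_ok (i_ex k r a)"
  by (auto simp: instr_ok_def instr_defs is_atom_iff)

lemma exec_simps:
  "exec (i_top k # L) \<rho> = exec L (\<rho>(k := Top))"
  "exec (i_name k s # L) \<rho> = exec L (\<rho>(k := Name (aval s)))"
  "exec (i_neg k a # L) \<rho> = exec L (\<rho>(k := Neg (\<rho> a)))"
  "exec (i_and k a b # L) \<rho> = exec L (\<rho>(k := And (\<rho> a) (\<rho> b)))"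
  "exec (i_ex k r a # L) \<rho> = exec L (\<rho>(k := Exists (aval r) (\<rho> a)))"
  by (simp_all add: instr_defs)

lemma vals_simps:
  "vals (i_top k # L) \<rho> = insert Top (vals L (\<rho>(k := Top)))"
  "vals (i_neg k a # L) \<rho> = insert (Neg (\<rho> a)) (vals L (\<rho>(k := Neg (\<rho> a))))"
  "vals (i_and k a b # L) \<rho> = insert (And (\<rho> a) (\<rho> b)) (vals L (\<rho>(k := And (\<rho> a) (\<rho> b))))"
  by (simp_all add: instr_defs)

lemma exec_append: "exec (K @ L) \<rho> = exec L (exec K \<rho>)"
  by (induction K arbitrary: \<rho>) (simp_all del: kval.simps)

lemma vals_append: "vals (K @ L) \<rho> = vals K \<rho> \<union> vals L (exec K \<rho>)"
  by (induction K arbitrary: \<rho>) (simp_all del: kval.simps)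

declare kval.simps [simp del] exec.simps(2) [simp del] vals.simps(2) [simp del]

subsection \<open>Making every node reachable from the root\<close>

text \<open>
  A DAG of \<open>E\<close> may contain only subconcepts of \<open>E\<close>. Therefore, after each assignment to a register
  \<open>k\<close>, the tautology \<open>\<not> (k \<sqinter> \<not> k)\<close> is added to a conjunction that becomes part of the root.
\<close>

definition pad_reg :: "nat \<Rightarrow> sexp" where
  "pad_reg i = Pr (enc_nat 3) (enc_nat i)"

definition pad1 :: "sexp \<Rightarrow> sexp list" where
  "pad1 e = [e, i_neg (pad_reg 1) (car e), i_and (pad_reg 2) (car e) (pad_reg 1),
    i_neg (pad_reg 3) (pad_reg 2), i_and (pad_reg 0) (pad_reg 0) (pad_reg 3)]"

definition pad :: "sexp \<Rightarrow> sexp list \<Rightarrow> sexp list" where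
  "pad k L = concat (map pad1 L) @ [i_and (pad_reg 0) (pad_reg 0) k]"

text \<open>Tag 3 is reserved for the padding; \<open>reg_F\<close>, \<open>reg_X\<close> and
  \<open>reg\<close> use the tags 0, 1 and 2.\<close>

definition user_key :: "sexp \<Rightarrow> bool" where
  "user_key k \<longleftrightarrow> car k \<noteq> enc_nat 3"

text \<open>Independence of the padding registers is stated semantically: it allows the padding to
  change them between two instructions of the original program.\<close>

definition user_instr :: "sexp \<Rightarrow> bool" where
  "user_instr e \<longleftrightarrow> user_key (car e) \<and> (\<forall>\<rho> \<rho>'. (\<forall>k. user_key k \<longrightarrow> \<rho> k = \<rho>' k) \<longrightarrow> kval \<rho> (cdr e) = kval
    \<rho>' (cdr e))"

lemma user_key_pad_reg [simp]: "\<not> user_key (pad_reg i)"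
  by (simp add: user_key_def pad_reg_def)

lemma user_key_neq_pad_reg: "user_key k \<Longrightarrow> k \<noteq> pad_reg i"
  by auto

lemma pad_reg_inject [simp]: "pad_reg i = pad_reg j \<longleftrightarrow> i = j"
  by (simp add: pad_reg_def)

lemma pad1_exec:
  assumes e: "user_instr e" and \<rho>: "\<forall>k. user_key k \<longrightarrow> \<rho> k = \<rho>' k"
  defines "C \<equiv> kval \<rho>' (cdr e)" and "acc \<equiv> \<rho> (pad_reg 0)"
  defines "acc' \<equiv> And acc (Neg (And C (Neg C)))"
  shows "exec (pad1 e) \<rho> (pad_reg 0) = acc'"
    and "user_key k \<Longrightarrow> exec (pad1 e) \<rho> k = (\<rho>'(car e := C)) k"
    and "vals (pad1 e) \<rho> = {C, Neg C, And C (Neg C), Neg (And C (Neg C)), acc'}"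
proof -
  have C: "kval \<rho> (cdr e) = C" using e \<rho> unfolding user_instr_def C_def by blast
  have ne: "car e \<noteq> pad_reg i" for i using e by (auto simp: user_instr_def)
  have ee: "exec (e # L) \<rho> = exec L (\<rho>(car e := C))" "vals (e # L) \<rho> = insert C (vals L (\<rho>(car e :=
    C)))" for L
    by (simp_all only: exec.simps vals.simps C)
  note s = pad1_def ee C exec_simps vals_simps
  show "exec (pad1 e) \<rho> (pad_reg 0) = acc'"
    by (simp add: s ne ne[symmetric] acc'_def acc_def)
  show "user_key k \<Longrightarrow> exec (pad1 e) \<rho> k = (\<rho>'(car e := C)) k"
    using \<rho> by (auto simp: s dest: user_key_neq_pad_reg)
  show "vals (pad1 e) \<rho> = {C, Neg C, And C (Neg C), Neg (And C (Neg C)), acc'}"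
    by (simp add: s ne ne[symmetric] acc'_def acc_def)
qed

text \<open>Only tautologies are conjoined to the accumulator, so its extension remains the domain,
  while every earlier value, its own earlier versions included, remains a subconcept of it.
  \<open>V\<close> carries the values of the instructions already executed.\<close>

lemma pad_exec:
  assumes "\<forall>e\<in>set L. user_instr e" "\<forall>k. user_key k \<longrightarrow> \<rho> k = \<rho>' k"
    "V \<subseteq> subconcepts (\<rho> (pad_reg 0))"
    "\<forall>I. is_interp I \<longrightarrow> ext (I :: nat interp) (\<rho> (pad_reg 0)) = domain I"
    "\<forall>C\<in>W. sig_concept C \<subseteq> S" "sig_concept (\<rho> (pad_reg 0)) \<subseteq> S" "vals L \<rho>' \<subseteq> W"
  defines "P \<equiv> concat (map pad1 L)"
  shows "(\<forall>k. user_key k \<longrightarrow> exec P \<rho> k = exec L \<rho>' k)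
    \<and> V \<union> vals P \<rho> \<subseteq> subconcepts (exec P \<rho> (pad_reg 0))
    \<and> (\<forall>I. is_interp I \<longrightarrow> ext (I :: nat interp) (exec P \<rho> (pad_reg 0)) = domain I)
    \<and> sig_concept (exec P \<rho> (pad_reg 0)) \<subseteq> S"
  using assms(1-7) unfolding P_def
proof (induction L arbitrary: \<rho> \<rho>' V)
  case (Cons e L)
  let ?C = "kval \<rho>' (cdr e)"
  let ?\<rho> = "exec (pad1 e) \<rho>"
  have e: "user_instr e" using Cons.prems by simp
  note p = pad1_exec[OF e Cons.prems(2)]
  have sub_trans: "subconcepts (\<rho> (pad_reg 0)) \<subseteq> subconcepts (?\<rho> (pad_reg 0))"
    by (simp add: p(1) subset_insertI2)
  have 1: "V \<union> vals (pad1 e) \<rho> \<subseteq> subconcepts (?\<rho> (pad_reg 0))"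
    using Cons.prems(3) by (auto simp: p(1,3) subconcepts_self)
  have 2: "\<forall>I. is_interp I \<longrightarrow> ext (I :: nat interp) (?\<rho> (pad_reg 0)) = domain I"
    using Cons.prems(4) by (auto simp: p(1))
  have C: "?C \<in> W" "vals L (\<rho>'(car e := ?C)) \<subseteq> W" using Cons.prems(7) by (auto simp: vals.simps(2))
  have 3: "sig_concept (?\<rho> (pad_reg 0)) \<subseteq> S"
    using Cons.prems(5,6) C(1) by (auto simp: p(1))
  have 4: "\<forall>k. user_key k \<longrightarrow> ?\<rho> k = (\<rho>'(car e := ?C)) k" using p(2) by blast
  from Cons.IH[OF _ 4 1 2 Cons.prems(5) 3 C(2)] Cons.prems(1)
  show ?case by (simp add: exec_append vals_append Un_assoc fun_upd_def exec.simps(2) vals.simps(2))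
qed auto

lemma pad1_ok: "instr_ok e \<Longrightarrow> x \<in> set (pad1 e) \<Longrightarrow> instr_ok x"
  by (auto simp: pad1_def intro: instr_ok_intros)

lemma hashcons_pad:
  assumes ok: "\<forall>e\<in>set L. instr_ok e \<and> user_instr e" and k: "user_key k"
    and S: "\<forall>C\<in>vals L (\<lambda>k. Top). sig_concept C \<subseteq> S"
  obtains E ns where "slist (hashcons (pad k L)) = enc_dag ns" "is_dag_of ns E"
    "sig_concept E \<subseteq> S" 
    "\<And>I. is_interp (I :: nat interp) \<Longrightarrow> ext I E = ext I (exec L (\<lambda>k. Top) k)"
proof -
  let ?P = "concat (map pad1 L)"
  let ?\<rho> = "exec ?P (\<lambda>k. Top)"
  have p: "(\<forall>k. user_key k \<longrightarrow> ?\<rho> k = exec L (\<lambda>k. Top) k)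
    \<and> {Top} \<union> vals ?P (\<lambda>k. Top) \<subseteq> subconcepts (?\<rho> (pad_reg 0))
    \<and> (\<forall>I. is_interp I \<longrightarrow> ext (I :: nat interp) (?\<rho> (pad_reg 0)) = domain I)
    \<and> sig_concept (?\<rho> (pad_reg 0)) \<subseteq> S"
    by (rule pad_exec[where W = "vals L (\<lambda>k. Top)"]) (use ok S in auto)
  \<comment> \<open>The accumulator makes every node a subconcept of the root and, being a
    tautology, does not change the extension of register \<open>k\<close>.\<close>
  define E where "E = And (?\<rho> (pad_reg 0)) (?\<rho> k)"
  have vals: "vals (pad k L) (\<lambda>k. Top) = insert E (vals ?P (\<lambda>k. Top))"
    by (simp add: pad_def vals_append vals_simps E_def)
  have kS: "sig_concept (exec L \<rho> k) \<subseteq> S" if "\<forall>C\<in>vals L \<rho>. sig_concept C \<subseteq> S" "sig_concept (\<rho> k) \<subseteq> S" for \<rho>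
    using that by (induction L arbitrary: \<rho>) (simp_all add: exec.simps(2) vals.simps(2))
  have "\<forall>e\<in>set (pad k L). instr_ok e"
    using ok pad1_ok by (auto simp: pad_def intro: instr_ok_intros)
  then have "\<exists>ns. slist (hashcons (pad k L)) = enc_dag ns \<and> is_dag_of ns E"
    by (rule hashcons_correct) (use vals p in \<open>auto simp: E_def\<close>)
  moreover have "ext I E = ext I (exec L (\<lambda>k. Top) k)" if "is_interp I" for I :: "nat interp"
    using p that k ext_subset_dom[OF that] by (auto simp: E_def)
  moreover have "sig_concept E \<subseteq> S" using p k kS[OF S] by (auto simp: E_def)
  ultimately show ?thesis using that by blast
qed

section \<open>The algorithm\<close>

definition smem :: "sexp \<Rightarrow> sexp \<Rightarrow> bool" where
  "smem x t \<longleftrightarrow> x \<in> set (lst t)"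

definition is_ex :: "sexp \<Rightarrow> bool" where
  "is_ex x \<longleftrightarrow> car x = enc_nat 4 \<and> is_atom (car (cdr x))"

definition ex_role :: "sexp \<Rightarrow> sexp" where
  "ex_role x = car (cdr x)"

definition ex_arg :: "sexp \<Rightarrow> sexp" where
  "ex_arg x = cdr (cdr x)"

definition is_csym :: "sexp \<Rightarrow> bool" where
  "is_csym s \<longleftrightarrow> car s = enc_nat 0 \<and> is_atom (cdr s)"

definition is_rsym :: "sexp \<Rightarrow> bool" where
  "is_rsym s \<longleftrightarrow> car s = enc_nat 1 \<and> is_atom (cdr s)"

text \<open>Scratch registers. \<open>reg_F t\<close> will hold the concept saying that
  \<open>t\<close> belongs to the current view, \<open>reg_X Y\<close> the concept saying that the
  current view is exactly \<open>Y\<close>.\<close>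

definition reg :: "nat \<Rightarrow> sexp" where
  "reg i = Pr (enc_nat 2) (enc_nat i)"

definition reg_F :: "sexp \<Rightarrow> sexp" where
  "reg_F t = Pr (enc_nat 0) t"

definition reg_X :: "sexp \<Rightarrow> sexp" where
  "reg_X Y = Pr (enc_nat 1) Y"

text \<open>\<open>A\<close> holds the codes of the axioms, \<open>U\<close> the subtrees of the
  input, \<open>W\<close> the sublists of \<open>U\<close>, \<open>SY\<close> the codes of the given
  \<Sigma>-symbols, \<open>Ys\<close> the sublists of \<open>types0\<close>, and \<open>c0\<close>
  the code of the left-hand concept. Every quantifier below ranges over one of these lists or a list
  derived from them, which makes all notions polynomial in their size.\<close>

locale alg =
  fixes A U W SY Ys :: "sexp list" and c0 :: sexp
begin

text \<open>
  Candidate types and sets of roles are both represented by the sublists \<open>W\<close> of \<open>U\<close>. Quantifying over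
  the closed sets of roles yields the reflexive transitive closure of the role inclusions without an
  iteration.
\<close>

definition role_closed :: "sexp \<Rightarrow> bool" where
  "role_closed \<rho> \<longleftrightarrow> (\<forall>a\<in>set A. car a = enc_nat 1 \<longrightarrow> smem (car (cdr a)) \<rho> \<longrightarrow> smem (cdr (cdr a)) \<rho>)"

definition subrole :: "sexp \<Rightarrow> sexp \<Rightarrow> bool" where
  "subrole r s \<longleftrightarrow> (\<forall>\<rho>\<in>set W. role_closed \<rho> \<longrightarrow> smem r \<rho> \<longrightarrow> smem s \<rho>)"

text \<open>The condition on a successor type, read contrapositively: an existential restriction
  along a superrole of \<open>r\<close> that is missing in \<open>t\<close> forbids its filler in
  \<open>t'\<close>.\<close>

definition compat :: "sexp \<Rightarrow> sexp \<Rightarrow> sexp \<Rightarrow> bool" where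
  "compat r t t' \<longleftrightarrow> (\<forall>x\<in>set U. is_ex x \<and> subrole r (ex_role x) \<and> smem (ex_arg x) t' \<longrightarrow> smem x t)"

definition loc_ok :: "sexp \<Rightarrow> bool" where
  "loc_ok t \<longleftrightarrow>
    (\<forall>x\<in>set U. (x = Pr Nl Nl \<longrightarrow> smem x t) \<and> (car x = enc_nat 2 \<longrightarrow> smem x t = (\<not> smem (cdr x) t))
      \<and> (car x = enc_nat 3 \<longrightarrow> smem x t = (smem (car (cdr x)) t \<and> smem (cdr (cdr x)) t)))
    \<and> (\<forall>a\<in>set A. car a = enc_nat 0 \<longrightarrow> smem (car (cdr a)) t \<longrightarrow> smem (cdr (cdr a)) t)"

definition types0 :: "sexp list" where
  "types0 = filter (\<lambda>t. loc_ok t) W"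

definition self_witnessing :: "sexp \<Rightarrow> bool" where
  "self_witnessing Y \<longleftrightarrow> (\<forall>t\<in>set (lst Y). \<forall>x\<in>set U. is_ex x \<and> smem x t \<longrightarrow>
    (\<exists>t'\<in>set (lst Y). smem (ex_arg x) t' \<and> compat (ex_role x) t t'))"

text \<open>
  The union of all self-witnessing sets is self-witnessing, which replaces the iterated elimination of
  types without witnesses.
\<close>

definition realizable :: "sexp \<Rightarrow> bool" where
  "realizable t \<longleftrightarrow> (\<exists>Y\<in>set Ys. smem t Y \<and> self_witnessing Y)"

definition types :: "sexp list" where
  "types = filter (\<lambda>t. realizable t) types0"

text \<open>The sublists of \<open>types\<close>, selected from those of the longer list
  \<open>types0\<close>: a third powerset is avoided.\<close>

definition mosaics :: "sexp list" where
  "mosaics = filter (\<lambda>Y. \<forall>t\<in>set (lst Y). realizable t) Ys"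

section \<open>Instructions computing the concepts of one level\<close>

definition names_block :: "sexp \<Rightarrow> sexp \<Rightarrow> sexp list" where
  "names_block t s = (if is_csym s then i_name (reg 0) (cdr s) #
     (if smem (Pr (enc_nat 1) (cdr s)) t then [i_and (reg_F t) (reg_F t) (reg 0)]
      else [i_neg (reg 1) (reg 0), i_and (reg_F t) (reg_F t) (reg 1)]) else [])"

text \<open>If no type of \<open>Y\<close> can follow \<open>t\<close> along the role, then a
  successor of view \<open>Y\<close> excludes \<open>t\<close> from the next view.\<close>

definition univ_block1 :: "sexp \<Rightarrow> sexp \<Rightarrow> sexp \<Rightarrow> sexp list" where
  "univ_block1 t s Y = (if \<exists>t'\<in>set (lst Y). compat (cdr s) t t' then []
     else [i_ex (reg 0) (cdr s) (reg_X Y), i_neg (reg 1) (reg 0), i_and (reg_F t) (reg_F t) (reg 1)])"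

definition univ_block :: "sexp \<Rightarrow> sexp \<Rightarrow> sexp list" where
  "univ_block t s = (if is_rsym s then concat (map (\<lambda>Y. univ_block1 t s Y) mosaics) else [])"

text \<open>A concept cannot say that one successor is reached along several roles. It suffices to
  ask for successors with the same view \<open>Y\<close> along each \<Sigma>-superrole, because
  views and not points are matched. Without such a superrole the conjunction is
  \<open>Top\<close>.\<close>

definition ex_block2 :: "sexp \<Rightarrow> sexp \<Rightarrow> sexp \<Rightarrow> sexp list" where
  "ex_block2 x Y s = (if is_rsym s \<and> subrole (ex_role x) (cdr s)
     then [i_ex (reg 2) (cdr s) (reg_X Y), i_and (reg 1) (reg 1) (reg 2)] else [])"

text \<open>The disjunction over the possible views \<open>Y\<close> of a witness is formed by De
  Morgan: \<open>reg 0\<close> collects the negated disjuncts, and \<open>reg 1\<close> the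
  conjunction over the roles.\<close>

definition ex_block1 :: "sexp \<Rightarrow> sexp \<Rightarrow> sexp \<Rightarrow> sexp list" where
  "ex_block1 t x Y = (if \<exists>t'\<in>set (lst Y). smem (ex_arg x) t' \<and> compat (ex_role x) t t'
     then i_top (reg 1) # concat (map (\<lambda>s. ex_block2 x Y s) SY)
       @ [i_neg (reg 2) (reg 1), i_and (reg 0) (reg 0) (reg 2)] else [])"

definition ex_block :: "sexp \<Rightarrow> sexp \<Rightarrow> sexp list" where
  "ex_block t x = (if is_ex x \<and> smem x t
     then i_top (reg 0) # concat (map (\<lambda>Y. ex_block1 t x Y) mosaics)
       @ [i_neg (reg 1) (reg 0), i_and (reg_F t) (reg_F t) (reg 1)] else [])"

definition F_block :: "sexp \<Rightarrow> sexp list" where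
  "F_block t = i_top (reg_F t) # concat (map (\<lambda>s. names_block t s) SY)
     @ concat (map (\<lambda>s. univ_block t s) SY) @ concat (map (\<lambda>x. ex_block t x) U)"

definition X_block1 :: "sexp \<Rightarrow> sexp \<Rightarrow> sexp list" where
  "X_block1 Y t = (if smem t Y then [i_and (reg_X Y) (reg_X Y) (reg_F t)]
     else [i_neg (reg 0) (reg_F t), i_and (reg_X Y) (reg_X Y) (reg 0)])"

definition X_block :: "sexp \<Rightarrow> sexp list" where
  "X_block Y = i_top (reg_X Y) # concat (map (\<lambda>t. X_block1 Y t) types)"

text \<open>The order matters: all \<open>reg_X\<close> are computed from the old
  \<open>reg_F\<close> before any \<open>reg_F\<close> is overwritten.\<close>

definition level_block :: "sexp list" where
  "level_block = concat (map (\<lambda>Y. X_block Y) mosaics) @ concat (map (\<lambda>t. F_block t) types)"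

definition result_block1 :: "sexp \<Rightarrow> sexp list" where
  "result_block1 t = (if smem c0 t then [i_neg (reg 1) (reg_F t), i_and (reg 0) (reg 0) (reg 1)] else [])"

text \<open>
  The registers are overwritten from level to level. Initially they hold \<open>Top\<close>, which puts every type
  into view 0.
\<close>

definition prog :: "sexp list" where
  "prog = concat (map (\<lambda>Y. level_block) Ys)
     @ i_top (reg 0) # concat (map (\<lambda>t. result_block1 t) types) @ [i_neg (reg 1) (reg 0)]"

end

text \<open>With \<open>Nl\<close> present, \<open>U\<close> is closed under the total functions
  \<open>car\<close> and \<open>cdr\<close>. Atoms are subtrees too, so sets of role names occur
  among the sublists of \<open>U\<close>.\<close>

definition univ :: "sexp \<Rightarrow> sexp list" where
  "univ inp = Nl # subtrees inp"

definition stage1 :: "sexp \<Rightarrow> sexp" where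
  "stage1 inp = Pr (slist (map slist (subseqs (univ inp)))) inp"

definition stage2 :: "sexp \<Rightarrow> sexp" where
  "stage2 z = Pr (slist (map slist (subseqs
     (alg.types0 (lst (car (cdr z))) (univ (cdr z)) (lst (car z)))))) z"

definition stage3 :: "sexp \<Rightarrow> sexp" where
  "stage3 z = slist (hashcons (pad (reg 1)
     (alg.prog (lst (car (cdr (cdr z)))) (univ (cdr (cdr z))) (lst (car (cdr z)))
       (lst (cdr (cdr (cdr (cdr (cdr z)))))) (lst (car z)) (car (cdr (cdr (cdr z)))))))"

lemmas sexp_defs = smem_def is_ex_def ex_role_def ex_arg_def is_csym_def is_rsym_def is_atom_def
  reg_def reg_F_def reg_X_def instr_defs univ_def

lemmas alg_type_defs = alg.role_closed_def alg.subrole_def alg.compat_def alg.loc_ok_def alg.types0_def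
  alg.self_witnessing_def alg.realizable_def alg.types_def alg.mosaics_def

lemmas alg_block_defs = alg.names_block_def alg.univ_block1_def alg.univ_block_def
  alg.ex_block2_def alg.ex_block1_def alg.ex_block_def alg.F_block_def alg.X_block1_def alg.X_block_def
  alg.level_block_def alg.result_block1_def alg.prog_def

text \<open>Once both powersets are written out, the rest consists of nested loops over given lists.
  The list \<open>Ys\<close> doubles as the counter for the levels.\<close>

lemma timed_stages: "\<exists>p. timed (\<lambda>z. stage3 (stage2 (stage1 z))) (\<lambda>n. 2 ^ 2 ^ poly p n)"
proof -
  have "poly_time_list univ"
    unfolding univ_def[abs_def] by (intro poly_time_intros poly_time_list_subtrees)
  from timed_subseqs[OF this] obtain p1 where p1: "timed stage1 (\<lambda>n. 2 ^ poly p1 n)"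
    by (auto simp: stage1_def[abs_def])
  have "poly_time_list (\<lambda>z. alg.types0 (lst (car (cdr z))) (univ (cdr z)) (lst (car z)))"
    unfolding alg_type_defs sexp_defs by (intro poly_time_intros poly_time_list_subtrees poly_time_enc_nat)
  from timed_subseqs[OF this] obtain p2 where p2: "timed stage2 (\<lambda>n. 2 ^ poly p2 n)"
    by (auto simp: stage2_def[abs_def])
  have "poly_time stage3"
    unfolding stage3_def[abs_def] pad_def pad1_def[abs_def] pad_reg_def alg_block_defs alg_type_defs
      sexp_defs
    by (intro poly_time_slist poly_time_list_hashcons poly_time_list_append
      poly_time_list_concat_map poly_time_intros poly_time_list_subtrees poly_time_enc_nat)
  from timed_double_exp[OF p1 p2 this] show ?thesis .
qed

section \<open>Semantics of the generated program\<close>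

text \<open>The specification of a block that conjoins a condition \<open>Q\<close> to register
  \<open>a\<close> and touches only registers in \<open>K\<close>. It speaks of extensions, so a
  loop over blocks becomes an intersection of sets.\<close>

definition conj_step ::
    "'d interp \<Rightarrow> sexp set \<Rightarrow> sexp \<Rightarrow> sexp list \<Rightarrow> (sexp \<Rightarrow> concept) \<Rightarrow> 'd set \<Rightarrow> bool" where
  "conj_step I K a L \<rho> Q \<longleftrightarrow> (\<forall>k. k \<notin> K \<longrightarrow> exec L \<rho> k = \<rho> k)
    \<and> ext I (exec L \<rho> a) = ext I (\<rho> a) \<inter> Q"

lemma conj_step_Nil: "conj_step I K a [] \<rho> UNIV"
  by (simp add: conj_step_def)

lemma conj_step_append:
  assumes "conj_step I K a L \<rho> Q" "conj_step I K a M (exec L \<rho>) R"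
  shows "conj_step I K a (L @ M) \<rho> (Q \<inter> R)"
  using assms by (auto simp: conj_step_def exec_append)

text \<open>The invariant \<open>R\<close> depends only on registers outside \<open>K\<close>, here
  those from which the blocks read, so each block finds the same operands.\<close>

lemma conj_loop:
  assumes "\<And>x \<rho>. x \<in> set xs \<Longrightarrow> R \<rho> \<Longrightarrow> conj_step I K a (blk x) \<rho> (Q x)"
    and R: "\<And>\<rho> \<rho>'. R \<rho> \<Longrightarrow> (\<forall>k. k \<notin> K \<longrightarrow> \<rho>' k = \<rho> k) \<Longrightarrow> R \<rho>'" and "R \<rho>"
  shows "conj_step I K a (concat (map (\<lambda>x. blk x) xs)) \<rho> (\<Inter>x\<in>set xs. Q x)"
  using assms(1,3)
proof (induction xs arbitrary: \<rho>)
  case Nil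
  show ?case by (simp add: conj_step_Nil)
next
  case (Cons x xs)
  have x: "conj_step I K a (blk x) \<rho> (Q x)" using Cons.prems by simp
  then have "R (exec (blk x) \<rho>)" using R[OF Cons.prems(2)] by (auto simp: conj_step_def)
  from conj_step_append[OF x Cons.IH[OF _ this]] Cons.prems(1) show ?case by simp
qed

lemma assign_loop:
  assumes b: "\<And>t \<rho>. t \<in> set ts \<Longrightarrow> R \<rho> \<Longrightarrow> (\<forall>k. k \<notin> insert (key t) S \<longrightarrow> exec (b t) \<rho> k = \<rho> k)
      \<and> ext I (exec (b t) \<rho> (key t)) = V t"
    and R: "\<And>\<rho> \<rho>'. R \<rho> \<Longrightarrow> (\<forall>k. k \<notin> S \<union> range key \<longrightarrow> \<rho>' k = \<rho> k) \<Longrightarrow> R \<rho>'" and "R \<rho>"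
    and key: "inj key" "\<And>t. key t \<notin> S"
  shows "(\<forall>k. k \<notin> S \<union> range key \<longrightarrow> exec (concat (map (\<lambda>t. b t) ts)) \<rho> k = \<rho> k)
    \<and> (\<forall>t. ext I (exec (concat (map (\<lambda>t. b t) ts)) \<rho> (key t)) = (if t \<in> set ts then V t else ext I
      (\<rho> (key t))))"
  using b \<open>R \<rho>\<close>
proof (induction ts arbitrary: \<rho>)
  case (Cons t ts)
  let ?\<rho> = "exec (b t) \<rho>"
  have t: "\<forall>k. k \<notin> insert (key t) S \<longrightarrow> ?\<rho> k = \<rho> k" "ext I (?\<rho> (key t)) = V t"
    using Cons.prems by auto
  then have "R ?\<rho>" using R[OF Cons.prems(2)] by blast
  note IH = Cons.IH[OF Cons.prems(1) this]
  have "ext I (exec (concat (map b (t # ts))) \<rho> (key t')) = (if t' \<in> set (t # ts) then V t' else ext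
    I (\<rho> (key t')))" for t'
  proof -
    have "t' \<noteq> t \<Longrightarrow> ?\<rho> (key t') = \<rho> (key t')" using t(1) key by (auto dest: injD)
    then show ?thesis using IH t(2) by (auto simp: exec_append)
  qed
  then show ?case using IH t(1) by (auto simp: exec_append)
qed simp

lemma reg_inject [simp]: "reg i = reg j \<longleftrightarrow> i = j" "reg_F t = reg_F t' \<longleftrightarrow> t = t'"
    "reg_X Y = reg_X Y' \<longleftrightarrow> Y = Y'"
  by (simp_all add: reg_def reg_F_def reg_X_def)

lemma reg_distinct [simp]: "reg i \<noteq> reg_F t" "reg_F t \<noteq> reg i" "reg i \<noteq> reg_X Y" "reg_X Y \<noteq> reg i"
    "reg_F t \<noteq> reg_X Y" "reg_X Y \<noteq> reg_F t"
  by (simp_all add: reg_def reg_F_def reg_X_def)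

lemma reg_notin_range [simp]: "reg_F t \<notin> range reg_X" "reg_X Y \<notin> range reg_F"
    "reg i \<notin> range reg_F" "reg i \<notin> range reg_X"
  by auto

context alg
begin

section \<open>Extensions of the registers after each block\<close>

definition names_ext :: "'d interp \<Rightarrow> sexp \<Rightarrow> sexp \<Rightarrow> 'd set" where
  "names_ext I t s = (if is_csym s then
     (if smem (Pr (enc_nat 1) (cdr s)) t then conc I (aval (cdr s)) else domain I - conc I (aval (cdr s)))
     else UNIV)"

definition ex_ext :: "'d interp \<Rightarrow> sexp \<Rightarrow> 'd set \<Rightarrow> 'd set" where
  "ex_ext I s X = {d \<in> domain I. \<exists>e. (d, e) \<in> role I (aval (cdr s)) \<and> e \<in> X}"

definition univ_ext :: "'d interp \<Rightarrow> (sexp \<Rightarrow> 'd set) \<Rightarrow> sexp \<Rightarrow> sexp \<Rightarrow> 'd set" where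
  "univ_ext I Xv t s = (if is_rsym s then
     (\<Inter>Y\<in>set mosaics. if \<exists>t'\<in>set (lst Y). compat (cdr s) t t' then UNIV else domain I - ex_ext I s (Xv Y))
     else UNIV)"

definition wit_ext :: "'d interp \<Rightarrow> (sexp \<Rightarrow> 'd set) \<Rightarrow> sexp \<Rightarrow> sexp \<Rightarrow> 'd set" where
  "wit_ext I Xv x Y = (\<Inter>s\<in>set SY. if is_rsym s \<and> subrole (ex_role x) (cdr s) then ex_ext I s (Xv Y)
    else UNIV)"

definition exist_ext :: "'d interp \<Rightarrow> (sexp \<Rightarrow> 'd set) \<Rightarrow> sexp \<Rightarrow> sexp \<Rightarrow> 'd set" where
  "exist_ext I Xv t x = (if is_ex x \<and> smem x t then
     domain I - (domain I \<inter> (\<Inter>Y\<in>set mosaics.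
       if \<exists>t'\<in>set (lst Y). smem (ex_arg x) t' \<and> compat (ex_role x) t t'
       then domain I - (domain I \<inter> wit_ext I Xv x Y) else UNIV))
     else UNIV)"

definition F_next :: "'d interp \<Rightarrow> (sexp \<Rightarrow> 'd set) \<Rightarrow> sexp \<Rightarrow> 'd set" where
  "F_next I Xv t = domain I \<inter> (\<Inter>s\<in>set SY. names_ext I t s) \<inter> (\<Inter>s\<in>set SY. univ_ext I Xv t s)
     \<inter> (\<Inter>x\<in>set U. exist_ext I Xv t x)"

definition X_next :: "'d interp \<Rightarrow> (sexp \<Rightarrow> 'd set) \<Rightarrow> sexp \<Rightarrow> 'd set" where
  "X_next I Fv Y = domain I \<inter> (\<Inter>t\<in>set types. if smem t Y then Fv t else domain I - Fv t)"

abbreviation F_regs :: "sexp \<Rightarrow> sexp set" where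
  "F_regs t \<equiv> {reg_F t, reg 0, reg 1, reg 2}"

lemma names_block: "conj_step I (F_regs t) (reg_F t) (names_block t s) \<rho> (names_ext I t s)"
  by (auto simp: conj_step_def names_block_def names_ext_def exec_simps)

lemma univ_block:
  assumes "\<forall>Y\<in>set mosaics. ext I (\<rho> (reg_X Y)) = Xv Y"
  shows "conj_step I (F_regs t) (reg_F t) (univ_block t s) \<rho> (univ_ext I Xv t s)"
proof (cases "is_rsym s")
  case True
  have "conj_step I (F_regs t) (reg_F t) (univ_block1 t s Y) \<rho>
      (if \<exists>t'\<in>set (lst Y). compat (cdr s) t t' then UNIV else domain I - ex_ext I s (Xv Y))"
    if "Y \<in> set mosaics" "\<forall>Y\<in>set mosaics. ext I (\<rho> (reg_X Y)) = Xv Y" for Y \<rho>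
    using that by (auto simp: conj_step_def univ_block1_def exec_simps ex_ext_def)
  from conj_loop[where R = "\<lambda>\<rho>. \<forall>Y\<in>set mosaics. ext I (\<rho> (reg_X Y)) = Xv Y", OF this _ assms]
  show ?thesis using True by (simp add: univ_block_def univ_ext_def)
qed (simp add: univ_block_def univ_ext_def conj_step_Nil)

lemma ex_block1:
  assumes Y: "Y \<in> set mosaics" and \<rho>: "\<forall>Y\<in>set mosaics. ext I (\<rho> (reg_X Y)) = Xv Y"
  shows "conj_step I {reg 0, reg 1, reg 2} (reg 0) (ex_block1 t x Y) \<rho>
    (if \<exists>t'\<in>set (lst Y). smem (ex_arg x) t' \<and> compat (ex_role x) t t'
       then domain I - (domain I \<inter> wit_ext I Xv x Y) else UNIV)"
proof (cases "\<exists>t'\<in>set (lst Y). smem (ex_arg x) t' \<and> compat (ex_role x) t t'")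
  case True
  let ?L = "concat (map (\<lambda>s. ex_block2 x Y s) SY)"
  let ?\<rho> = "\<rho>(reg 1 := Top)"
  have "conj_step I {reg 1, reg 2} (reg 1) (ex_block2 x Y s) \<rho>
      (if is_rsym s \<and> subrole (ex_role x) (cdr s) then ex_ext I s (Xv Y) else UNIV)"
    if "ext I (\<rho> (reg_X Y)) = Xv Y" for \<rho> s
    using that by (auto simp: conj_step_def ex_block2_def exec_simps ex_ext_def)
  from conj_loop[where R = "\<lambda>\<rho>. ext I (\<rho> (reg_X Y)) = Xv Y", OF this, of SY ?\<rho>] Y \<rho>
  have "conj_step I {reg 1, reg 2} (reg 1) ?L ?\<rho> (wit_ext I Xv x Y)"
    by (simp add: wit_ext_def)
  then have *: "\<And>k. k \<noteq> reg 1 \<Longrightarrow> k \<noteq> reg 2 \<Longrightarrow> exec ?L ?\<rho> k = \<rho> k"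
    "ext I (exec ?L ?\<rho> (reg 1)) = domain I \<inter> wit_ext I Xv x Y"
    by (auto simp: conj_step_def)
  show ?thesis unfolding ex_block1_def if_P[OF True]
    by (simp add: conj_step_def exec_append exec_simps * del: One_nat_def)
next
  case False
  show ?thesis unfolding ex_block1_def if_not_P[OF False] by (rule conj_step_Nil)
qed

lemma ex_block:
  assumes \<rho>: "\<forall>Y\<in>set mosaics. ext I (\<rho> (reg_X Y)) = Xv Y"
  shows "conj_step I (F_regs t) (reg_F t) (ex_block t x) \<rho> (exist_ext I Xv t x)"
proof (cases "is_ex x \<and> smem x t")
  case True
  let ?L = "concat (map (\<lambda>Y. ex_block1 t x Y) mosaics)"
  let ?\<rho> = "\<rho>(reg 0 := Top)"
  let ?Q = "\<Inter>Y\<in>set mosaics. if \<exists>t'\<in>set (lst Y). smem (ex_arg x) t' \<and> compat (ex_role x) t t'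
       then domain I - (domain I \<inter> wit_ext I Xv x Y) else UNIV"
  have "conj_step I {reg 0, reg 1, reg 2} (reg 0) ?L ?\<rho> ?Q"
    by (rule conj_loop[where R = "\<lambda>\<rho>. \<forall>Y\<in>set mosaics. ext I (\<rho> (reg_X Y)) = Xv Y"], rule ex_block1)
      (use \<rho> in auto)
  then have *: "\<And>k. k \<noteq> reg 0 \<Longrightarrow> k \<noteq> reg 1 \<Longrightarrow> k \<noteq> reg 2 \<Longrightarrow> exec ?L ?\<rho> k = \<rho> k"
    "ext I (exec ?L ?\<rho> (reg 0)) = domain I \<inter> ?Q"
    by (auto simp: conj_step_def)
  show ?thesis unfolding ex_block_def exist_ext_def if_P[OF True]
    by (simp add: conj_step_def exec_append exec_simps * del: One_nat_def)
next
  case False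
  show ?thesis unfolding ex_block_def exist_ext_def if_not_P[OF False] by (rule conj_step_Nil)
qed

lemma F_block:
  assumes \<rho>: "\<forall>Y\<in>set mosaics. ext I (\<rho> (reg_X Y)) = Xv Y"
  shows "(\<forall>k. k \<notin> F_regs t \<longrightarrow> exec (F_block t) \<rho> k = \<rho> k)
    \<and> ext I (exec (F_block t) \<rho> (reg_F t)) = F_next I Xv t"
proof -
  let ?R = "\<lambda>\<rho>. \<forall>Y\<in>set mosaics. ext I (\<rho> (reg_X Y)) = Xv Y"
  let ?\<rho> = "\<rho>(reg_F t := Top)"
  let ?L1 = "concat (map (\<lambda>s. names_block t s) SY)"
  let ?L2 = "concat (map (\<lambda>s. univ_block t s) SY)"
  let ?L3 = "concat (map (\<lambda>x. ex_block t x) U)"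
  have R: "?R \<rho>'" if "?R \<rho>" "\<forall>k. k \<notin> F_regs t \<longrightarrow> \<rho>' k = \<rho> k" for \<rho> \<rho>' using that by auto
  note loop = conj_loop[where R = ?R and K = "F_regs t" and a = "reg_F t", OF _ R]
  have 1: "conj_step I (F_regs t) (reg_F t) ?L1 \<rho> (\<Inter>s\<in>set SY. names_ext I t s)" if "?R \<rho>" for \<rho>
    by (rule loop[OF _ _ _ that]) (rule names_block)
  have 2: "conj_step I (F_regs t) (reg_F t) ?L2 \<rho> (\<Inter>s\<in>set SY. univ_ext I Xv t s)" if "?R \<rho>" for \<rho>
    by (rule loop[OF _ _ _ that]) (rule univ_block)
  have 3: "conj_step I (F_regs t) (reg_F t) ?L3 \<rho> (\<Inter>x\<in>set U. exist_ext I Xv t x)" if "?R \<rho>" for \<rho>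
    by (rule loop[OF _ _ _ that]) (rule ex_block)
  have R1: "?R (exec L \<rho>)" if "?R \<rho>" "conj_step I (F_regs t) (reg_F t) L \<rho> Q" for L \<rho> Q
    using R[OF that(1)] that(2) by (auto simp: conj_step_def)
  have r0: "?R ?\<rho>" using \<rho> by simp
  note r1 = R1[OF r0 1[OF r0]]
  note r2 = R1[OF r1 2[OF r1]]
  from conj_step_append[OF 1[OF r0] conj_step_append[OF 2[OF r1] 3[OF r2]]]
  show ?thesis
    by (simp add: conj_step_def F_block_def exec_simps F_next_def Int_assoc fun_upd_def)
qed

lemma X_block:
  assumes \<rho>: "\<forall>t\<in>set types. ext I (\<rho> (reg_F t)) = Fv t"
  shows "(\<forall>k. k \<notin> {reg_X Y, reg 0} \<longrightarrow> exec (X_block Y) \<rho> k = \<rho> k)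
    \<and> ext I (exec (X_block Y) \<rho> (reg_X Y)) = X_next I Fv Y"
proof -
  let ?R = "\<lambda>\<rho>. \<forall>t\<in>set types. ext I (\<rho> (reg_F t)) = Fv t"
  have "conj_step I {reg_X Y, reg 0} (reg_X Y) (X_block1 Y t) \<rho> (if smem t Y then Fv t else domain I
    - Fv t)"
    if "t \<in> set types" "?R \<rho>" for t \<rho>
    using that by (auto simp: conj_step_def X_block1_def exec_simps)
  then have "conj_step I {reg_X Y, reg 0} (reg_X Y) (concat (map (\<lambda>t. X_block1 Y t) types)) (\<rho>(reg_X
    Y := Top))
      (\<Inter>t\<in>set types. if smem t Y then Fv t else domain I - Fv t)"
    by (rule conj_loop[where R = ?R]) (use \<rho> in auto)
  then show ?thesis by (simp add: conj_step_def X_block_def exec_simps X_next_def)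
qed

lemma level_block:
  fixes I :: "'d interp"
  defines "Fv \<equiv> \<lambda>\<rho> t. ext I (\<rho> (reg_F t))"
  assumes "t \<in> set types"
  shows "Fv (exec level_block \<rho>) t = F_next I (X_next I (Fv \<rho>)) t"
proof -
  let ?L = "concat (map (\<lambda>Y. X_block Y) mosaics)"
  have "(\<forall>k. k \<notin> {reg 0} \<union> range reg_X \<longrightarrow> exec ?L \<rho> k = \<rho> k)
    \<and> (\<forall>Y. ext I (exec ?L \<rho> (reg_X Y)) = (if Y \<in> set mosaics then X_next I (Fv \<rho>) Y else ext I (\<rho>
      (reg_X Y))))"
  proof (rule assign_loop[where R = "\<lambda>\<rho>'. \<forall>t\<in>set types. ext I (\<rho>' (reg_F t)) = Fv \<rho> t"], goal_cases)
    case (1 Y \<rho>')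
    from X_block[OF 1(2)] show ?case by simp
  next
    case (2 \<rho>' \<rho>'')
    then show ?case by auto
  qed (auto simp: Fv_def inj_def)
  then have X: "\<forall>Y\<in>set mosaics. ext I (exec ?L \<rho> (reg_X Y)) = X_next I (Fv \<rho>) Y" by simp
  have "(\<forall>k. k \<notin> {reg 0, reg 1, reg 2} \<union> range reg_F \<longrightarrow> exec (concat (map (\<lambda>t. F_block t) types))
    (exec ?L \<rho>) k = exec ?L \<rho> k)
    \<and> (\<forall>t. ext I (exec (concat (map (\<lambda>t. F_block t) types)) (exec ?L \<rho>) (reg_F t)) =
       (if t \<in> set types then F_next I (X_next I (Fv \<rho>)) t else ext I (exec ?L \<rho> (reg_F t))))"
  proof (rule assign_loop[where R = "\<lambda>\<rho>'. \<forall>Y\<in>set mosaics. ext I (\<rho>' (reg_X Y)) = X_next I (Fv \<rho>)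
    Y"], goal_cases)
    case (1 t \<rho>')
    from F_block[OF 1(2)] show ?case by simp
  next
    case (2 \<rho>' \<rho>'')
    then show ?case by auto
  qed (use X in \<open>auto simp: inj_def\<close>)
  then show ?thesis using assms(2) by (simp add: level_block_def exec_append Fv_def)
qed

definition level :: "nat \<Rightarrow> sexp \<Rightarrow> concept" where
  "level n = ((\<lambda>\<rho>. exec level_block \<rho>) ^^ n) (\<lambda>k. Top)"

lemma exec_levels: "exec (concat (map (\<lambda>Y. level_block) Ys)) (\<lambda>k. Top) = level (length Ys)"
proof -
  have "exec (concat (map (\<lambda>Y. B) xs)) \<rho> = ((\<lambda>\<rho>. exec B \<rho>) ^^ length xs) \<rho>" for \<rho> B and xs :: "sexp list"
    by (induction xs arbitrary: \<rho>) (simp_all add: exec_append funpow_swap1)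
  then show ?thesis by (simp add: level_def)
qed

lemma prog_ext:
  "ext I (exec prog (\<lambda>k. Top) (reg 1)) = domain I - (domain I \<inter>
    (\<Inter>t\<in>set types. if smem c0 t then domain I - ext I (level (length Ys) (reg_F t)) else UNIV))"
proof -
  let ?\<rho> = "level (length Ys)"
  let ?L = "concat (map (\<lambda>t. result_block1 t) types)"
  let ?R = "\<lambda>\<rho>. \<forall>t\<in>set types. ext I (\<rho> (reg_F t)) = ext I (?\<rho> (reg_F t))"
  have "conj_step I {reg 0, reg 1} (reg 0) (result_block1 t) \<rho>
      (if smem c0 t then domain I - ext I (?\<rho> (reg_F t)) else UNIV)"
    if "t \<in> set types" "?R \<rho>" for t \<rho>
    using that by (auto simp: conj_step_def result_block1_def exec_simps)
  then have "conj_step I {reg 0, reg 1} (reg 0) ?L (?\<rho>(reg 0 := Top))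
      (\<Inter>t\<in>set types. if smem c0 t then domain I - ext I (?\<rho> (reg_F t)) else UNIV)"
    by (rule conj_loop[where R = ?R]) auto
  then have "ext I (exec ?L (?\<rho>(reg 0 := Top)) (reg 0)) = domain I \<inter>
    (\<Inter>t\<in>set types. if smem c0 t then domain I - ext I (?\<rho> (reg_F t)) else UNIV)"
    by (simp add: conj_step_def)
  then show ?thesis by (simp add: prog_def exec_append exec_simps exec_levels)
qed

end

section \<open>Correctness of the interpolant\<close>

text \<open>
  Subtrees of the input that do not encode a concept are decoded as well, so they need not be excluded
  from \<open>U\<close>.
\<close>

function dec :: "sexp \<Rightarrow> concept" where
  "dec x = (case x of Pr g y \<Rightarrow>
      if g = enc_nat 1 \<and> is_atom y then Name (aval y)
      else if g = enc_nat 2 then Neg (dec y)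
      else if g = enc_nat 3 then And (dec (car y)) (dec (cdr y))
      else if g = enc_nat 4 \<and> is_atom (car y) then Exists (aval (car y)) (dec (cdr y))
      else Top
    | _ \<Rightarrow> Top)"
  by auto

lemma size_car: "size (car x) \<le> size x" and size_cdr: "size (cdr x) \<le> size x"
  by (cases x; simp)+

termination dec
  by (relation "measure size") (auto simp: less_Suc_eq_le le_SucI size_car size_cdr trans_le_add2)

declare dec.simps [simp del]

lemma dec_Pr: "dec (Pr g y) =
     (if g = enc_nat 1 \<and> is_atom y then Name (aval y)
      else if g = enc_nat 2 then Neg (dec y)
      else if g = enc_nat 3 then And (dec (car y)) (dec (cdr y))
      else if g = enc_nat 4 \<and> is_atom (car y) then Exists (aval (car y)) (dec (cdr y))
      else Top)"
  by (subst dec.simps) simp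

lemma is_atom_simps [simp]: "is_atom (Atom a)" "\<not> is_atom Nl" "\<not> is_atom (Pr u v)"
  by (simp_all add: is_atom_def)

lemma dec_enc: "dec (enc_concept C) = C"
  by (induction C) (simp_all add: dec_Pr)

lemma filter_in_subseqs: "filter P xs \<in> set (subseqs xs)"
  by (induction xs) (auto simp: Let_def)

text \<open>Each member is a function of its predecessor, so one repetition makes the chain
  constant. A strict decrease at step \<open>n\<close> would thus force strict decreases at all
  earlier steps, more than there are elements.\<close>

lemma decreasing_chain_stable:
  fixes S :: "nat \<Rightarrow> 'a set"
  assumes dec: "\<And>n. S (Suc n) \<subseteq> S n" and fin: "finite (S 0)"
    and step: "\<And>n. S (Suc n) = G (S n)" and n: "card (S 0) \<le> n"
  shows "S (Suc n) = S n"
proof (rule ccontr)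
  assume neq: "S (Suc n) \<noteq> S n"
  have fin: "finite (S m)" for m by (induction m) (use fin dec finite_subset in blast)+
  have "S (Suc m) \<noteq> S m" if "m \<le> n" for m
  proof
    assume eq: "S (Suc m) = S m"
    have "S (m + j) = S m" for j by (induction j) (use step eq in simp_all)
    from this[of "n - m"] this[of "Suc n - m"] neq that show False by (simp add: Suc_diff_le)
  qed
  then have lt: "card (S (Suc m)) < card (S m)" if "m \<le> n" for m
    using that dec[of m] psubset_card_mono[OF fin] by blast
  have "m \<le> Suc n \<Longrightarrow> card (S m) + m \<le> card (S 0)" for m
  proof (induction m)
    case (Suc m)
    then show ?case using lt[of m] by simp
  qed simp
  from this[of "Suc n"] n show False by simp
qed

text \<open>Ties the lists of \<open>alg\<close> to an input. \<Sigma> may be infinite; the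
  algorithm sees only \<open>syms\<close>, its part that occurs in the input.\<close>

locale mosaic = alg A U W SY Ys c0 for A U W SY Ys c0 +
  fixes axs :: "axiom list" and C D :: concept and syms :: "symb list" and \<Sigma> :: "symb set"
  assumes A_def: "A = map enc_axiom axs"
    and U_closed: "x \<in> set U \<Longrightarrow> y \<in> set (subtrees x) \<Longrightarrow> y \<in> set U"
    and Nl_U: "Nl \<in> set U"
    and axs_U: "ax \<in> set axs \<Longrightarrow> enc_axiom ax \<in> set U"
    and C_U: "enc_concept C \<in> set U" and D_U: "enc_concept D \<in> set U"
    and W_def: "W = map slist (subseqs U)"
    and SY_def: "SY = map enc_symb syms"
    and Ys_def: "Ys = map slist (subseqs (alg.types0 A U W))"
    and c0_def: "c0 = enc_concept C"
    and syms: "set syms = \<Sigma> \<inter> (sig_ontology (set axs) \<union> sig_concept C \<union> sig_concept D)"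
    and CSym_U: "CSym a \<in> set syms \<Longrightarrow> enc_concept (Name a) \<in> set U"
    and RSym_U: "RSym r \<in> set syms \<Longrightarrow> Atom r \<in> set U"
begin

definition sigma0 :: "symb set" where
  "sigma0 = sig_ontology (set axs) \<union> sig_concept C \<union> sig_concept D"

lemma U_Pr: "Pr u v \<in> set U \<Longrightarrow> u \<in> set U" "Pr u v \<in> set U \<Longrightarrow> v \<in> set U"
  using U_closed[of "Pr u v"] subtrees_self by auto

lemma U_car: "x \<in> set U \<Longrightarrow> car x \<in> set U" and U_cdr: "x \<in> set U \<Longrightarrow> cdr x \<in> set U"
  by (cases x; auto dest: U_Pr intro: Nl_U)+

lemma csymE:
  assumes "s \<in> set SY" "is_csym s"
  obtains a where "s = enc_symb (CSym a)" "CSym a \<in> set syms"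
proof -
  obtain x where "x \<in> set syms" "s = enc_symb x" using assms(1) by (auto simp: SY_def)
  then show ?thesis
    by - (rule symb.exhaust[of x]; use assms(2) that in \<open>auto simp: is_csym_def\<close>)
qed

lemma rsymE:
  assumes "s \<in> set SY" "is_rsym s"
  obtains r where "s = enc_symb (RSym r)" "RSym r \<in> set syms"
proof -
  obtain x where "x \<in> set syms" "s = enc_symb x" using assms(1) by (auto simp: SY_def)
  then show ?thesis
    by - (rule symb.exhaust[of x]; use assms(2) that in \<open>auto simp: is_rsym_def\<close>)
qed

lemma rsymI: "RSym r \<in> set syms \<Longrightarrow> enc_symb (RSym r) \<in> set SY \<and> is_rsym (enc_symb (RSym r))"
  by (simp add: SY_def is_rsym_def del: enc_symb.simps) (simp add: is_rsym_def)

lemma csymI: "CSym r \<in> set syms \<Longrightarrow> enc_symb (CSym r) \<in> set SY \<and> is_csym (enc_symb (CSym r))"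
  by (simp add: SY_def is_csym_def del: enc_symb.simps) (simp add: is_csym_def)

lemma subrole_refl: "subrole r r"
  by (simp add: subrole_def)

lemma subrole_trans: "subrole r s \<Longrightarrow> subrole s q \<Longrightarrow> subrole r q"
  by (auto simp: subrole_def)

lemma compat_subrole: "compat r t t' \<Longrightarrow> subrole r s \<Longrightarrow> compat s t t'"
  unfolding compat_def using subrole_trans by blast

lemma subrole_RI: "RI r s \<in> set axs \<Longrightarrow> subrole (Atom r) (Atom s)"
  unfolding subrole_def
proof (intro ballI impI)
  fix \<rho> assume "RI r s \<in> set axs" "role_closed \<rho>" "smem (Atom r) \<rho>"
  moreover from this have "enc_axiom (RI r s) \<in> set A" unfolding A_def set_map by blast
  ultimately show "smem (Atom s) \<rho>" unfolding role_closed_def by fastforce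
qed

text \<open>Lets quantifiers over the lists \<open>mosaics\<close> be exchanged for quantifiers over
  sets of types.\<close>

lemma mosaics_sets: "(\<lambda>Y. set (lst Y)) ` set mosaics = Pow (set types)"
proof -
  have a: "(\<lambda>Y. set (lst Y)) ` set Ys = Pow (set types0)"
    using subseqs_powset[of types0] by (simp add: Ys_def image_image comp_def)
  have b: "set types = {t \<in> set types0. realizable t}" by (simp add: types_def)
  have c: "set mosaics = {Y \<in> set Ys. \<forall>t\<in>set (lst Y). realizable t}" by (simp add: mosaics_def)
  show ?thesis
  proof (intro equalityI subsetI)
    fix X assume "X \<in> (\<lambda>Y. set (lst Y)) ` set mosaics"
    then obtain Y where Y: "Y \<in> set Ys" "\<forall>t\<in>set (lst Y). realizable t" "X = set (lst Y)" using c by blast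
    then have "X \<subseteq> set types0" using a by blast
    then show "X \<in> Pow (set types)" using Y b by blast
  next
    fix X assume X: "X \<in> Pow (set types)"
    then have "X \<in> (\<lambda>Y. set (lst Y)) ` set Ys" unfolding a using b by blast
    then obtain Y where "Y \<in> set Ys" "X = set (lst Y)" by blast
    then show "X \<in> (\<lambda>Y. set (lst Y)) ` set mosaics" using X b c by blast
  qed
qed

lemma mosaic_subset: "Y \<in> set mosaics \<Longrightarrow> set (lst Y) \<subseteq> set types"
  using mosaics_sets by auto

lemma ball_mosaics: "(\<forall>Y\<in>set mosaics. P (set (lst Y))) \<longleftrightarrow> (\<forall>Y\<subseteq>set types. P Y)"
proof -
  have "(\<forall>Y\<in>set mosaics. P (set (lst Y))) \<longleftrightarrow> (\<forall>X\<in>(\<lambda>Y. set (lst Y)) ` set mosaics. P X)" by simp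
  then show ?thesis unfolding mosaics_sets by auto
qed

lemma bex_mosaics: "(\<exists>Y\<in>set mosaics. P (set (lst Y))) \<longleftrightarrow> (\<exists>Y\<subseteq>set types. P Y)"
  using ball_mosaics[of "\<lambda>Y. \<not> P Y"] by blast

text \<open>All members of a self-witnessing set are realizable by that very set, so the witness
  found in it is again in \<open>types\<close>.\<close>

lemma types_witness:
  assumes "t \<in> set types" "x \<in> set U" "is_ex x" "smem x t"
  shows "\<exists>t'\<in>set types. smem (ex_arg x) t' \<and> compat (ex_role x) t t'"
proof -
  obtain Y where Y: "Y \<in> set Ys" "smem t Y" "self_witnessing Y"
    using assms(1) by (auto simp: types_def realizable_def)
  then obtain t' where t': "t' \<in> set (lst Y)" "smem (ex_arg x) t'" "compat (ex_role x) t t'"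
    using assms(2-4) unfolding self_witnessing_def smem_def[of t] by blast
  have "set (lst Y) \<subseteq> set types0"
    using Y(1) subseqs_powset[of types0] by (auto simp: Ys_def)
  then have "t' \<in> set types"
    using t'(1) Y by (auto simp: types_def realizable_def smem_def)
  then show ?thesis using t' by blast
qed

subsection \<open>The values computed level by level\<close>

text \<open>\<open>N\<close> stands for the concept names true at a point and \<open>Z\<close> for
  the pairs of a role and the view of a successor along it. The next view depends on nothing else,
  which permits computing views without a model.\<close>

definition next_view :: "nat set \<Rightarrow> (nat \<times> sexp set) set \<Rightarrow> sexp set" where
  "next_view N Z = {t \<in> set types.
    (\<forall>s\<in>set SY. is_csym s \<longrightarrow> (smem (Pr (enc_nat 1) (cdr s)) t \<longleftrightarrow> aval (cdr s) \<in> N))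
    \<and> (\<forall>s\<in>set SY. is_rsym s \<longrightarrow> (\<forall>Y. (aval (cdr s), Y) \<in> Z \<longrightarrow> (\<exists>t'\<in>Y. compat (cdr s) t t')))
    \<and> (\<forall>x\<in>set U. is_ex x \<and> smem x t \<longrightarrow> (\<exists>Y\<subseteq>set types.
        (\<exists>t'\<in>Y. smem (ex_arg x) t' \<and> compat (ex_role x) t t')
        \<and> (\<forall>s\<in>set SY. is_rsym s \<and> subrole (ex_role x) (cdr s) \<longrightarrow> (aval (cdr s), Y) \<in> Z)))}"

definition upclosed :: "(nat \<times> sexp set) set \<Rightarrow> bool" where
  "upclosed Z \<longleftrightarrow> (\<forall>s\<in>set SY. \<forall>s'\<in>set SY. \<forall>Y. is_rsym s \<and> is_rsym s' \<and> subrole (cdr s) (cdr s')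
    \<and> (aval (cdr s), Y) \<in> Z \<longrightarrow> (aval (cdr s'), Y) \<in> Z)"

text \<open>An over-approximation of the views of level \<open>n\<close> in models: of the
  successors it remembers only that their views are in \<open>reach n\<close> and respect the role
  hierarchy.\<close>

fun reach :: "nat \<Rightarrow> sexp set set" where
  "reach 0 = Pow (set types)"
| "reach (Suc n) = {next_view N Z | N Z. upclosed Z \<and> Z \<subseteq> UNIV \<times> reach n}"

definition view :: "'d interp \<Rightarrow> nat \<Rightarrow> 'd \<Rightarrow> sexp set" where
  "view I n d = {t \<in> set types. d \<in> ext I (level n (reg_F t))}"

definition succs :: "'d interp \<Rightarrow> nat \<Rightarrow> 'd \<Rightarrow> (nat \<times> sexp set) set" where
  "succs I n d = {(r, Y). \<exists>e. (d, e) \<in> role I r \<and> view I n e = Y}"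

lemma view_0: "d \<in> domain I \<Longrightarrow> view I 0 d = set types"
  by (simp add: view_def level_def)

lemma view_subset: "view I n d \<subseteq> set types"
  by (auto simp: view_def)

text \<open>The bridge from registers to combinatorics. \<open>reg_X Y\<close> holds exactly at the
  points whose view is \<open>Y\<close>, so existential restrictions of these registers reveal
  \<open>succs\<close>.\<close>

lemma view_Suc:
  assumes I: "is_interp I" and d: "d \<in> domain I"
  shows "view I (Suc n) d = next_view {a. d \<in> conc I a} (succs I n d)"
proof -
  let ?Fv = "\<lambda>t. ext I (level n (reg_F t))"
  let ?Xv = "X_next I ?Fv"
  have X: "e \<in> ?Xv Y \<longleftrightarrow> e \<in> domain I \<and> view I n e = set (lst Y)" if Y: "Y \<in> set mosaics" for e Y
    using mosaic_subset[OF Y] unfolding X_next_def view_def smem_def by auto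
  have ex: "d \<in> ex_ext I s (?Xv Y) \<longleftrightarrow> (aval (cdr s), set (lst Y)) \<in> succs I n d" if "Y \<in> set mosaics" for s Y
  proof -
    have "e \<in> domain I" if "(d, e) \<in> role I r" for e r using I that by (auto simp: is_interp_def)
    then show ?thesis using X[OF that] d unfolding ex_ext_def succs_def by blast
  qed
  have Z: "Z \<subseteq> set types" if "(r, Z) \<in> succs I n d" for r Z
    using that unfolding succs_def view_def by blast
  have names: "d \<in> names_ext I t s \<longleftrightarrow> (is_csym s \<longrightarrow> (smem (Pr (enc_nat 1) (cdr s)) t \<longleftrightarrow> aval (cdr s) \<in>
    {a. d \<in> conc I a}))" for t s
    using d by (auto simp: names_ext_def)
  have univ: "d \<in> univ_ext I ?Xv t s \<longleftrightarrow>
    (is_rsym s \<longrightarrow> (\<forall>Y. (aval (cdr s), Y) \<in> succs I n d \<longrightarrow> (\<exists>t'\<in>Y. compat (cdr s) t t')))" (is "?l =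
      ?r") for t s
  proof (cases "is_rsym s")
    case True
    have "?l \<longleftrightarrow> (\<forall>Y\<in>set mosaics. (\<exists>t'\<in>set (lst Y). compat (cdr s) t t') \<or> (aval (cdr s), set (lst Y))
      \<notin> succs I n d)"
      unfolding univ_ext_def if_P[OF True] INT_iff by (intro ball_cong refl) (simp add: d ex)
    also have "\<dots> \<longleftrightarrow> (\<forall>Y\<subseteq>set types. (\<exists>t'\<in>Y. compat (cdr s) t t') \<or> (aval (cdr s), Y) \<notin> succs I n d)"
      by (rule ball_mosaics)
    also have "\<dots> \<longleftrightarrow> (\<forall>Y. (aval (cdr s), Y) \<in> succs I n d \<longrightarrow> (\<exists>t'\<in>Y. compat (cdr s) t t'))"
      using Z[of "aval (cdr s)"] by meson
    finally show ?thesis using True by simp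
  qed (simp add: univ_ext_def)
  have wit: "d \<in> wit_ext I ?Xv x Y \<longleftrightarrow>
    (\<forall>s\<in>set SY. is_rsym s \<and> subrole (ex_role x) (cdr s) \<longrightarrow> (aval (cdr s), set (lst Y)) \<in> succs I n d)"
    if "Y \<in> set mosaics" for x Y
    unfolding wit_ext_def INT_iff by (intro ball_cong refl) (auto simp add: ex[OF that])
  have exist: "d \<in> exist_ext I ?Xv t x \<longleftrightarrow> (is_ex x \<and> smem x t \<longrightarrow> (\<exists>Y\<subseteq>set types.
        (\<exists>t'\<in>Y. smem (ex_arg x) t' \<and> compat (ex_role x) t t')
        \<and> (\<forall>s\<in>set SY. is_rsym s \<and> subrole (ex_role x) (cdr s) \<longrightarrow> (aval (cdr s), Y) \<in> succs I n d)))"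
      (is "?l = (_ \<longrightarrow> ?r)") for t x
  proof (cases "is_ex x \<and> smem x t")
    case True
    have "?l \<longleftrightarrow> (\<exists>Y\<in>set mosaics. (\<exists>t'\<in>set (lst Y). smem (ex_arg x) t' \<and> compat (ex_role x) t t')
        \<and> d \<in> wit_ext I ?Xv x Y)"
    proof -
      have "(\<forall>Y\<in>set mosaics. d \<in> (if \<exists>t'\<in>set (lst Y). smem (ex_arg x) t' \<and> compat (ex_role x) t t'
          then domain I - (domain I \<inter> wit_ext I ?Xv x Y) else UNIV))
        \<longleftrightarrow> (\<forall>Y\<in>set mosaics. \<not> ((\<exists>t'\<in>set (lst Y). smem (ex_arg x) t' \<and> compat (ex_role x) t t') \<and> d \<in>
          wit_ext I ?Xv x Y))"
        using d by (intro ball_cong refl) (simp, blast)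
      then show ?thesis
        unfolding exist_ext_def if_P[OF True] Diff_iff Int_iff INT_iff using d by blast
    qed
    also have "\<dots> \<longleftrightarrow> (\<exists>Y\<in>set mosaics. (\<exists>t'\<in>set (lst Y). smem (ex_arg x) t' \<and> compat (ex_role x) t t')
        \<and> (\<forall>s\<in>set SY. is_rsym s \<and> subrole (ex_role x) (cdr s) \<longrightarrow> (aval (cdr s), set (lst Y)) \<in> succs I n d))"
      using wit by (intro bex_cong refl) simp
    also have "\<dots> \<longleftrightarrow> ?r"
      by (rule bex_mosaics)
    finally show ?thesis using True by simp
  next
    case False
    then show ?thesis unfolding exist_ext_def if_not_P[OF False] by blast
  qed
  have "t \<in> view I (Suc n) d \<longleftrightarrow> t \<in> next_view {a. d \<in> conc I a} (succs I n d)" for t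
  proof (cases "t \<in> set types")
    case True
    have "ext I (level (Suc n) (reg_F t)) = F_next I ?Xv t"
      using level_block[OF True, of I "level n"] by (simp add: level_def)
    then show ?thesis using True d
      by (simp only: view_def next_view_def F_next_def Int_iff INT_iff names univ exist
        mem_Collect_eq simp_thms conj_assoc)
  qed (simp add: view_def next_view_def)
  then show ?thesis by blast
qed

subsection \<open>Types realized in models\<close>

text \<open>Filtering preserves the order of \<open>U\<close>, so the type of a point is literally a
  member of \<open>W\<close>.\<close>

definition tp :: "'d interp \<Rightarrow> 'd \<Rightarrow> sexp" where
  "tp I d = slist (filter (\<lambda>x. d \<in> ext I (dec x)) U)"

lemma smem_tp: "smem x (tp I d) \<longleftrightarrow> x \<in> set U \<and> d \<in> ext I (dec x)"
  by (auto simp: tp_def smem_def)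

lemma dec_ex: "is_ex x \<Longrightarrow> dec x = Exists (aval (ex_role x)) (dec (ex_arg x))"
  by (cases x) (auto simp: is_ex_def ex_role_def ex_arg_def dec_Pr)

text \<open>The role names that connect \<open>d\<close> to \<open>e\<close> in a model form a
  closed set listed in \<open>W\<close>; quantification over closed sets in \<open>subrole\<close>
  can be instantiated with it.\<close>

lemma subrole_model:
  assumes M: "is_model I (set axs)" and de: "(d, e) \<in> role I r" and "Atom r \<in> set U"
    and sub: "subrole (Atom r) s"
  shows "is_atom s \<and> (d, e) \<in> role I (aval s)"
proof -
  let ?\<rho> = "slist (filter (\<lambda>x. is_atom x \<and> (d, e) \<in> role I (aval x)) U)"
  have "?\<rho> \<in> set W" by (simp add: W_def filter_in_subseqs)
  moreover have "role_closed ?\<rho>"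
    unfolding role_closed_def
  proof (intro ballI impI)
    fix a assume a: "a \<in> set A" "car a = enc_nat 1" "smem (car (cdr a)) ?\<rho>"
    then obtain ax where ax: "ax \<in> set axs" "a = enc_axiom ax" by (auto simp: A_def)
    then obtain q q' where RI: "RI q q' \<in> set axs" "a = enc_axiom (RI q q')"
      by - (rule axiom.exhaust[of ax]; use a(2) in auto)
    then have "role I q \<subseteq> role I q'" using M by (force simp: is_model_def)
    moreover have "Atom q' \<in> set U" using axs_U[OF RI(1)] by (auto dest!: U_Pr(2))
    ultimately show "smem (cdr (cdr a)) ?\<rho>" using a(3) RI(2) by (auto simp: smem_def)
  qed
  moreover have "smem (Atom r) ?\<rho>" using assms by (simp add: smem_def)
  ultimately have "smem s ?\<rho>" using sub unfolding subrole_def by blast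
  then show ?thesis by (simp add: smem_def)
qed

context
  fixes I :: "'d interp"
  assumes M: "is_model I (set axs)"
begin

lemma interp: "is_interp I"
  using M by (simp add: is_model_def)

lemma compat_tp:
  assumes "(d, e) \<in> role I r" "Atom r \<in> set U"
  shows "compat (Atom r) (tp I d) (tp I e)"
  unfolding compat_def
proof (intro ballI impI, elim conjE)
  fix x assume x: "x \<in> set U" "is_ex x" "subrole (Atom r) (ex_role x)" "smem (ex_arg x) (tp I e)"
  have "(d, e) \<in> role I (aval (ex_role x))" using subrole_model[OF M assms x(3)] by simp
  moreover have "d \<in> domain I" using interp assms(1) by (auto simp: is_interp_def)
  ultimately show "smem x (tp I d)"
    using x by (auto simp: smem_tp dec_ex)
qed

lemma tp_types0:
  assumes d: "d \<in> domain I"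
  shows "tp I d \<in> set types0"
proof -
  have "tp I d \<in> set W" by (simp add: W_def tp_def filter_in_subseqs)
  moreover have "loc_ok (tp I d)"
    unfolding loc_ok_def
  proof (intro conjI ballI impI)
    fix x assume x: "x \<in> set U"
    show "smem x (tp I d)" if "x = Pr Nl Nl" using that x d by (simp add: smem_tp dec_Pr)
    show "smem x (tp I d) = (\<not> smem (cdr x) (tp I d))" if "car x = enc_nat 2"
      using that x d U_cdr[OF x] by (cases x) (auto simp: smem_tp dec_Pr)
    show "smem x (tp I d) = (smem (car (cdr x)) (tp I d) \<and> smem (cdr (cdr x)) (tp I d))" if "car x =
      enc_nat 3"
      using that x d U_cdr[OF x] U_car[OF U_cdr[OF x]] U_cdr[OF U_cdr[OF x]]
      by (cases x) (auto simp: smem_tp dec_Pr)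
  next
    fix a assume a: "a \<in> set A" "car a = enc_nat 0" "smem (car (cdr a)) (tp I d)"
    then obtain ax where ax: "ax \<in> set axs" "a = enc_axiom ax" by (auto simp: A_def)
    then obtain F G where CI: "CI F G \<in> set axs" "a = enc_axiom (CI F G)"
      by - (rule axiom.exhaust[of ax]; use a(2) in auto)
    then have "ext I F \<subseteq> ext I G" using M by (force simp: is_model_def)
    moreover have "enc_concept G \<in> set U" using axs_U[OF CI(1)] by (auto dest!: U_Pr(2))
    ultimately show "smem (cdr (cdr a)) (tp I d)" using a(3) CI(2) by (auto simp: smem_tp dec_enc)
  qed
  ultimately show ?thesis by (simp add: types0_def)
qed

lemma ex_witness:
  assumes "smem x (tp I d)" "is_ex x"
  obtains e r where "e \<in> domain I" "ex_role x = Atom r" "(d, e) \<in> role I r" "Atom r \<in> set U"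
    "smem (ex_arg x) (tp I e)" "compat (ex_role x) (tp I d) (tp I e)"
proof -
  obtain r where r: "ex_role x = Atom r" using assms(2) by (auto simp: is_ex_def ex_role_def is_atom_iff)
  have xU: "x \<in> set U" using assms(1) by (simp add: smem_tp)
  have U: "ex_role x \<in> set U" "ex_arg x \<in> set U"
    using U_car[OF U_cdr[OF xU]] U_cdr[OF U_cdr[OF xU]] by (simp_all add: ex_role_def ex_arg_def)
  obtain e where e: "(d, e) \<in> role I r" "e \<in> ext I (dec (ex_arg x))"
    using assms r by (auto simp: smem_tp dec_ex)
  moreover have "e \<in> domain I" using e interp by (auto simp: is_interp_def)
  moreover have "compat (ex_role x) (tp I d) (tp I e)" using compat_tp[OF e(1)] U(1) r by simp
  ultimately show ?thesis using that[of e r] U r by (simp add: smem_tp)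
qed

text \<open>The set of all types realized in the model is self-witnessing.\<close>

lemma tp_types:
  assumes d: "d \<in> domain I"
  shows "tp I d \<in> set types"
proof -
  let ?Y = "filter (\<lambda>t. t \<in> tp I ` domain I) types0"
  have "slist ?Y \<in> set Ys" by (simp add: Ys_def filter_in_subseqs)
  moreover have "self_witnessing (slist ?Y)"
    unfolding self_witnessing_def
  proof (intro ballI impI, elim conjE)
    fix t x assume "t \<in> set (lst (slist ?Y))" and x: "x \<in> set U" "is_ex x" "smem x t"
    then obtain d where d: "t = tp I d" by auto
    from ex_witness[of x d] x d obtain e where
      "e \<in> domain I" "smem (ex_arg x) (tp I e)" "compat (ex_role x) (tp I d) (tp I e)"
      by blast
    then show "\<exists>t'\<in>set (lst (slist ?Y)). smem (ex_arg x) t' \<and> compat (ex_role x) t t'"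
      using tp_types0 d by auto
  qed
  moreover have "smem (tp I d) (slist ?Y)" using tp_types0 d by (simp add: smem_def)
  ultimately have "realizable (tp I d)" by (auto simp: realizable_def)
  then show ?thesis using tp_types0[OF d] by (simp add: types_def)
qed

text \<open>By induction on the level: an actual successor \<open>e\<close> supplies the type
  \<open>tp I e\<close> in its own view, both for the successor condition and, with \<open>Y\<close>
  the view of \<open>e\<close>, for the witness condition.\<close>

lemma tp_view: "d \<in> domain I \<Longrightarrow> tp I d \<in> view I n d"
proof (induction n arbitrary: d)
  case 0
  then show ?case by (simp add: view_0 tp_types)
next
  case (Suc n)
  note d = Suc.prems
  have dom: "e \<in> domain I" if "(d, e) \<in> role I r" for d e r using that interp by (auto simp: is_interp_def)
  show ?case unfolding view_Suc[OF interp d] next_view_def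
  proof (intro CollectI conjI ballI impI allI tp_types[OF d])
    fix s assume "s \<in> set SY" "is_csym s"
    then obtain a where a: "s = enc_symb (CSym a)" "CSym a \<in> set syms" by (rule csymE)
    from CSym_U[OF a(2)] show "smem (Pr (enc_nat 1) (cdr s)) (tp I d) = (aval (cdr s) \<in> {a. d \<in> conc I a})"
      by (simp add: a(1) smem_tp dec_Pr)
  next
    fix s Y assume "s \<in> set SY" "is_rsym s" and Y: "(aval (cdr s), Y) \<in> succs I n d"
    then obtain r where r: "s = enc_symb (RSym r)" "RSym r \<in> set syms" using rsymE by blast
    obtain e where e: "(d, e) \<in> role I r" "view I n e = Y" using Y r by (auto simp: succs_def)
    have "tp I e \<in> Y" using Suc.IH[OF dom[OF e(1)]] e(2) by simp
    then show "\<exists>t'\<in>Y. compat (cdr s) (tp I d) t'" using compat_tp[OF e(1) RSym_U[OF r(2)]] r(1) by auto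
  next
    fix x assume x: "x \<in> set U" "is_ex x \<and> smem x (tp I d)"
    obtain e r where e: "e \<in> domain I" "ex_role x = Atom r" "(d, e) \<in> role I r" "Atom r \<in> set U"
      "smem (ex_arg x) (tp I e)" "compat (ex_role x) (tp I d) (tp I e)"
      using ex_witness[of x d] x(2) by blast
    have "(aval s, view I n e) \<in> succs I n d" if "subrole (ex_role x) s" for s
      using subrole_model[OF M e(3,4)] that e(2) by (auto simp: succs_def)
    then show "\<exists>Y\<subseteq>set types. (\<exists>t'\<in>Y. smem (ex_arg x) t' \<and> compat (ex_role x) (tp I d) t')
        \<and> (\<forall>s\<in>set SY. is_rsym s \<and> subrole (ex_role x) (cdr s) \<longrightarrow> (aval (cdr s), Y) \<in> succs I n d)"
      by (intro exI[of _ "view I n e"] conjI view_subset bexI[of _ "tp I e"] Suc.IH e ballI impI,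
        elim conjE)
  qed
qed

lemma view_reach: "d \<in> domain I \<Longrightarrow> view I n d \<in> reach n"
proof (induction n arbitrary: d)
  case 0
  then show ?case by (simp add: view_0)
next
  case (Suc n)
  have "succs I n d \<subseteq> UNIV \<times> reach n"
  proof -
    have "e \<in> domain I" if "(d, e) \<in> role I r" for e r using that interp by (auto simp: is_interp_def)
    then show ?thesis using Suc.IH unfolding succs_def by blast
  qed
  moreover have "upclosed (succs I n d)"
    unfolding upclosed_def
  proof (intro ballI allI impI, elim conjE)
    fix s s' Y assume s: "s \<in> set SY" "is_rsym s" "subrole (cdr s) (cdr s')" "(aval (cdr s), Y) \<in>
      succs I n d"
    obtain r where r: "s = enc_symb (RSym r)" "RSym r \<in> set syms" using s rsymE by blast
    then show "(aval (cdr s'), Y) \<in> succs I n d"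
      using s(3,4) subrole_model[OF M _ RSym_U[OF r(2)]] by (fastforce simp: succs_def)
  qed
  ultimately show ?case by (auto simp: view_Suc[OF interp Suc.prems])
qed

end

subsection \<open>Models from stable views\<close>

lemma reach_decreasing: "reach (Suc n) \<subseteq> reach n"
proof (induction n)
  case 0
  then show ?case by (auto simp: next_view_def)
next
  case (Suc n)
  then show ?case by (subst (1 2) reach.simps(2)) blast
qed

text \<open>The origin of the number of levels: \<open>Ys\<close> has
  \<open>2 ^ length types0\<close> members, at least as many as there are sets of types, and
  \<open>reach 0\<close> consists of the latter.\<close>

lemma reach_stable: "reach (Suc (length Ys)) = reach (length Ys)"
proof (rule decreasing_chain_stable[where G = "\<lambda>R. {next_view N Z | N Z. upclosed Z \<and> Z \<subseteq> UNIV \<times> R}"])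
  have "card (set types) \<le> length types0"
    by (rule le_trans[OF card_length]) (simp add: types_def)
  moreover have "length Ys = 2 ^ length types0" by (subst Ys_def) (simp add: length_subseqs)
  ultimately show "card (reach 0) \<le> length Ys" by (simp add: card_Pow)
qed (use reach_decreasing in auto)

text \<open>
  Needed for witnesses along roles without a superrole in \<open>\<Sigma>\<close>, where \<open>next_view\<close> imposes no condition on
  the set \<open>Y\<close>.
\<close>

lemma reach_covers: "t \<in> set types \<Longrightarrow> \<exists>Y\<in>reach n. t \<in> Y"
proof (induction n arbitrary: t)
  case 0
  then show ?case by auto
next
  case (Suc n)
  have "\<exists>t' Y. t' \<in> set types \<and> smem (ex_arg x) t' \<and> compat (ex_role x) t t' \<and> Y \<in> reach n \<and> t' \<in> Y"
    if "x \<in> set U" "is_ex x" "smem x t" for x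
    using types_witness[OF Suc.prems that] Suc.IH by blast
  then obtain t' Y where x: "\<And>x. x \<in> set U \<Longrightarrow> is_ex x \<Longrightarrow> smem x t \<Longrightarrow> t' x \<in> set types \<and> smem (ex_arg x) (t' x)
      \<and> compat (ex_role x) t (t' x) \<and> Y x \<in> reach n \<and> t' x \<in> Y x"
    by metis
  \<comment> \<open>Only the required witnesses become successors. A view \<open>Y x\<close> is
    listed along superroles of the role of \<open>x\<close>, where \<open>t' x\<close> is still
    compatible by \<open>compat_subrole\<close>.\<close>
  define Z where "Z = {(aval (cdr s), Y x) | s x. s \<in> set SY \<and> is_rsym s \<and> x \<in> set U \<and> is_ex x \<and> smem x t
    \<and> subrole (ex_role x) (cdr s)}"
  have aval: "cdr s = cdr s'" if "is_rsym s" "is_rsym s'" "aval (cdr s) = aval (cdr s')" for s s'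
    using that by (auto simp: is_rsym_def is_atom_iff)
  have Z: "\<exists>x. Y' = Y x \<and> x \<in> set U \<and> is_ex x \<and> smem x t \<and> subrole (ex_role x) (cdr s)"
    if "is_rsym s" "(aval (cdr s), Y') \<in> Z" for s Y'
    using that aval unfolding Z_def by auto metis
  have sub: "Y' \<subseteq> set types" if "Y' \<in> reach n" for Y'
  proof -
    have "reach n \<subseteq> reach 0"
      by (induction n) (use reach_decreasing in \<open>blast+\<close>)
    then show ?thesis using that by auto
  qed
  let ?N = "{a. smem (Pr (enc_nat 1) (Atom a)) t}"
  have "t \<in> next_view ?N Z"
    unfolding next_view_def
  proof (intro CollectI conjI ballI impI allI Suc.prems)
    fix s assume "s \<in> set SY" "is_csym s"
    then show "smem (Pr (enc_nat 1) (cdr s)) t = (aval (cdr s) \<in> ?N)"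
      by (auto simp: is_csym_def is_atom_iff)
  next
    fix s Y' assume "s \<in> set SY" "is_rsym s" "(aval (cdr s), Y') \<in> Z"
    then show "\<exists>t'\<in>Y'. compat (cdr s) t t'" using Z x compat_subrole by metis
  next
    fix x' assume x': "x' \<in> set U" "is_ex x' \<and> smem x' t"
    then have "(aval (cdr s), Y x') \<in> Z" if "s \<in> set SY" "is_rsym s \<and> subrole (ex_role x') (cdr s)" for s
      using that unfolding Z_def by auto
    then show "\<exists>Y\<subseteq>set types. (\<exists>t'\<in>Y. smem (ex_arg x') t' \<and> compat (ex_role x') t t')
        \<and> (\<forall>s\<in>set SY. is_rsym s \<and> subrole (ex_role x') (cdr s) \<longrightarrow> (aval (cdr s), Y) \<in> Z)"
      using x[of x'] x' sub by (intro exI[of _ "Y x'"]) blast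
  qed
  moreover have "upclosed Z"
    unfolding upclosed_def
  proof (intro ballI allI impI, elim conjE)
    fix s s' Y' assume s: "s \<in> set SY" "s' \<in> set SY" "is_rsym s" "is_rsym s'" "subrole (cdr s) (cdr
      s')" "(aval (cdr s), Y') \<in> Z"
    then show "(aval (cdr s'), Y') \<in> Z"
      using Z[OF s(3,6)] subrole_trans unfolding Z_def by blast
  qed
  moreover have "Z \<subseteq> UNIV \<times> reach n" using x unfolding Z_def by auto
  ultimately show ?case by auto
qed

lemma types_loc_ok: "t \<in> set types \<Longrightarrow> loc_ok t"
  by (auto simp: types_def types0_def)

text \<open>The points of the model are pairs of a stationary view and a type in it. The type
  determines which concepts of the input hold, while points with the same view satisfy the same
  concepts over \<Sigma>. The interpolant thus passes from \<open>(t, Y)\<close> to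
  \<open>(t', Y)\<close>.\<close>

lemma no_joint_view:
  assumes E0: "is_interpolant (set axs) C D \<Sigma> E0"
    and Y: "Y \<in> reach (length Ys)" and t: "t \<in> Y" "smem (enc_concept C) t" and t': "t' \<in> Y"
  shows "smem (enc_concept D) t'"
proof -
  let ?R = "reach (length Ys)"
  \<comment> \<open>Stationarity provides every view in \<open>?R\<close> with successor views again
    in \<open>?R\<close>, so the model closes up without unfolding levels.\<close>
  have "\<forall>Y\<in>?R. \<exists>N Z. Y = next_view N Z \<and> upclosed Z \<and> Z \<subseteq> UNIV \<times> ?R"
    using reach_stable by (auto simp: set_eq_iff)
  then obtain N Z where NZ: "\<And>Y. Y \<in> ?R \<Longrightarrow> Y = next_view (N Y) (Z Y)" "\<And>Y. Y \<in> ?R \<Longrightarrow> upclosed (Z Y)"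
    "\<And>Y. Y \<in> ?R \<Longrightarrow> Z Y \<subseteq> UNIV \<times> ?R"
    by metis
  define dom where "dom = {(t, Y). Y \<in> ?R \<and> t \<in> Y}"
  \<comment> \<open>Symbols outside the input are empty, so a symbol of \<Sigma> that the algorithm
    never saw cannot separate points. Along \<Sigma>-superroles of \<open>r\<close> the target view
    must be listed in \<open>Z Y\<close>, a condition that involves only the two views.\<close>
  define J where "J = \<lparr>domain = dom,
    conc = \<lambda>a. {(t, Y) \<in> dom. CSym a \<in> sigma0 \<and> smem (enc_concept (Name a)) t},
    role = \<lambda>r. {((t, Y), (t', Y')). (t, Y) \<in> dom \<and> (t', Y') \<in> dom \<and> RSym r \<in> sigma0 \<and> compat (Atom r) t t'
      \<and> (\<forall>s\<in>set SY. is_rsym s \<and> subrole (Atom r) (cdr s) \<longrightarrow> (aval (cdr s), Y') \<in> Z Y)}\<rparr>"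
  have dom_next: "t \<in> next_view (N Y) (Z Y)" "t \<in> set types" "Y \<in> ?R" if "(t, Y) \<in> dom" for t Y
  proof -
    show Y: "Y \<in> ?R" using that by (auto simp: dom_def)
    show "t \<in> next_view (N Y) (Z Y)" using NZ(1)[OF Y] that by (auto simp: dom_def)
    then show "t \<in> set types" by (auto simp: next_view_def)
  qed
  have J: "is_interp J"
    using Y t unfolding is_interp_def J_def dom_def by auto
  have truth: "(t, Y) \<in> ext J F \<longleftrightarrow> smem (enc_concept F) t"
    if "(t, Y) \<in> dom" "sig_concept F \<subseteq> sigma0" "enc_concept F \<in> set U" for t Y F
    using that
  proof (induction F arbitrary: t Y)
    case Top
    then show ?case using types_loc_ok[OF dom_next(2)[OF Top(1)]] by (auto simp: J_def loc_ok_def)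
  next
    case (Name a)
    then show ?case by (auto simp: J_def)
  next
    case (Neg F)
    have "enc_concept F \<in> set U" using Neg.prems(3) unfolding enc_concept.simps by (rule U_Pr(2))
    moreover have "smem (enc_concept (Neg F)) t = (\<not> smem (enc_concept F) t)"
      using types_loc_ok[OF dom_next(2)[OF Neg.prems(1)]] Neg.prems(3) unfolding loc_ok_def by force
    ultimately show ?case using Neg by (simp add: J_def)
  next
    case (And F G)
    have "Pr (enc_concept F) (enc_concept G) \<in> set U" using And.prems(3) unfolding enc_concept.simps
      by (rule U_Pr(2))
    then have "enc_concept F \<in> set U" "enc_concept G \<in> set U" by (auto dest: U_Pr)
    moreover have "smem (enc_concept (And F G)) t = (smem (enc_concept F) t \<and> smem (enc_concept G) t)"
      using types_loc_ok[OF dom_next(2)[OF And.prems(1)]] And.prems(3) unfolding loc_ok_def by force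
    ultimately show ?case using And by simp
  next
    case (Exists r F)
    let ?x = "enc_concept (Exists r F)"
    have ex: "is_ex ?x" "ex_role ?x = Atom r" "ex_arg ?x = enc_concept F"
      by (simp_all add: is_ex_def ex_role_def ex_arg_def)
    have "Pr (Atom r) (enc_concept F) \<in> set U" using Exists.prems(3) unfolding enc_concept.simps by
      (rule U_Pr(2))
    then have FU: "enc_concept F \<in> set U" by (auto dest: U_Pr)
    have r: "RSym r \<in> sigma0" "sig_concept F \<subseteq> sigma0" using Exists.prems(2) by auto
    show ?case
    proof
      assume "(t, Y) \<in> ext J (Exists r F)"
      then obtain t' Y' where "(t', Y') \<in> dom" "compat (Atom r) t t'" "(t', Y') \<in> ext J F"
        by (auto simp: J_def)
      with Exists.IH[OF _ r(2) FU] have "compat (Atom r) t t'" "smem (enc_concept F) t'" by auto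
      then show "smem ?x t" using Exists.prems(3) ex subrole_refl unfolding compat_def by metis
    next
      assume "smem ?x t"
      then obtain Y' t' where Y': "Y' \<subseteq> set types" "t' \<in> Y'" "smem (enc_concept F) t'" "compat (Atom
        r) t t'"
        "\<forall>s\<in>set SY. is_rsym s \<and> subrole (Atom r) (cdr s) \<longrightarrow> (aval (cdr s), Y') \<in> Z Y"
        using dom_next(1)[OF Exists.prems(1)] Exists.prems(3) ex unfolding next_view_def by fastforce
      have "\<exists>Y''. Y'' \<in> ?R \<and> t' \<in> Y''
        \<and> (\<forall>s\<in>set SY. is_rsym s \<and> subrole (Atom r) (cdr s) \<longrightarrow> (aval (cdr s), Y'') \<in> Z Y)"
      \<comment> \<open>With a \<Sigma>-superrole, \<open>Y'\<close> is listed in \<open>Z Y\<close>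
        and hence stationary. Otherwise nothing constrains the view of the successor, and any
        stationary view containing \<open>t'\<close> serves.\<close>
      proof (cases "\<exists>s\<in>set SY. is_rsym s \<and> subrole (Atom r) (cdr s)")
        case True
        then have "Y' \<in> ?R" using Y'(5) NZ(3)[OF dom_next(3)[OF Exists.prems(1)]] by blast
        then show ?thesis using Y' by blast
      next
        case False
        then show ?thesis using reach_covers[of t' "length Ys"] Y' by blast
      qed
      then obtain Y'' where Y'': "(t', Y'') \<in> dom"
        "\<forall>s\<in>set SY. is_rsym s \<and> subrole (Atom r) (cdr s) \<longrightarrow> (aval (cdr s), Y'') \<in> Z Y"
        by (auto simp: dom_def)
      have "((t, Y), (t', Y'')) \<in> role J r"
        using Y'' Y' r Exists.prems(1) by (simp add: J_def)
      moreover have "(t', Y'') \<in> ext J F" using Exists.IH[OF Y''(1) r(2) FU] Y'(3) by simp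
      ultimately show "(t, Y) \<in> ext J (Exists r F)" using Exists.prems(1) by (auto simp: J_def)
    qed
  qed
  have "satisfies J ax" if ax: "ax \<in> set axs" for ax
  proof (cases ax)
    case (CI F G)
    have "sig_axiom ax \<subseteq> sigma0" using ax by (auto simp: sigma0_def sig_ontology_def)
    then have sig: "sig_concept F \<subseteq> sigma0" "sig_concept G \<subseteq> sigma0" using CI by auto
    have "Pr (enc_concept F) (enc_concept G) \<in> set U" using axs_U[OF ax] unfolding CI
      enc_axiom.simps by (rule U_Pr(2))
    then have U: "enc_concept F \<in> set U" "enc_concept G \<in> set U" by (auto dest: U_Pr)
    have "(t, Y) \<in> ext J G" if "(t, Y) \<in> ext J F" for t Y
    proof -
      have d: "(t, Y) \<in> dom" using that ext_subset_dom[OF J, of F] by (auto simp: J_def)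
      have "smem (enc_concept F) t" using truth[OF d sig(1) U(1)] that by simp
      moreover have "enc_axiom (CI F G) \<in> set A" using ax CI unfolding A_def set_map by blast
      ultimately have "smem (enc_concept G) t"
        using types_loc_ok[OF dom_next(2)[OF d]] unfolding loc_ok_def by force
      then show ?thesis using truth[OF d sig(2) U(2)] by simp
    qed
    then show ?thesis using CI by auto
  next
    case (RI r s)
    then have "subrole (Atom r) (Atom s)" using ax subrole_RI by simp
    moreover have "RSym s \<in> sigma0" using ax RI by (force simp: sigma0_def sig_ontology_def)
    ultimately show ?thesis using RI compat_subrole subrole_trans by (auto simp: J_def)
  qed
  then have mod: "is_model J (set axs)" using J by (simp add: is_model_def)
  have domJ: "domain J = dom" by (simp add: J_def)
  have nameJ: "(t, Y) \<in> ext J (Name a) \<longleftrightarrow> (t, Y) \<in> dom \<and> CSym a \<in> sigma0 \<and> smem (enc_concept (Name a)) t"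
    for t Y a by (simp add: J_def)
  \<comment> \<open>Membership in a common view forces agreement on the concept names in \<Sigma>.
    For a \<Sigma>-role, the successor view \<open>Y'\<close> is listed in \<open>Z Y\<close>, so
    \<open>t'\<close> too has a compatible type in \<open>Y'\<close>; upward closure of
    \<open>Z Y\<close> supplies the edge.\<close>
  have bisim: "(t', Y) \<in> ext J E"
    if "sig_concept E \<subseteq> \<Sigma>" "(t, Y) \<in> dom" "(t', Y) \<in> dom" "(t, Y) \<in> ext J E" for t t' Y E
    using that
  proof (induction E arbitrary: t t' Y)
    case (Name a)
    then have "CSym a \<in> set syms" "smem (enc_concept (Name a)) t" "CSym a \<in> sigma0"
      unfolding nameJ by (auto simp: syms sigma0_def)
    moreover from this csymI have "smem (enc_concept (Name a)) t = smem (enc_concept (Name a)) t'"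
      using dom_next(1)[OF Name(2)] dom_next(1)[OF Name(3)] unfolding next_view_def by fastforce
    ultimately show ?case using Name(3) unfolding nameJ by blast
  next
    case (Neg E)
    show ?case using Neg.IH[of t' Y t] Neg.prems by (auto simp: domJ)
  next
    case (Exists r E)
    from Exists.prems obtain u Y' where u: "((t, Y), (u, Y')) \<in> role J r" "(u, Y') \<in> ext J E"
      by auto
    have r: "RSym r \<in> set syms" using Exists.prems(1) u(1) by (auto simp: J_def syms sigma0_def)
    have Y: "Y \<in> ?R" using dom_next(3)[OF Exists.prems(2)] .
    note s = rsymI[OF r]
    have uZ: "(r, Y') \<in> Z Y" "(u, Y') \<in> dom" "RSym r \<in> sigma0"
      using u(1) s subrole_refl by (force simp: J_def)+
    obtain u' where u': "u' \<in> Y'" "compat (Atom r) t' u'"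
      using dom_next(1)[OF Exists.prems(3)] s uZ(1) unfolding next_view_def by fastforce
    have d: "(u', Y') \<in> dom" using u'(1) uZ(2) by (auto simp: dom_def)
    have "(aval (cdr s), Y') \<in> Z Y" if "s \<in> set SY" "is_rsym s" "subrole (Atom r) (cdr s)" for s
      using NZ(2)[OF Y] rsymI[OF r] that uZ(1) unfolding upclosed_def by force
    then have "((t', Y), (u', Y')) \<in> role J r"
      using u' d Exists.prems(3) uZ(3) by (auto simp: J_def)
    moreover have "(u', Y') \<in> ext J E" using Exists.IH[OF _ uZ(2) d u(2)] Exists.prems(1) by simp
    ultimately show ?case using Exists.prems(3) by (auto simp: domJ)
  next
    case (And E F)
    show ?case using And.IH(1)[of t Y t'] And.IH(2)[of t Y t'] And.prems by auto
  qed (simp add: domJ)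
  have d: "(t, Y) \<in> dom" "(t', Y) \<in> dom" using Y t t' by (auto simp: dom_def)
  have sig: "sig_concept C \<subseteq> sigma0" "sig_concept D \<subseteq> sigma0" by (auto simp: sigma0_def)
  have "(t, Y) \<in> ext J C" using truth[OF d(1) sig(1) C_U] t by simp
  \<comment> \<open>The domain of \<open>J\<close> does not consist of natural numbers, so the
    entailments are transferred by \<open>entails_all_models\<close>.\<close>
  then have "(t, Y) \<in> ext J E0"
    using E0 entails_all_models[OF _ _ mod] by (auto simp: is_interpolant_def)
  moreover have "sig_concept E0 \<subseteq> \<Sigma>" using E0 by (simp add: is_interpolant_def)
  ultimately have "(t', Y) \<in> ext J E0" using bisim[OF _ d] by simp
  then have "(t', Y) \<in> ext J D"
    using E0 entails_all_models[OF _ _ mod] by (auto simp: is_interpolant_def)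
  then show ?thesis using truth[OF d(2) sig(2) D_U] by simp
qed

theorem prog_interpolant:
  assumes E0: "is_interpolant (set axs) C D \<Sigma> E0"
    and E: "\<And>I. is_interp (I :: nat interp) \<Longrightarrow> ext I E = ext I (exec prog (\<lambda>k. Top) (reg 1))"
  shows "entails (set axs) C E \<and> entails (set axs) E D"
proof -
  have iff: "d \<in> ext I E \<longleftrightarrow> (\<exists>t\<in>view I (length Ys) d. smem (enc_concept C) t)"
    if "is_interp I" "d \<in> domain I" for I :: "nat interp" and d
    using that unfolding E[OF that(1)] prog_ext view_def by (auto simp: c0_def split: if_splits)
  show ?thesis
    unfolding entails_def
  proof (intro conjI allI impI subsetI)
    fix I :: "nat interp" and d assume M: "is_model I (set axs)" and d: "d \<in> ext I C"
    have I: "is_interp I" using M by (simp add: is_model_def)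
    then have dI: "d \<in> domain I" using d ext_subset_dom by blast
    have "smem (enc_concept C) (tp I d)" using d C_U by (simp add: smem_tp dec_enc)
    then show "d \<in> ext I E" using iff[OF I dI] tp_view[OF M dI] by blast
  next
    fix I :: "nat interp" and d assume M: "is_model I (set axs)" and d: "d \<in> ext I E"
    have I: "is_interp I" using M by (simp add: is_model_def)
    then have dI: "d \<in> domain I" using d ext_subset_dom by blast
    obtain t where t: "t \<in> view I (length Ys) d" "smem (enc_concept C) t"
      using iff[OF I dI] d by blast
    from no_joint_view[OF E0 view_reach[OF M dI] t tp_view[OF M dI]]
    show "d \<in> ext I D" by (simp add: smem_tp dec_enc)
  qed
qed

end

section \<open>Well-formedness of the generated program\<close>

text \<open>The signature clause is relative to registers that already stay within \<open>S\<close>;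
  starting from \<open>Top\<close> everywhere, it propagates along the program.\<close>

definition good_instr :: "symb set \<Rightarrow> sexp \<Rightarrow> bool" where
  "good_instr S e \<longleftrightarrow> instr_ok e \<and> user_instr e
    \<and> (\<forall>\<rho>. (\<forall>k. sig_concept (\<rho> k) \<subseteq> S) \<longrightarrow> sig_concept (kval \<rho> (cdr e)) \<subseteq> S)"

lemma good_instr_intros:
  "user_key k \<Longrightarrow> good_instr S (i_top k)"
  "user_key k \<Longrightarrow> is_atom s \<Longrightarrow> CSym (aval s) \<in> S \<Longrightarrow> good_instr S (i_name k s)"
  "user_key k \<Longrightarrow> user_key a \<Longrightarrow> good_instr S (i_neg k a)"
  "user_key k \<Longrightarrow> user_key a \<Longrightarrow> user_key b \<Longrightarrow> good_instr S (i_and k a b)"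
  "user_key k \<Longrightarrow> is_atom r \<Longrightarrow> RSym (aval r) \<in> S \<Longrightarrow> user_key a \<Longrightarrow> good_instr S (i_ex k r a)"
  by (auto simp: good_instr_def instr_ok_intros user_instr_def instr_defs kval.simps)
    (auto simp: instr_ok_def is_atom_iff)

lemma user_key_reg [simp]: "user_key (reg i)" "user_key (reg_F t)" "user_key (reg_X Y)"
  by (simp_all add: user_key_def reg_def reg_F_def reg_X_def)

lemma good_instr_sig:
  "\<forall>e\<in>set L. good_instr S e \<Longrightarrow> \<forall>k. sig_concept (\<rho> k) \<subseteq> S \<Longrightarrow> \<forall>C\<in>vals L \<rho>. sig_concept C \<subseteq> S"
proof (induction L arbitrary: \<rho>)
  case (Cons e L)
  have e: "sig_concept (kval \<rho> (cdr e)) \<subseteq> S" using Cons.prems by (simp add: good_instr_def)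
  then have "\<forall>k. sig_concept ((\<rho>(car e := kval \<rho> (cdr e))) k) \<subseteq> S" using Cons.prems(2) by simp
  with Cons.IH[OF _ this] Cons.prems(1) e show ?case by (simp add: vals.simps(2) fun_upd_def)
qed simp

lemma (in alg) good_prog:
  assumes S: "\<And>s. s \<in> set SY \<Longrightarrow> is_csym s \<Longrightarrow> CSym (aval (cdr s)) \<in> S"
    "\<And>s. s \<in> set SY \<Longrightarrow> is_rsym s \<Longrightarrow> RSym (aval (cdr s)) \<in> S"
  shows "\<forall>e\<in>set prog. good_instr S e"
proof -
  have a: "is_atom (cdr s)" if "is_csym s \<or> is_rsym s" for s using that by (auto simp: is_csym_def
    is_rsym_def)
  note good = good_instr_intros S a
  have "e \<in> set (names_block t s) \<Longrightarrow> s \<in> set SY \<Longrightarrow> good_instr S e" for t s e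
    by (auto simp: names_block_def good split: if_splits)
  moreover have "e \<in> set (univ_block t s) \<Longrightarrow> s \<in> set SY \<Longrightarrow> good_instr S e" for t s e
    by (auto simp: univ_block_def univ_block1_def good split: if_splits)
  moreover have "e \<in> set (ex_block t x) \<Longrightarrow> good_instr S e" for t x e
    by (auto simp: ex_block_def ex_block1_def ex_block2_def good split: if_splits)
  ultimately have F: "e \<in> set (F_block t) \<Longrightarrow> good_instr S e" for t e
    by (auto simp: F_block_def good)
  have X: "e \<in> set (X_block Y) \<Longrightarrow> good_instr S e" for Y e
    by (auto simp: X_block_def X_block1_def good split: if_splits)
  have "e \<in> set level_block \<Longrightarrow> good_instr S e" for e
    using F X by (auto simp: level_block_def)
  moreover have "e \<in> set (result_block1 t) \<Longrightarrow> good_instr S e" for t e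
    by (auto simp: result_block1_def good split: if_splits)
  ultimately show ?thesis by (auto simp: prog_def good)
qed

section \<open>Inputs\<close>

lemma lst_enc_list: "lst (enc_list f xs) = map f xs"
  by (induction xs) auto

lemma enc_list_subtrees: "x \<in> set xs \<Longrightarrow> f x \<in> set (subtrees (enc_list f xs))"
  by (induction xs) (auto simp: subtrees_self)

lemma CSym_subtrees: "CSym a \<in> sig_concept C \<Longrightarrow> enc_concept (Name a) \<in> set (subtrees (enc_concept C))"
  by (induction C) auto

text \<open>Tags are unary numbers up to 4, so a symbol costs only a bounded number of
  nodes.\<close>

lemma enc_concept_size: "sexp_size (enc_concept C) \<le> 12 * concept_size C"
  by (induction C) auto

lemma enc_axiom_size: "sexp_size (enc_axiom ax) + 1 \<le> 13 * axiom_size ax"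
proof (cases ax)
  case (CI F G)
  then show ?thesis using enc_concept_size[of F] enc_concept_size[of G] by simp
qed simp

lemma card_sig_concept: "finite (sig_concept C) \<and> card (sig_concept C) \<le> concept_size C"
proof (induction C)
  case (And C D)
  then show ?case using card_Un_le[of "sig_concept C" "sig_concept D"] by simp
qed (auto simp: card_insert_if)

lemma card_sig_axiom: "finite (sig_axiom ax) \<and> card (sig_axiom ax) \<le> axiom_size ax"
proof (cases ax)
  case (CI F G)
  then show ?thesis
    using card_sig_concept[of F] card_sig_concept[of G] card_Un_le[of "sig_concept F" "sig_concept
      G"] by simp
qed (auto simp: card_insert_if)

text \<open>The bound is independent of \<Sigma>: the listed symbols are distinct and occur in the
  input, so they are no more numerous than its symbols.\<close>

lemma input_size:
  assumes "is_input \<O> C D \<Sigma> inp"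
  shows "sexp_size inp \<le> 50 * (ontology_size \<O> + concept_size C + concept_size D) + 10"
proof -
  obtain axs syms where axs: "distinct axs" "set axs = \<O>" and syms: "distinct syms"
    "set syms = \<Sigma> \<inter> (sig_ontology \<O> \<union> sig_concept C \<union> sig_concept D)"
    and inp: "inp = Pr (enc_list enc_axiom axs) (Pr (enc_concept C) (Pr (enc_concept D) (enc_list
      enc_symb syms)))"
    using assms by (auto simp: is_input_def)
  let ?n = "ontology_size \<O> + concept_size C + concept_size D"
  have "sexp_size (enc_list enc_axiom xs) \<le> 1 + 13 * (\<Sum>x\<leftarrow>xs. axiom_size x)" for xs
  proof (induction xs)
    case (Cons x xs)
    then show ?case using enc_axiom_size[of x] by simp
  qed simp
  moreover have "(\<Sum>x\<leftarrow>axs. axiom_size x) = ontology_size \<O>"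
    using axs by (simp add: ontology_size_def sum_list_distinct_conv_sum_set)
  ultimately have 1: "sexp_size (enc_list enc_axiom axs) \<le> 1 + 13 * ontology_size \<O>" by metis
  have fin: "finite (sig_ontology \<O>)"
    using axs(2) card_sig_axiom by (auto simp: sig_ontology_def)
  have "card (sig_ontology \<O>) \<le> (\<Sum>ax\<in>\<O>. card (sig_axiom ax))"
    unfolding sig_ontology_def using axs(2) by (intro card_UN_le) auto
  also have "\<dots> \<le> ontology_size \<O>"
    unfolding ontology_size_def using card_sig_axiom by (intro sum_mono) auto
  finally have "card (sig_ontology \<O>) \<le> ontology_size \<O>" .
  moreover have "card (sig_ontology \<O> \<union> sig_concept C \<union> sig_concept D)
      \<le> card (sig_ontology \<O>) + card (sig_concept C) + card (sig_concept D)"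
    using card_Un_le add_le_mono1 le_trans by blast
  moreover have "length syms \<le> card (sig_ontology \<O> \<union> sig_concept C \<union> sig_concept D)"
    unfolding distinct_card[OF syms(1), symmetric] syms(2)
    using fin card_sig_concept by (intro card_mono) auto
  ultimately have len: "length syms \<le> ?n"
    using card_sig_concept[of C] card_sig_concept[of D] by linarith
  have symb: "sexp_size (enc_symb s) \<le> 5" for s by (cases s) auto
  have "sexp_size (enc_list enc_symb xs) \<le> 1 + 6 * length xs" for xs
  proof (induction xs)
    case (Cons x xs)
    then show ?case using symb[of x] by simp
  qed simp
  then have 2: "sexp_size (enc_list enc_symb syms) \<le> 1 + 6 * ?n" using len by (meson add_left_mono
    le_trans mult_le_mono2)
  show ?thesis
    using 1 2 enc_concept_size[of C] enc_concept_size[of D] by (simp add: inp)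
qed

lemma stages_correct:
  assumes inp: "is_input \<O> C D \<Sigma> inp" and E0: "is_interpolant \<O> C D \<Sigma> E0"
  obtains E ns where "is_interpolant \<O> C D \<Sigma> E" "is_dag_of ns E"
    "stage3 (stage2 (stage1 inp)) = enc_dag ns"
proof -
  obtain axs syms where axs: "set axs = \<O>" and syms:
    "set syms = \<Sigma> \<inter> (sig_ontology \<O> \<union> sig_concept C \<union> sig_concept D)"
    and inp: "inp = Pr (enc_list enc_axiom axs) (Pr (enc_concept C) (Pr (enc_concept D) (enc_list
      enc_symb syms)))"
    using inp by (auto simp: is_input_def)
  define A where "A = map enc_axiom axs"
  define U where "U = univ inp"
  define W where "W = map slist (subseqs U)"
  define SY where "SY = map enc_symb syms"
  define Ys where "Ys = map slist (subseqs (alg.types0 A U W))"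
  let ?prog = "alg.prog A U W SY Ys (enc_concept C)"
  have closed: "y \<in> set U" if "x \<in> set U" "y \<in> set (subtrees x)" for x y
    using that subtrees_trans by (auto simp: U_def univ_def)
  have parts: "enc_list enc_axiom axs \<in> set U" "enc_concept C \<in> set U" "enc_concept D \<in> set U"
      "enc_list enc_symb syms \<in> set U"
    by (auto simp: U_def univ_def inp subtrees_self)
  have axU: "enc_axiom ax \<in> set U" if "ax \<in> set axs" for ax
    using closed[OF parts(1)] enc_list_subtrees[OF that] by auto
  have CU: "enc_concept (Name a) \<in> set U" if "CSym a \<in> set syms" for a
  proof -
    have sub: "enc_concept (Name a) \<in> set U" if "CSym a \<in> sig_concept F" "enc_concept F \<in> set U" for F
      using closed[OF that(2)] CSym_subtrees[OF that(1)] by auto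
    have "CSym a \<in> sig_ontology (set axs) \<union> sig_concept C \<union> sig_concept D"
      using that unfolding syms axs by blast
    then consider "CSym a \<in> sig_ontology (set axs)" | "CSym a \<in> sig_concept C" | "CSym a \<in> sig_concept D"
      by blast
    then show ?thesis
    proof cases
      case 1
      then obtain ax where ax: "ax \<in> set axs" "CSym a \<in> sig_axiom ax" by (auto simp: sig_ontology_def)
      from ax(2) obtain F G where FG: "ax = CI F G" by (cases ax) auto
      have "enc_concept F \<in> set U" "enc_concept G \<in> set U"
        by (rule closed[OF axU[OF ax(1)]]; simp add: FG subtrees_self)+
      then show ?thesis using ax(2) FG sub by auto
    qed (use sub parts in auto)
  qed
  have RU: "Atom r \<in> set U" if "RSym r \<in> set syms" for r
    using closed[OF closed[OF parts(4) enc_list_subtrees[OF that]], of "Atom r"] by simp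
  interpret mosaic A U W SY Ys "enc_concept C" axs C D syms \<Sigma>
  proof
    show "Nl \<in> set U" by (simp add: U_def univ_def)
  qed (use closed axU parts CU RU syms axs in \<open>auto simp: A_def W_def SY_def Ys_def\<close>)
  have good: "\<forall>e\<in>set prog. good_instr \<Sigma> e"
  proof (rule good_prog)
    show "CSym (aval (cdr s)) \<in> \<Sigma>" if "s \<in> set SY" "is_csym s" for s
      using csymE[OF that] syms by force
    show "RSym (aval (cdr s)) \<in> \<Sigma>" if "s \<in> set SY" "is_rsym s" for s
      using rsymE[OF that] syms by force
  qed
  obtain E ns where E: "slist (hashcons (pad (reg 1) prog)) = enc_dag ns" "is_dag_of ns E"
    "sig_concept E \<subseteq> \<Sigma>"
    "\<And>I. is_interp (I :: nat interp) \<Longrightarrow> ext I E = ext I (exec prog (\<lambda>k. Top) (reg 1))"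
    by (rule hashcons_pad[of prog "reg 1" \<Sigma>])
      (use good good_instr_sig[OF good, of "\<lambda>k. Top"] in \<open>auto simp: good_instr_def\<close>)
  have "is_interpolant \<O> C D \<Sigma> E"
    using prog_interpolant[OF _ E(4)] E0 E(3) axs by (simp add: is_interpolant_def)
  moreover have "stage3 (stage2 (stage1 inp)) = slist (hashcons (pad (reg 1) prog))"
    unfolding stage1_def stage2_def stage3_def U_def[symmetric] car.simps cdr.simps lst_slist
      W_def[symmetric]
    by (simp add: inp lst_enc_list A_def[symmetric] SY_def[symmetric] Ys_def[symmetric]
        U_def[unfolded inp, symmetric] W_def[symmetric])
  ultimately show ?thesis using that E by metis
qed

text \<open>The entry point has to be function 0, so a caller is put in front of the shifted
  program.\<close>

lemma timed_computes:
  assumes "timed F T"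
  shows "\<exists>P. \<forall>z. \<exists>t\<le>sexp_size z + T (sexp_size z) + 1. computes P z (F z) t"
proof -
  obtain P f where P: "runs P f F T" using assms by (auto simp: timed_def)
  define P' where "P' = [Call (f + 1) [Arg 0]] @ map (shift 1) P"
  have "runs P' (f + 1) F T"
    using runs_shift[OF P, of "[Call (f + 1) [Arg 0]]"] by (simp add: P'_def)
  from runs_call[OF this evaluates_Arg0] have
    "\<exists>t\<le>T (sexp_size z). evaluates P' [z] (P' ! 0) (F z) (sexp_size z + t + 1)" for z
    by (simp add: P'_def)
  then have "\<exists>t\<le>sexp_size z + T (sexp_size z) + 1. computes P' z (F z) t" for z
    unfolding computes_def by (metis P'_def add_le_mono add_left_mono append_Cons le_refl list.distinct(1))
  then show ?thesis by blast
qed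

lemma double_exp_bound: "m + 2 ^ 2 ^ a + 1 \<le> (2::nat) ^ 2 ^ (a + m + 1)"
proof -
  \<comment> \<open>Applied twice: with \<open>x = 2 ^ 2 ^ a\<close> the summand \<open>m\<close>
    moves into the first exponent, with \<open>x = 2 ^ a\<close> from there into the second.\<close>
  have *: "m + x + 1 \<le> 2 ^ (m + 1) * x" if "1 \<le> x" for x :: nat
  proof -
    have "m \<le> m * x" "(m + 2) * x = m * x + 2 * x" using that by (simp_all add: add_mult_distrib)
    then have "m + x + 1 \<le> (m + 2) * x" using that by linarith
    also have "m + 2 \<le> 2 ^ (m + 1)" by (induction m) auto
    finally show ?thesis by simp
  qed
  have "m + 2 ^ 2 ^ a + 1 \<le> 2 ^ (m + 1) * (2::nat) ^ 2 ^ a" by (rule *) simp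
  also have "\<dots> = 2 ^ (m + 1 + 2 ^ a)" by (rule power_add[symmetric])
  also have "\<dots> \<le> 2 ^ 2 ^ (a + m + 1)"
    using *[of "2 ^ a"] by (intro power_increasing) (simp_all add: power_add mult.commute)
  finally show ?thesis .
qed

theorem theorem2:
  shows "\<exists>(P :: program) (p :: nat poly).
    \<forall>(\<O> :: ontology) (C\<^sub>0 :: concept) (D\<^sub>0 :: concept) (\<Sigma> :: symb set) (inp :: sexp).
      finite \<O> \<longrightarrow> is_input \<O> C\<^sub>0 D\<^sub>0 \<Sigma> inp \<longrightarrow> (\<exists>E. is_interpolant \<O> C\<^sub>0 D\<^sub>0 \<Sigma> E) \<longrightarrow>
        (\<exists>E ns t. is_interpolant \<O> C\<^sub>0 D\<^sub>0 \<Sigma> E \<and> is_dag_of ns E \<and>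
          computes P inp (enc_dag ns) t \<and>
          at_most_double_exponential p
            (ontology_size \<O> + concept_size C\<^sub>0 + concept_size D\<^sub>0) t)"
proof -
  obtain q where q: "timed (\<lambda>z. stage3 (stage2 (stage1 z))) (\<lambda>n. 2 ^ 2 ^ poly q n)"
    using timed_stages by blast
  obtain P where P: "\<And>z. \<exists>t\<le>sexp_size z + 2 ^ 2 ^ poly q (sexp_size z) + 1.
      computes P z (stage3 (stage2 (stage1 z))) t"
    using timed_computes[OF q] by blast
  \<comment> \<open>The input has size at most \<open>50 * n + 10\<close>. Composition with
    \<open>q\<close> accounts for the stages, and the added \<open>50 * n + 11\<close> is the
    \<open>m + 1\<close> from \<open>double_exp_bound\<close>.\<close>
  define p where "p = pcompose q [:10, 50:] + [:11, 50:]"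
  have bound: "at_most_double_exponential p n t"
    if "t \<le> m + 2 ^ 2 ^ poly q m + 1" "m \<le> 50 * n + 10" for n m t
  proof -
    let ?m = "50 * n + 10"
    have "(2::nat) ^ 2 ^ poly q m \<le> 2 ^ 2 ^ poly q ?m"
      by (intro power_increasing poly_mono_nat that(2)) auto
    then have "t \<le> ?m + 2 ^ 2 ^ poly q ?m + 1" using that by linarith
    also have "\<dots> \<le> 2 ^ 2 ^ (poly q ?m + ?m + 1)" by (rule double_exp_bound)
    also have "poly q ?m + ?m + 1 = poly p n" by (simp add: p_def poly_pcompose algebra_simps)
    finally show ?thesis by (simp add: at_most_double_exponential_def)
  qed
  show ?thesis
  proof (intro exI[of _ P] exI[of _ p] allI impI)
    fix \<O> C D \<Sigma> inp
    assume inp: "is_input \<O> C D \<Sigma> inp" and "\<exists>E. is_interpolant \<O> C D \<Sigma> E"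
    then obtain E0 where "is_interpolant \<O> C D \<Sigma> E0" by blast
    from stages_correct[OF inp this] obtain E ns where E: "is_interpolant \<O> C D \<Sigma> E" "is_dag_of ns E"
      "stage3 (stage2 (stage1 inp)) = enc_dag ns" by blast
    obtain t where t: "t \<le> sexp_size inp + 2 ^ 2 ^ poly q (sexp_size inp) + 1"
      "computes P inp (enc_dag ns) t" using P[of inp] E(3) by auto
    show "\<exists>E ns t. is_interpolant \<O> C D \<Sigma> E \<and> is_dag_of ns E \<and> computes P inp (enc_dag ns) t \<and>
        at_most_double_exponential p (ontology_size \<O> + concept_size C + concept_size D) t"
      using E t(2) bound[OF t(1) input_size[OF inp]] by blast
  qed
qed

end
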